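(* If $\mathcal{C}$ is a geometric polytopal $3$-complex that can be built by geometric handle additions to a $3$-polytope so that its boundary is homeomorphic to a surface of genus $g$, then $$\chi_\alpha(\mathcal{C})=1-g.$$
   Context: A polytopal complex is a finite collection of convex polytopes, closed under taking faces, such that the intersection of any two members is a face of both. A geometric polytopal $d$-complex $\mathcal{C}$ is a polytopal complex that is connected, pure of dimension $d$, and embedded in $\mathbb{R}^d$ (its cells are actual convex polytopes in $\mathbb{R}^d$). $|\mathcal{C}|$ is the union of the cells, $\mathrm{int}(\mathcal{C})$ its $d$-dimensional interior, and $\partial\mathcal{C}$ the complex of boundary faces. For a nonempty $F\in\partial\mathcal{C}$, $\alpha(F,\mathcal{C})=\mathrm{vol}(S_\varepsilon(x)\cap\mathrm{int}(\mathcal{C}))/\mathrm{vol}(S_\varepsilon(x))$, with $x$ in the relative interior of $F$ and $S_\varepsilon(x)$ the $(d-1)$-sphere of radius $\varepsilon$ centered at $x$, $\varepsilon>0$ sufficiently small. For $0\le i\le d-1$, $\alpha_i(\mathcal{C})=\sum\alpha(F,\mathcal{C})$ over all $i$-faces $F$ of $\partial\mathcal{C}$; $\chi_\alpha(\mathcal{C})=\sum_{i=0}^{d-1}(-1)^i\alpha_i(\mathcal{C})$. A gluing $\mathcal{A}\oplus\mathcal{B}$ of two $d$-complexes is their union, where $\mathcal{A},\mathcal{B}$ meet exactly along a common subcomplex $\mathcal{A}\cap\mathcal{B}$ contained in both $\partial\mathcal{A}$ and $\partial\mathcal{B}$. A complex $\mathcal{C}'$ is obtained from $\mathcal{C}$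 by a geometric handle addition if $\mathcal{C}'=\mathcal{C}\oplus\mathcal{B}$ with $\mathcal{B}$ a geometric polytopal complex homeomorphic to a $d$-ball and $\mathcal{C}\cap\mathcal{B}$ the union of two disjoint subcomplexes homeomorphic to $(d-1)$-balls. Here $d=3$. Genus $g$ refers to closed orientable surfaces, with Euler characteristic $2-2g$. *)

theory Defs
  imports "HOL-Analysis.Analysis" "HOL-Homology.Homology"
begin

section \<open>Geometric polytopal complexes\<close>

text \<open>
  In the library \<^term>\<open>{}\<close> is a face of every convex set, so every nonempty complex contains the
  empty cell, whose \<^const>\<open>aff_dim\<close> is \<open>-1\<close>.
\<close>

definition face_closed :: "'a::euclidean_space set set \<Rightarrow> bool" where
  "face_closed \<C> \<longleftrightarrow> (\<forall>P\<in>\<C>. \<forall>F. F face_of P \<longrightarrow> F \<in> \<C>)"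

definition polytopal_complex :: "'a::euclidean_space set set \<Rightarrow> bool" where
  "polytopal_complex \<C> \<longleftrightarrow>
     finite \<C> \<and> (\<forall>P\<in>\<C>. polytope P) \<and> face_closed \<C> \<and>
     (\<forall>P\<in>\<C>. \<forall>Q\<in>\<C>. (P \<inter> Q) face_of P \<and> (P \<inter> Q) face_of Q)"

definition subcomplex :: "'a::euclidean_space set set \<Rightarrow> 'a set set \<Rightarrow> bool" where
  "subcomplex \<D> \<C> \<longleftrightarrow> \<D> \<subseteq> \<C> \<and> face_closed \<D>"

text \<open>
  The dimension \<open>d\<close> of a geometric complex is that of the ambient space, \<open>d = DIM('a)\<close>.
  The underlying space \<open>|\<C>|\<close> is written \<^term>\<open>\<Union>\<C>\<close>.
\<close>

definition geometric_complex :: "'a::euclidean_space set set \<Rightarrow> bool" where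
  "geometric_complex \<C> \<longleftrightarrow>
     polytopal_complex \<C> \<and> \<C> \<noteq> {} \<and> connected (\<Union>\<C>) \<and>
     (\<forall>F\<in>\<C>. \<exists>P\<in>\<C>. aff_dim P = int DIM('a) \<and> F face_of P)"

definition boundary_complex :: "'a::euclidean_space set set \<Rightarrow> 'a set set" where
  "boundary_complex \<C> = {F \<in> \<C>. F \<subseteq> frontier (\<Union>\<C>)}"

section \<open>Solid angles\<close>

text \<open>
  The \<open>(d-1)\<close>-dimensional volume of a subset \<open>A\<close> of the sphere of radius \<open>\<epsilon>\<close> about \<open>x\<close>: the usual
  polar-coordinates surface measure, i.e. \<open>d / \<epsilon>\<close> times the \<open>d\<close>-dimensional Lebesgue measure of
  the cone over \<open>A\<close> with apex \<open>x\<close>.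
\<close>

definition sphere_vol :: "'a::euclidean_space \<Rightarrow> real \<Rightarrow> 'a set \<Rightarrow> real" where
  "sphere_vol x \<epsilon> A =
     real DIM('a) / \<epsilon> * measure lebesgue {x + t *\<^sub>R (y - x) | t y. 0 \<le> t \<and> t \<le> 1 \<and> y \<in> A}"

definition angle_ratio :: "'a::euclidean_space set set \<Rightarrow> 'a \<Rightarrow> real \<Rightarrow> real" where
  "angle_ratio \<C> x \<epsilon> =
     sphere_vol x \<epsilon> (sphere x \<epsilon> \<inter> interior (\<Union>\<C>)) / sphere_vol x \<epsilon> (sphere x \<epsilon>)"

text \<open>
  \<open>\<alpha>(F, \<C>)\<close> is the common value of the ratio for all \<open>x\<close> in the relative interior of \<open>F\<close> and all
  sufficiently small \<open>\<epsilon> > 0\<close> (depending on \<open>x\<close>); meant for nonempty \<open>F\<close> in the boundary complex.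
\<close>

definition solid_angle :: "'a::euclidean_space set \<Rightarrow> 'a set set \<Rightarrow> real" where
  "solid_angle F \<C> =
     (THE a. \<forall>x\<in>rel_interior F. \<forall>\<^sub>F \<epsilon> in at_right 0. angle_ratio \<C> x \<epsilon> = a)"

definition angle_sum :: "nat \<Rightarrow> 'a::euclidean_space set set \<Rightarrow> real" where
  "angle_sum i \<C> = (\<Sum>F \<in> {F \<in> boundary_complex \<C>. aff_dim F = int i}. solid_angle F \<C>)"

definition chi_alpha :: "'a::euclidean_space set set \<Rightarrow> real" where
  "chi_alpha \<C> = (\<Sum>i<DIM('a). (- 1) ^ i * angle_sum i \<C>)"

section \<open>Gluings and handle additions\<close>

text \<open>
  \<open>\<A>\<close> and \<open>\<B>\<close> meet exactly along the common subcomplex \<open>\<A> \<inter> \<B>\<close>: the underlying spaces share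
  no point outside the common cells.
\<close>

definition is_gluing ::
    "'a::euclidean_space set set \<Rightarrow> 'a set set \<Rightarrow> 'a set set \<Rightarrow> bool" where
  "is_gluing \<C>' \<A> \<B> \<longleftrightarrow>
     geometric_complex \<A> \<and> geometric_complex \<B> \<and> \<C>' = \<A> \<union> \<B> \<and>
     \<Union>\<A> \<inter> \<Union>\<B> = \<Union>(\<A> \<inter> \<B>) \<and>
     \<A> \<inter> \<B> \<subseteq> boundary_complex \<A> \<and> \<A> \<inter> \<B> \<subseteq> boundary_complex \<B>"

text \<open>The model \<open>k\<close>-ball is the closed unit ball of a \<open>k\<close>-dimensional subspace of \<open>'a\<close>.\<close>

definition homeomorphic_to_ball :: "nat \<Rightarrow> 'a::euclidean_space set \<Rightarrow> bool" where
  "homeomorphic_to_ball k S \<longleftrightarrow>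
     (\<exists>T::'a set. subspace T \<and> dim T = k \<and> S homeomorphic (cball 0 1 \<inter> T))"

text \<open>
  Subcomplexes all contain the empty cell, so disjointness of two of them refers to their
  underlying spaces.
\<close>

definition handle_addition :: "'a::euclidean_space set set \<Rightarrow> 'a set set \<Rightarrow> bool" where
  "handle_addition \<C> \<C>' \<longleftrightarrow>
     (\<exists>\<B>. is_gluing \<C>' \<C> \<B> \<and> homeomorphic_to_ball DIM('a) (\<Union>\<B>) \<and>
       (\<exists>\<D>\<^sub>1 \<D>\<^sub>2. subcomplex \<D>\<^sub>1 (\<C> \<inter> \<B>) \<and> subcomplex \<D>\<^sub>2 (\<C> \<inter> \<B>) \<and>
          \<C> \<inter> \<B> = \<D>\<^sub>1 \<union> \<D>\<^sub>2 \<and> \<Union>\<D>\<^sub>1 \<inter> \<Union>\<D>\<^sub>2 = {} \<and>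
          homeomorphic_to_ball (DIM('a) - 1) (\<Union>\<D>\<^sub>1) \<and>
          homeomorphic_to_ball (DIM('a) - 1) (\<Union>\<D>\<^sub>2)))"

inductive built_by_handles :: "'a::euclidean_space set set \<Rightarrow> bool" where
  polytope: "polytope (P :: 'a set) \<Longrightarrow> aff_dim P = int DIM('a) \<Longrightarrow>
    built_by_handles {F. F face_of P}"
| handle: "built_by_handles \<C> \<Longrightarrow> handle_addition \<C> \<C>' \<Longrightarrow> built_by_handles \<C>'"

section \<open>Closed orientable surfaces of genus \<open>g\<close>\<close>

definition topological_manifold :: "nat \<Rightarrow> 'a topology \<Rightarrow> bool" where
  "topological_manifold n X \<longleftrightarrow>
     Hausdorff_space X \<and> second_countable X \<and>
     (\<forall>x\<in>topspace X. \<exists>U. openin X U \<and> x \<in> U \<and>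
        subtopology X U homeomorphic_space Euclidean_space n)"

text \<open>
  An orientation chooses a generator \<open>\<mu> x\<close> of each local homology group \<open>H\<^sub>n(X, X - {x})\<close> such that,
  near every point, the \<open>\<mu> y\<close> are the restrictions of a single class of \<open>H\<^sub>n(X, X - U)\<close>.
\<close>

definition orientable_manifold :: "nat \<Rightarrow> 'a topology \<Rightarrow> bool" where
  "orientable_manifold n X \<longleftrightarrow> topological_manifold n X \<and>
     (\<exists>\<mu>. (\<forall>x\<in>topspace X.
             \<mu> x \<in> carrier (relative_homology_group (int n) X (topspace X - {x})) \<and>
             generate (relative_homology_group (int n) X (topspace X - {x})) {\<mu> x} =
               carrier (relative_homology_group (int n) X (topspace X - {x}))) \<and>
          (\<forall>x\<in>topspace X. \<exists>U m. openin X U \<and> x \<in> U \<and>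
             m \<in> carrier (relative_homology_group (int n) X (topspace X - U)) \<and>
             (\<forall>y\<in>U. hom_induced (int n) X (topspace X - U) X (topspace X - {y}) id m = \<mu> y)))"

text \<open>
  The rank of an abelian group is the largest number of \<open>\<int>\<close>-independent elements; it is meant for
  groups in which this number is bounded, as for the homology groups of closed manifolds.
\<close>

definition int_independent :: "('a, 'b) monoid_scheme \<Rightarrow> 'a set \<Rightarrow> bool" where
  "int_independent G A \<longleftrightarrow> finite A \<and> A \<subseteq> carrier G \<and>
     (\<forall>c :: 'a \<Rightarrow> int. finprod G (\<lambda>a. a [^]\<^bsub>G\<^esub> c a) A = \<one>\<^bsub>G\<^esub> \<longrightarrow> (\<forall>a\<in>A. c a = 0))"

definition group_rank :: "('a, 'b) monoid_scheme \<Rightarrow> nat" where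
  "group_rank G = Sup {card A | A. int_independent G A}"

text \<open>
  The alternating sum of the Betti numbers in singular homology, meant for spaces with only finitely
  many nonzero Betti numbers (an infinite sum would be \<open>0\<close>).
\<close>

definition euler_char :: "'a topology \<Rightarrow> int" where
  "euler_char X =
     (\<Sum>n | group_rank (homology_group (int n) X) \<noteq> 0.
        (- 1) ^ n * int (group_rank (homology_group (int n) X)))"

definition closed_orientable_surface :: "nat \<Rightarrow> 'a topology \<Rightarrow> bool" where
  "closed_orientable_surface g X \<longleftrightarrow>
     topspace X \<noteq> {} \<and> compact_space X \<and> connected_space X \<and> orientable_manifold 2 X \<and>
     euler_char X = 2 - 2 * int g"

end

theory Submission
  imports Defs
begin

text \<open>
  Let \<open>\<chi>\<close> denote the alternating number of nonempty cells of a complex. For a polytope \<open>P\<close> and a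
  direction \<open>u \<noteq> 0\<close>, the points of \<open>P\<close> from which \<open>u\<close> points into the interior form a union of
  relatively open faces that meets every line parallel to \<open>u\<close> in a half-open segment, hence has Euler
  characteristic 0. Averaging over \<open>u\<close> gives Gram's relation for \<open>P\<close>; summing over the cells
  of \<open>\<C>\<close>, where the angles at an interior face add up to 1, gives \<open>\<chi>\<^sub>\<alpha>(\<C>) = \<chi>(\<partial>\<C>) - \<chi>(\<C>)\<close>.

  Write \<open>\<lambda>(F)\<close> for the alternating number of cells containing \<open>F\<close>. It is \<open>-1\<close> at interior faces. At boundary
  faces it is at most 0 because a handle addition satisfies
  \<open>\<lambda>(\<C>') = \<lambda>(\<C>) + \<lambda>(\<B>) - \<lambda>(\<D>)\<close> with \<open>\<lambda>(\<B>) = 0\<close> for a ball and \<open>\<lambda>(\<D>) \<ge> 0\<close> for a disc, and at least 0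
  because the link is a connected proper part of a sphere. Hence \<open>\<lambda>\<close> vanishes on the boundary, and
  \<open>\<chi>(\<C>) = \<Sum> (-1)\<^bsup>dim F\<^esup> \<lambda>(F) = \<chi>(\<partial>\<C>) - \<chi>(\<C>)\<close>. So \<open>\<chi>\<^sub>\<alpha>(\<C>) = \<chi>(\<partial>\<C>) / 2 = 1 - g\<close>; here \<open>\<chi>(\<partial>\<C>)\<close> is
  the singular Euler characteristic, by excision and induction on the number of cells.
\<close>

subsection \<open>Ranks of abelian groups\<close>

text \<open>The counts \<open>star_sum\<close> are defined by cells, yet they are topological: the
  cells avoiding \<open>x\<close> form a deformation retract of the space minus \<open>x\<close>, so
  \<open>star_sum\<close> is the Euler characteristic of the space minus that of the punctured
  space. This admits balls and discs that are known only up to homeomorphism. The obstacle is a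
  point interior to a gluing disc: there the disc contributes 1, and the counts alone do not show
  that such a point has left the frontier of the union. Hence the induction over handles keeps only
  an inequality, together with connectedness of the punctured star, and the opposite inequality
  comes from the position of the cells in space. Two Euler characteristics occur: that of singular
  homology, which sees the genus, and a finitely additive valuation on convex sets, which accepts
  relatively open cells and yields the relations of Euler and Gram by slicing. Angles are shares of
  Lebesgue measure in small balls, so directions are averaged over the unit ball instead of the
  sphere.\<close>

definition int_comb :: "('a, 'b) monoid_scheme \<Rightarrow> 'i set \<Rightarrow> ('i \<Rightarrow> int) \<Rightarrow> ('i \<Rightarrow> 'a) \<Rightarrow> 'a" where
  "int_comb G I c b = finprod G (\<lambda>i. b i [^]\<^bsub>G\<^esub> c i) I"

lemma int_comb_closed [simp]:
  assumes "comm_group G" "b \<in> I \<rightarrow> carrier G"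
  shows "int_comb G I c b \<in> carrier G"
proof -
  interpret comm_group G by fact
  show ?thesis using assms(2) unfolding int_comb_def by (intro finprod_closed) auto
qed

lemma int_comb_cong:
  assumes "comm_group G" "b \<in> I \<rightarrow> carrier G"
    and "\<And>i. i \<in> I \<Longrightarrow> c i = c' i" "\<And>i. i \<in> I \<Longrightarrow> b i = b' i"
  shows "int_comb G I c b = int_comb G I c' b'"
proof -
  interpret comm_group G by fact
  show ?thesis
    using assms(2-) unfolding int_comb_def
    by (intro finprod_cong') (auto simp: Pi_iff)
qed

lemma int_comb_empty [simp]: "comm_group G \<Longrightarrow> int_comb G {} c b = \<one>\<^bsub>G\<^esub>"
  by (simp add: int_comb_def comm_group.axioms(1) comm_monoid.finprod_empty)

lemma int_comb_insert:
  assumes "comm_group G" "finite I" "i \<notin> I" "b \<in> insert i I \<rightarrow> carrier G"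
  shows "int_comb G (insert i I) c b = b i [^]\<^bsub>G\<^esub> c i \<otimes>\<^bsub>G\<^esub> int_comb G I c b"
proof -
  interpret comm_group G by fact
  show ?thesis
    using assms(2-) unfolding int_comb_def by (subst finprod_insert) auto
qed

lemma int_comb_add:
  assumes "comm_group G" "b \<in> I \<rightarrow> carrier G"
  shows "int_comb G I (\<lambda>i. c i + d i) b = int_comb G I c b \<otimes>\<^bsub>G\<^esub> int_comb G I d b"
proof -
  interpret comm_group G by fact
  have "int_comb G I (\<lambda>i. c i + d i) b
      = finprod G (\<lambda>i. b i [^]\<^bsub>G\<^esub> c i \<otimes>\<^bsub>G\<^esub> b i [^]\<^bsub>G\<^esub> d i) I"
    using assms(2) unfolding int_comb_def by (intro finprod_cong') (auto simp: int_pow_mult Pi_iff)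
  also have "\<dots> = int_comb G I c b \<otimes>\<^bsub>G\<^esub> int_comb G I d b"
    using assms(2) unfolding int_comb_def by (intro finprod_multf) auto
  finally show ?thesis .
qed

lemma int_comb_scale:
  assumes "comm_group G" "finite I" "b \<in> I \<rightarrow> carrier G"
  shows "int_comb G I c b [^]\<^bsub>G\<^esub> (e::int) = int_comb G I (\<lambda>i. e * c i) b"
  using assms(2,3)
proof (induction I)
  case empty
  interpret comm_group G by fact
  show ?case using assms(1) by simp
next
  case (insert i I)
  interpret comm_group G by fact
  have [simp]: "int_comb G I c b \<in> carrier G" "b i \<in> carrier G"
    using insert.prems assms(1) by auto
  have "int_comb G I c b [^]\<^bsub>G\<^esub> (e::int) = int_comb G I (\<lambda>i. e * c i) b"
    using insert by auto
  then show ?case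
    using insert assms(1)
    by (simp add: int_comb_insert int_pow_distrib int_pow_pow mult.commute)
qed

text \<open>Coefficients compose like matrices. In the rank computation this rewrites a relation
  between kernel elements as a relation between the members of the original family.\<close>

lemma int_comb_nested:
  assumes "comm_group G" "finite I" "finite K" "b \<in> I \<rightarrow> carrier G"
  shows "int_comb G K e (\<lambda>k. int_comb G I (C k) b) = int_comb G I (\<lambda>i. \<Sum>k\<in>K. e k * C k i) b"
  using assms(3)
proof (induction K)
  case empty
  interpret comm_group G by fact
  show ?case by (simp add: int_comb_def finprod_one_eqI)
next
  case (insert k K)
  have "int_comb G (insert k K) e (\<lambda>k. int_comb G I (C k) b)
      = int_comb G I (C k) b [^]\<^bsub>G\<^esub> e k \<otimes>\<^bsub>G\<^esub> int_comb G K e (\<lambda>k. int_comb G I (C k) b)"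
    using insert assms by (intro int_comb_insert) auto
  also have "\<dots> = int_comb G I (\<lambda>i. \<Sum>k\<in>insert k K. e k * C k i) b"
    using insert assms by (simp add: int_comb_scale int_comb_add)
  finally show ?case .
qed

lemma hom_int_comb:
  assumes "comm_group G" "comm_group H" "\<phi> \<in> hom G H" "finite I" "b \<in> I \<rightarrow> carrier G"
  shows "\<phi> (int_comb G I c b) = int_comb H I c (\<phi> \<circ> b)"
  using assms(4,5)
proof (induction I)
  case empty
  interpret G: comm_group G by fact
  interpret H: comm_group H by fact
  show ?case using assms by (simp add: hom_one)
next
  case (insert i I)
  interpret G: comm_group G by fact
  interpret H: comm_group H by fact
  have b: "b i \<in> carrier G" "int_comb G I c b \<in> carrier G"
    using insert.prems assms(1) by auto
  have "\<phi> (int_comb G (insert i I) c b)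
     = \<phi> (b i [^]\<^bsub>G\<^esub> c i) \<otimes>\<^bsub>H\<^esub> \<phi> (int_comb G I c b)"
    using insert assms b by (simp add: int_comb_insert hom_mult)
  also have "\<phi> (b i [^]\<^bsub>G\<^esub> c i) = \<phi> (b i) [^]\<^bsub>H\<^esub> c i"
    using assms b by (intro hom_int_pow) auto
  also have "\<phi> (int_comb G I c b) = int_comb H I c (\<phi> \<circ> b)"
    using insert.IH insert.prems by blast
  also have "\<phi> (b i) [^]\<^bsub>H\<^esub> c i \<otimes>\<^bsub>H\<^esub> \<dots> = int_comb H (insert i I) c (\<phi> \<circ> b)"
    using insert assms(2) hom_carrier[OF assms(3)]
    by (subst int_comb_insert) (auto simp: Pi_iff)
  finally show ?case .
qed

lemma int_comb_Un:
  assumes "comm_group G" "finite I" "finite J" "I \<inter> J = {}" "b \<in> I \<union> J \<rightarrow> carrier G"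
  shows "int_comb G (I \<union> J) c b = int_comb G I c b \<otimes>\<^bsub>G\<^esub> int_comb G J c b"
proof -
  interpret comm_group G by fact
  show ?thesis
    using assms(2-) unfolding int_comb_def by (intro finprod_Un_disjoint) auto
qed

lemma int_comb_reindex:
  assumes "comm_group G" "inj_on h J" "b \<in> h ` J \<rightarrow> carrier G"
  shows "int_comb G J (c \<circ> h) (b \<circ> h) = int_comb G (h ` J) c b"
proof -
  interpret comm_group G by fact
  show ?thesis
    using assms(2-) unfolding int_comb_def o_def by (subst finprod_reindex) auto
qed

text \<open>Independence of a family instead of a set: a homomorphism may identify elements, and a
  family keeps them apart, so that images and preimages share one index set.\<close>

definition int_indep :: "('a, 'b) monoid_scheme \<Rightarrow> 'i set \<Rightarrow> ('i \<Rightarrow> 'a) \<Rightarrow> bool" where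
  "int_indep G I b \<longleftrightarrow> finite I \<and> b \<in> I \<rightarrow> carrier G \<and>
     (\<forall>c. int_comb G I c b = \<one>\<^bsub>G\<^esub> \<longrightarrow> (\<forall>i\<in>I. c i = 0))"

lemma int_independent_iff: "int_independent G A \<longleftrightarrow> int_indep G A (\<lambda>a. a)"
  by (auto simp: int_independent_def int_indep_def int_comb_def)

lemma int_indep_subset:
  assumes "comm_group G" "int_indep G I b" "J \<subseteq> I"
  shows "int_indep G J b"
  unfolding int_indep_def
proof (intro conjI allI impI ballI)
  interpret comm_group G by fact
  show fin: "finite J" and b: "b \<in> J \<rightarrow> carrier G"
    using assms unfolding int_indep_def by (auto intro: finite_subset)
  fix c j assume c: "int_comb G J c b = \<one>\<^bsub>G\<^esub>" and j: "j \<in> J"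
  \<comment> \<open>Extension by zero turns a relation over \<open>J\<close> into one over
    \<open>I\<close>.\<close>
  define d where "d = (\<lambda>i. if i \<in> J then c i else 0)"
  have "int_comb G (J \<union> (I - J)) d b = int_comb G J d b \<otimes>\<^bsub>G\<^esub> int_comb G (I - J) d b"
    using assms fin unfolding int_indep_def by (intro int_comb_Un) auto
  also have "int_comb G J d b = \<one>\<^bsub>G\<^esub>"
    unfolding c[symmetric] by (rule int_comb_cong) (use assms b in \<open>auto simp: d_def\<close>)
  also have "int_comb G (I - J) d b = \<one>\<^bsub>G\<^esub>"
    unfolding int_comb_def by (rule finprod_one_eqI) (auto simp: d_def)
  finally have "int_comb G I d b = \<one>\<^bsub>G\<^esub>"
    using assms(3) by (simp add: Un_absorb1)
  then have "d j = 0" using assms(2,3) j unfolding int_indep_def by blast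
  then show "c j = 0" using j by (simp add: d_def)
qed

lemma int_indep_reindex:
  assumes "comm_group G" "inj_on h J" "int_indep G (h ` J) b"
  shows "int_indep G J (b \<circ> h)"
  unfolding int_indep_def
proof (intro conjI allI impI ballI)
  show "finite J" using assms unfolding int_indep_def by (auto dest: finite_imageD)
  show "b \<circ> h \<in> J \<rightarrow> carrier G" using assms unfolding int_indep_def by auto
  fix c j assume c: "int_comb G J c (b \<circ> h) = \<one>\<^bsub>G\<^esub>" and j: "j \<in> J"
  define d where "d = c \<circ> the_inv_into J h"
  have "int_comb G (h ` J) d b = int_comb G J (d \<circ> h) (b \<circ> h)"
    using assms unfolding int_indep_def by (intro int_comb_reindex[symmetric]) auto
  also have "\<dots> = int_comb G J c (b \<circ> h)"
    using assms unfolding int_indep_def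
    by (intro int_comb_cong) (auto simp: d_def the_inv_into_f_f)
  finally have "d (h j) = 0" using c assms j unfolding int_indep_def by auto
  then show "c j = 0" using assms(2) j by (simp add: d_def the_inv_into_f_f)
qed

lemma int_indep_inj_on:
  assumes "comm_group G" "int_indep G I b"
  shows "inj_on b I"
proof (rule inj_onI, rule ccontr)
  interpret comm_group G by fact
  fix i j assume ij: "i \<in> I" "j \<in> I" "b i = b j" "i \<noteq> j"
  \<comment> \<open>A coincidence \<open>b i = b j\<close> is a nontrivial relation with
    coefficients 1 and -1.\<close>
  define c where "c = (\<lambda>k. if k = i then 1 else (-1::int))"
  have ind: "int_indep G {i,j} b" using assms ij by (intro int_indep_subset[OF assms]) auto
  have bi: "b i \<in> carrier G" using ind by (auto simp: int_indep_def)
  have "int_comb G {i,j} c b = b i [^]\<^bsub>G\<^esub> c i \<otimes>\<^bsub>G\<^esub> (b j [^]\<^bsub>G\<^esub> c j \<otimes>\<^bsub>G\<^esub> \<one>\<^bsub>G\<^esub>)"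
    using ij bi assms(1) by (simp add: int_comb_insert)
  also have "\<dots> = \<one>\<^bsub>G\<^esub>"
    using ij bi by (simp add: c_def int_pow_neg)
  finally have "c i = 0" using ind unfolding int_indep_def by blast
  then show False by (simp add: c_def)
qed

text \<open>The rank is taken of a subset of \<open>G\<close>, so that images and kernels need not be made into groups.\<close>

definition has_rank :: "('a, 'b) monoid_scheme \<Rightarrow> 'a set \<Rightarrow> nat \<Rightarrow> bool" where
  "has_rank G S r \<longleftrightarrow>
     (\<exists>b. int_indep G {..<r} b \<and> b ` {..<r} \<subseteq> S) \<and>
     (\<forall>(I::nat set) b. int_indep G I b \<and> b ` I \<subseteq> S \<longrightarrow> card I \<le> r)"

lemma has_rank_unique: "has_rank G S r \<Longrightarrow> has_rank G S s \<Longrightarrow> r = s"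
  unfolding has_rank_def by (metis card_lessThan le_antisym)

text \<open>\<open>has_rank\<close> has to fix one type of indices; renumbering makes its bound
  available for families over any index type.\<close>

lemma int_indep_nat:
  assumes "comm_group G" "int_indep G I b" "b ` I \<subseteq> S"
  obtains b' where "int_indep G {..<card I} b'" "b' ` {..<card I} \<subseteq> S"
proof -
  have "finite I" using assms by (simp add: int_indep_def)
  then obtain h where h: "bij_betw h {..<card I} I"
    using ex_bij_betw_nat_finite[of I] by (auto simp: atLeast0LessThan)
  then have "int_indep G {..<card I} (b \<circ> h)"
    using assms by (intro int_indep_reindex) (auto simp: bij_betw_def)
  moreover have "(b \<circ> h) ` {..<card I} \<subseteq> S" using h assms(3) by (auto simp: bij_betw_def)
  ultimately show ?thesis using that by blast
qed

lemma has_rank_card_le: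
  assumes "comm_group G" "has_rank G S r" "int_indep G I b" "b ` I \<subseteq> S"
  shows "card I \<le> r"
  using int_indep_nat[OF assms(1,3,4)] assms(2) unfolding has_rank_def by (metis card_lessThan)

lemma has_rankI:
  assumes "comm_group G" "int_indep G I b" "b ` I \<subseteq> S" "card I = r"
    and "\<And>(J::nat set) b. int_indep G J b \<Longrightarrow> b ` J \<subseteq> S \<Longrightarrow> card J \<le> r"
  shows "has_rank G S r"
  using int_indep_nat[OF assms(1-3)] assms(4,5) unfolding has_rank_def by metis

lemma has_rank_exists:
  assumes "comm_group G" and bd: "\<And>(I::nat set) b. int_indep G I b \<Longrightarrow> b ` I \<subseteq> S \<Longrightarrow> card I \<le> n"
  obtains r where "has_rank G S r" "r \<le> n"
proof -
  interpret comm_group G by fact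
  define P where "P = (\<lambda>r::nat. \<exists>b. int_indep G {..<r} b \<and> b ` {..<r} \<subseteq> S)"
  have 0: "P 0" by (auto simp: P_def int_indep_def)
  have b: "r \<le> n" if "P r" for r using that bd[of "{..<r}"] by (auto simp: P_def)
  define r where "r = (GREATEST r. P r)"
  have "P r" unfolding r_def by (rule GreatestI_nat[of P 0 n]) (use 0 b in blast)+
  moreover have "s \<le> r" if "P s" for s unfolding r_def
    by (rule Greatest_le_nat[of P s n]) (use that b in blast)+
  ultimately have "has_rank G S r"
    unfolding has_rank_def using int_indep_nat[OF assms(1)] by (metis P_def)
  then show ?thesis using that b \<open>P r\<close> by blast
qed

text \<open>An independent family is injective, so its range is an independent set of the same
  cardinality. The supremum in \<open>group_rank\<close> is therefore attained.\<close>

lemma group_rank_eq: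
  assumes "comm_group G" "has_rank G (carrier G) r"
  shows "group_rank G = r"
  unfolding group_rank_def
proof (rule cSup_eq_maximum)
  obtain b where b: "int_indep G {..<r} b" using assms(2) by (auto simp: has_rank_def)
  have inj: "inj_on b {..<r}" by (rule int_indep_inj_on[OF assms(1) b])
  have "b = (\<lambda>a. a) \<circ> b" by auto
  have "int_indep G (b ` {..<r}) (b \<circ> the_inv_into {..<r} b)"
    by (rule int_indep_reindex[OF assms(1)])
       (use inj b in \<open>auto intro!: inj_on_the_inv_into simp: the_inv_into_onto\<close>)
  moreover have "int_comb G (b ` {..<r}) c (b \<circ> the_inv_into {..<r} b) =
                 int_comb G (b ` {..<r}) c (\<lambda>a. a)" for c
    by (rule int_comb_cong[OF assms(1)])
       (use inj b in \<open>auto simp: f_the_inv_into_f the_inv_into_f_f int_indep_def\<close>)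
  ultimately have "int_indep G (b ` {..<r}) (\<lambda>a. a)"
    using b by (auto simp: int_indep_def)
  then show "r \<in> {card A |A. int_independent G A}"
    unfolding int_independent_iff using card_image[OF inj] by force
next
  fix n assume "n \<in> {card A |A. int_independent G A}"
  then obtain A where "n = card A" "int_indep G A (\<lambda>a. a)" by (auto simp: int_independent_iff)
  then show "n \<le> r"
    using has_rank_card_le[OF assms(1,2), of A "\<lambda>a. a"] by (auto simp: int_indep_def)
qed

lemma has_rank_mono:
  assumes "comm_group G" "has_rank G T r" "S \<subseteq> T"
  obtains s where "has_rank G S s"
proof (rule has_rank_exists[OF assms(1), of S r])
  show "card I \<le> r" if "int_indep G I b" "b ` I \<subseteq> S" for I :: "nat set" and b
    using assms(2,3) that unfolding has_rank_def by blast
qed (use that in blast)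

lemma int_indep_lift:
  assumes "comm_group G" "comm_group H" "\<phi> \<in> hom G H" "finite I" "b \<in> I \<rightarrow> carrier G"
    "int_indep H I (\<phi> \<circ> b)"
  shows "int_indep G I b"
  unfolding int_indep_def
proof (intro conjI allI impI ballI)
  interpret G: comm_group G by fact
  interpret H: comm_group H by fact
  fix c i assume "int_comb G I c b = \<one>\<^bsub>G\<^esub>" "i \<in> I"
  then have "int_comb H I c (\<phi> \<circ> b) = \<one>\<^bsub>H\<^esub>"
    using hom_int_comb[OF assms(1-5), of c] hom_one[OF assms(3)] by simp
  then show "c i = 0" using assms(6) \<open>i \<in> I\<close> by (simp add: int_indep_def)
qed (use assms in auto)

text \<open>Preimages of an independent family in the image are independent in \<open>G\<close>, so
  the rank of \<open>G\<close> bounds the length of such families.\<close>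

lemma has_rank_image:
  assumes "comm_group G" "comm_group H" "\<phi> \<in> hom G H" "has_rank G (carrier G) t"
  obtains s where "has_rank H (\<phi> ` carrier G) s"
proof -
  have "card I \<le> t" if I: "int_indep H I b" "b ` I \<subseteq> \<phi> ` carrier G" for I :: "nat set" and b
  proof -
    have "\<forall>i\<in>I. \<exists>x\<in>carrier G. b i = \<phi> x" using I(2) by (auto simp: image_subset_iff)
    then obtain d where d: "\<And>i. i \<in> I \<Longrightarrow> d i \<in> carrier G \<and> b i = \<phi> (d i)" by metis
    have "int_comb H I c (\<phi> \<circ> d) = int_comb H I c b" for c
      by (rule int_comb_cong[OF assms(2)])
         (use d assms(3) in \<open>auto simp: hom_def\<close>)
    then have "int_indep H I (\<phi> \<circ> d)" using I(1) d assms(3) by (auto simp: int_indep_def hom_def)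
    then have "int_indep G I d" using d I
      by (intro int_indep_lift[OF assms(1-3)]) (auto simp: int_indep_def)
    then show ?thesis using d by (intro has_rank_card_le[OF assms(1,4)]) auto
  qed
  then show ?thesis using has_rank_exists[OF assms(2), of "\<phi> ` carrier G" t] that by blast
qed

text \<open>Rank-nullity over the integers. Kernel elements together with lifts of independent
  images are independent. For the upper bound, a relation cannot in general be solved for one of its
  members, so relations with a nonzero coefficient at that member take the place of basis
  exchange.\<close>

lemma has_rank_kernel_image:
  assumes G: "comm_group G" and H: "comm_group H" and \<phi>: "\<phi> \<in> hom G H"
    and r: "has_rank G (kernel G H \<phi>) r" and s: "has_rank H (\<phi> ` carrier G) s"
  shows "has_rank G (carrier G) (r + s)"
proof -
  interpret G: comm_group G by fact
  interpret H: comm_group H by fact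
  obtain k where k: "int_indep G {..<r} k" "k ` {..<r} \<subseteq> kernel G H \<phi>"
    using r by (auto simp: has_rank_def)
  obtain d where d: "int_indep H {..<s} d" "d ` {..<s} \<subseteq> \<phi> ` carrier G"
    using s by (auto simp: has_rank_def)
  have "\<forall>i\<in>{..<s}. \<exists>x\<in>carrier G. d i = \<phi> x" using d(2) by (auto simp: image_subset_iff)
  then obtain l where l: "\<And>i. i < s \<Longrightarrow> l i \<in> carrier G \<and> d i = \<phi> (l i)"
    by (metis lessThan_iff)
  define b where "b = (\<lambda>i. if i < r then k i else l (i - r))"
  define R where "R = {r..<r+s}"
  have b_in: "b \<in> {..<r} \<union> R \<rightarrow> carrier G"
    using k l by (auto simp: b_def kernel_def R_def)
  then have b_in': "b i \<in> carrier G" if "i < r + s" for i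
    using that by (cases "i < r") (auto simp: R_def Pi_iff)
  have ind: "int_indep G ({..<r} \<union> R) b"
    unfolding int_indep_def
  proof (intro conjI allI impI b_in)
    fix c assume c: "int_comb G ({..<r} \<union> R) c b = \<one>\<^bsub>G\<^esub>"
    have split: "int_comb G ({..<r} \<union> R) c b = int_comb G {..<r} c b \<otimes>\<^bsub>G\<^esub> int_comb G R c b"
      using b_in by (intro int_comb_Un[OF G]) (auto simp: R_def)
    have cl: "int_comb G {..<r} c b \<in> carrier G" "int_comb G R c b \<in> carrier G"
      using b_in G by auto
    have 1: "\<phi> (int_comb G {..<r} c b) = \<one>\<^bsub>H\<^esub>"
    proof -
      have "\<phi> (int_comb G {..<r} c b) = int_comb H {..<r} c (\<phi> \<circ> b)"
        using b_in by (intro hom_int_comb[OF G H \<phi>]) auto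
      also have "\<dots> = \<one>\<^bsub>H\<^esub>" unfolding int_comb_def
        by (rule H.finprod_one_eqI) (use k in \<open>auto simp: b_def kernel_def\<close>)
      finally show ?thesis .
    qed
    have "\<phi> (int_comb G {..<r} c b) \<otimes>\<^bsub>H\<^esub> \<phi> (int_comb G R c b) = \<one>\<^bsub>H\<^esub>"
      using c cl hom_mult[OF \<phi> cl] hom_one[OF \<phi> G.is_group H.is_group] split by simp
    then have "\<phi> (int_comb G R c b) = \<one>\<^bsub>H\<^esub>"
      using 1 cl hom_in_carrier[OF \<phi>] by simp
    then have "int_comb H R c (\<phi> \<circ> b) = \<one>\<^bsub>H\<^esub>"
      using b_in hom_int_comb[OF G H \<phi>, of R b c] by (auto simp: R_def)
    moreover have "int_comb H {..<s} (c \<circ> (\<lambda>i. i + r)) (\<phi> \<circ> b \<circ> (\<lambda>i. i + r)) =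
        int_comb H ((\<lambda>i. i + r) ` {..<s}) c (\<phi> \<circ> b)"
      using b_in' hom_in_carrier[OF \<phi>]
      by (intro int_comb_reindex[OF H]) auto
    moreover have "(\<lambda>i. i + r) ` {..<s} = R"
      by (simp add: R_def lessThan_atLeast0 add.commute)
    moreover have "int_comb H {..<s} (c \<circ> (\<lambda>i. i + r)) (\<phi> \<circ> b \<circ> (\<lambda>i. i + r)) =
                   int_comb H {..<s} (c \<circ> (\<lambda>i. i + r)) d"
      by (rule int_comb_cong[OF H]) (use l hom_in_carrier[OF \<phi>] in \<open>auto simp: b_def\<close>)
    ultimately have "\<forall>i\<in>{..<s}. (c \<circ> (\<lambda>i. i + r)) i = 0"
      using d(1) unfolding int_indep_def by metis
    then have cR: "c i = 0" if "i \<in> R" for i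
      using that by (auto simp: R_def dest!: bspec[where x = "i - r"])
    then have "int_comb G R c b = \<one>\<^bsub>G\<^esub>" unfolding int_comb_def
      by (intro G.finprod_one_eqI) auto
    then have "int_comb G {..<r} c b = \<one>\<^bsub>G\<^esub>" using c split cl by simp
    moreover have "int_comb G {..<r} c b = int_comb G {..<r} c k"
      using b_in by (intro int_comb_cong[OF G]) (auto simp: b_def)
    ultimately have "\<forall>i\<in>{..<r}. c i = 0" using k(1) by (auto simp: int_indep_def)
    then show "\<forall>i\<in>{..<r} \<union> R. c i = 0" using cR by auto
  qed (auto simp: R_def)
  show ?thesis
  proof (rule has_rankI[OF G ind])
    show "b ` ({..<r} \<union> R) \<subseteq> carrier G" using b_in by blast
    show "card ({..<r} \<union> R) = r + s" by (subst card_Un_disjoint) (auto simp: R_def)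
    fix I :: "nat set" and b assume I: "int_indep G I b" "b ` I \<subseteq> carrier G"
    then have fin: "finite I" and bI: "b \<in> I \<rightarrow> carrier G" by (auto simp: int_indep_def)
    then have bH: "\<phi> (b i) \<in> carrier H" if "i \<in> I" for i
      using that hom_in_carrier[OF \<phi>] by auto
    \<comment> \<open>\<open>J\<close> is a longest subfamily with independent image;
      \<open>Suc (card I)\<close> only bounds the lengths.\<close>
    have "\<exists>J. (J \<subseteq> I \<and> int_indep H J (\<phi> \<circ> b)) \<and> (\<forall>J'. J' \<subseteq> I \<and> int_indep H J' (\<phi> \<circ> b) \<longrightarrow> card J' \<le> card J)"
      by (rule ex_has_greatest_nat[of _ "{}" _ "Suc (card I)"])
         (use fin in \<open>auto simp: int_indep_def less_Suc_eq_le intro: card_mono\<close>)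
    then obtain J where J: "J \<subseteq> I" "int_indep H J (\<phi> \<circ> b)"
      and Jmax: "\<And>J'. J' \<subseteq> I \<Longrightarrow> int_indep H J' (\<phi> \<circ> b) \<Longrightarrow> card J' \<le> card J" by blast
    have finJ: "finite J" using J fin finite_subset by blast
    \<comment> \<open>Maximality gives a relation over \<open>insert i J\<close>. Its coefficient at
      \<open>i\<close> cannot vanish, as otherwise \<open>J\<close> itself would be
      dependent.\<close>
    have "\<exists>c. int_comb H (insert i J) c (\<phi> \<circ> b) = \<one>\<^bsub>H\<^esub> \<and> c i \<noteq> 0" if i: "i \<in> I - J" for i
    proof -
      have "\<not> int_indep H (insert i J) (\<phi> \<circ> b)"
        using Jmax[of "insert i J"] i J(1) finJ by auto
      then obtain c j where c: "int_comb H (insert i J) c (\<phi> \<circ> b) = \<one>\<^bsub>H\<^esub>" "j \<in> insert i J" "c j \<noteq> 0"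
        unfolding int_indep_def using finJ J bH i by auto
      have bJ: "\<phi> \<circ> b \<in> insert i J \<rightarrow> carrier H"
        using bH i J by auto
      have "c i \<noteq> 0"
      proof
        assume "c i = 0"
        then have "int_comb H J c (\<phi> \<circ> b) = \<one>\<^bsub>H\<^esub>"
          using c(1) i finJ bJ by (subst (asm) int_comb_insert[OF H]) (auto simp: int_comb_closed[OF H])
        then have "\<forall>j\<in>J. c j = 0" using J(2) by (auto simp: int_indep_def)
        then show False using c \<open>c i = 0\<close> by auto
      qed
      then show ?thesis using c by auto
    qed
    then obtain c where c: "\<And>i. i \<in> I - J \<Longrightarrow> int_comb H (insert i J) (c i) (\<phi> \<circ> b) = \<one>\<^bsub>H\<^esub> \<and> c i i \<noteq> 0"
      by metis
    define C where "C = (\<lambda>i j. if j \<in> insert i J then c i j else 0)"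
    define b' where "b' = (\<lambda>i. int_comb G I (C i) b)"
    have b'_ker: "b' i \<in> kernel G H \<phi>" if i: "i \<in> I - J" for i
    proof -
      have "\<phi> (b' i) = int_comb H I (C i) (\<phi> \<circ> b)"
        unfolding b'_def using fin bI by (intro hom_int_comb[OF G H \<phi>])
      also have "I = insert i J \<union> (I - insert i J)" using i J by auto
      also have "int_comb H \<dots> (C i) (\<phi> \<circ> b) =
          int_comb H (insert i J) (C i) (\<phi> \<circ> b) \<otimes>\<^bsub>H\<^esub> int_comb H (I - insert i J) (C i) (\<phi> \<circ> b)"
        using fin finJ bH i J by (intro int_comb_Un[OF H]) auto
      also have "int_comb H (insert i J) (C i) (\<phi> \<circ> b) = int_comb H (insert i J) (c i) (\<phi> \<circ> b)"
        using bH i J by (intro int_comb_cong[OF H]) (auto simp: C_def)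
      also have "\<dots> = \<one>\<^bsub>H\<^esub>" using c i by auto
      also have "int_comb H (I - insert i J) (C i) (\<phi> \<circ> b) = \<one>\<^bsub>H\<^esub>"
        unfolding int_comb_def by (rule H.finprod_one_eqI) (auto simp: C_def)
      finally show ?thesis using bI G by (simp add: kernel_def b'_def)
    qed
    have "int_indep G (I - J) b'"
      unfolding int_indep_def
    proof (intro conjI allI impI ballI)
      fix e i assume e: "int_comb G (I - J) e b' = \<one>\<^bsub>G\<^esub>" and i: "i \<in> I - J"
      have "int_comb G I (\<lambda>j. \<Sum>k\<in>I - J. e k * C k j) b = \<one>\<^bsub>G\<^esub>"
        using int_comb_nested[OF G fin _ bI, of "I - J" e C] fin e by (simp add: b'_def)
      then have "(\<Sum>k\<in>I - J. e k * C k i) = 0" using I(1) i by (auto simp: int_indep_def)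
      \<comment> \<open>\<open>i\<close> lies outside \<open>J\<close>, so among the relations
        indexed by \<open>I - J\<close> only the one belonging to \<open>i\<close> involves
        \<open>b i\<close>.\<close>
      also have "(\<Sum>k\<in>I - J. e k * C k i) = (\<Sum>k\<in>I - J. if k = i then e i * c i i else 0)"
        using i by (intro sum.cong) (auto simp: C_def)
      also have "\<dots> = e i * c i i" using i fin by simp
      finally show "e i = 0" using c i by auto
    qed (use fin bI G in \<open>auto simp: b'_def\<close>)
    then have "card (I - J) \<le> r"
      using b'_ker by (intro has_rank_card_le[OF G r]) auto
    moreover have "card J \<le> s"
      using bI J(1) by (intro has_rank_card_le[OF H s J(2)]) auto
    ultimately show "card I \<le> r + s"
      using card_Diff_subset[OF finJ J(1)] card_mono[OF fin J(1)] by linarith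
  qed
qed

subsection \<open>Euler characteristics of pairs of spaces\<close>

lemma has_rank_one:
  assumes "comm_group G"
  shows "has_rank G {\<one>\<^bsub>G\<^esub>} 0"
proof -
  interpret comm_group G by fact
  have "card I \<le> 0" if I: "int_indep G I b" "b ` I \<subseteq> {\<one>\<^bsub>G\<^esub>}" for I :: "nat set" and b
  proof -
    have "int_comb G I (\<lambda>_. 1) b = \<one>\<^bsub>G\<^esub>"
      unfolding int_comb_def by (rule finprod_one_eqI) (use I in auto)
    then have "I = {}" using I(1) by (force simp: int_indep_def)
    then show ?thesis by simp
  qed
  then show ?thesis
    using assms by (auto simp: has_rank_def int_indep_def)
qed

text \<open>Rank-nullity with a kernel of rank 0 and full image.\<close>

lemma has_rank_iso:
  assumes "comm_group G" "comm_group H" "G \<cong> H" "has_rank G (carrier G) r"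
  shows "has_rank H (carrier H) r"
proof -
  interpret G: comm_group G by fact
  interpret H: comm_group H by fact
  obtain \<phi> where \<phi>: "\<phi> \<in> iso G H" using assms(3) by (auto simp: is_iso_def)
  then have hom: "\<phi> \<in> hom G H" and im: "\<phi> ` carrier G = carrier H" and inj: "inj_on \<phi> (carrier G)"
    by (auto simp: iso_def bij_betw_def)
  have "kernel G H \<phi> = {\<one>\<^bsub>G\<^esub>}"
  proof (intro equalityI subsetI)
    fix x assume "x \<in> kernel G H \<phi>"
    then have "x \<in> carrier G" "\<phi> x = \<phi> \<one>\<^bsub>G\<^esub>"
      using hom_one[OF hom G.is_group H.is_group] by (auto simp: kernel_def)
    then show "x \<in> {\<one>\<^bsub>G\<^esub>}" using inj_onD[OF inj] by blast
  qed (use hom_one[OF hom G.is_group H.is_group] in \<open>simp add: kernel_def\<close>)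
  then have k: "has_rank G (kernel G H \<phi>) 0" using has_rank_one[OF assms(1)] by simp
  obtain s where s: "has_rank H (\<phi> ` carrier G) s" using has_rank_image[OF assms(1,2) hom assms(4)] .
  from has_rank_kernel_image[OF assms(1,2) hom k s] have "r = s"
    using has_rank_unique[OF assms(4)] by simp
  then show ?thesis using s im by simp
qed

lemma has_rank_integer_group: "has_rank integer_group (carrier integer_group) 1"
proof -
  interpret comm_group integer_group by (rule abelian_integer_group)
  have 1: "int_indep integer_group {..<1::nat} (\<lambda>_. 1)"
    by (auto simp: int_indep_def int_comb_def lessThan_Suc abelian_integer_group)
  have "card I \<le> 1" if I: "int_indep integer_group I b" for I :: "nat set" and b
  proof (rule ccontr)
    assume "\<not> card I \<le> 1"
    then obtain i j where ij: "i \<in> I" "j \<in> I" "i \<noteq> j"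
      by (metis I card_le_Suc0_iff_eq int_indep_def One_nat_def)
    have ind: "int_indep integer_group {i,j} b"
      by (rule int_indep_subset[OF abelian_integer_group I]) (use ij in auto)
    have e: "int_comb integer_group {i,j} c b = c i * b i + c j * b j" for c
      using ij by (simp add: int_comb_insert abelian_integer_group)
    \<comment> \<open>Cross-multiplication: the coefficients \<open>b j\<close> and
      \<open>- b i\<close> give a relation, so \<open>b i\<close> vanishes, and then
      \<open>b i\<close> alone is dependent.\<close>
    have "b i = 0"
      using ij ind e[of "\<lambda>k. if k = i then b j else - b i"] by (auto simp: int_indep_def)
    then show False
      using ij ind e[of "\<lambda>k. if k = i then 1 else 0"] by (auto simp: int_indep_def)
  qed
  then show ?thesis using 1 unfolding has_rank_def by auto
qed

text \<open>A relation instead of a function, so that finiteness of all ranks and their vanishing in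
  high degrees travel with the value.\<close>

definition euler_pair :: "'a topology \<Rightarrow> 'a set \<Rightarrow> int \<Rightarrow> bool" where
  "euler_pair X S e \<longleftrightarrow> (\<exists>r N.
     (\<forall>n. has_rank (relative_homology_group (int n) X S)
            (carrier (relative_homology_group (int n) X S)) (r n)) \<and>
     (\<forall>n\<ge>N. r n = 0) \<and> e = (\<Sum>n<N. (- 1) ^ n * int (r n)))"

lemma alternating_sum_extend:
  fixes r :: "nat \<Rightarrow> nat"
  assumes "\<forall>n\<ge>N. r n = 0" "N \<le> M"
  shows "(\<Sum>n<M. (- 1) ^ n * int (r n)) = (\<Sum>n<N. (- 1) ^ n * int (r n))"
  using assms by (intro sum.mono_neutral_right) auto

lemma euler_pair_unique:
  assumes "euler_pair X S e" "euler_pair X S e'"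
  shows "e = e'"
proof -
  obtain r N where r: "\<And>n. has_rank (relative_homology_group (int n) X S)
            (carrier (relative_homology_group (int n) X S)) (r n)"
     "\<forall>n\<ge>N. r n = 0" "e = (\<Sum>n<N. (- 1) ^ n * int (r n))"
    using assms(1) unfolding euler_pair_def by blast
  obtain r' N' where r': "\<And>n. has_rank (relative_homology_group (int n) X S)
            (carrier (relative_homology_group (int n) X S)) (r' n)"
     "\<forall>n\<ge>N'. r' n = 0" "e' = (\<Sum>n<N'. (- 1) ^ n * int (r' n))"
    using assms(2) unfolding euler_pair_def by blast
  have "r = r'" using has_rank_unique[OF r(1) r'(1)] by blast
  then show ?thesis
    using alternating_sum_extend[OF r(2), of "max N N'"]
      alternating_sum_extend[OF r'(2), of "max N N'"] r(3) r'(3) by simp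
qed

lemma euler_char_eq:
  assumes "euler_pair X {} e"
  shows "euler_char X = e"
proof -
  obtain r N where r: "\<And>n. has_rank (homology_group (int n) X)
            (carrier (homology_group (int n) X)) (r n)"
     "\<forall>n\<ge>N. r n = 0" "e = (\<Sum>n<N. (- 1) ^ n * int (r n))"
    using assms unfolding euler_pair_def by blast
  have gr: "group_rank (homology_group (int n) X) = r n" for n
    by (rule group_rank_eq[OF abelian_homology_group r(1)])
  have "euler_char X = (\<Sum>n | r n \<noteq> 0. (- 1) ^ n * int (r n))"
    unfolding euler_char_def gr ..
  also have "\<dots> = (\<Sum>n<N. (- 1) ^ n * int (r n))"
  proof (rule sum.mono_neutral_left)
    show "{n. r n \<noteq> 0} \<subseteq> {..<N}"
    proof
      fix n assume "n \<in> {n. r n \<noteq> 0}"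
      then show "n \<in> {..<N}" using r(2) by (cases "N \<le> n") auto
    qed
  qed auto
  finally show ?thesis using r(3) by simp
qed

lemma euler_pair_iso:
  assumes "euler_pair X S e"
    and "\<And>n::nat. relative_homology_group (int n) X S \<cong> relative_homology_group (int n) Y T"
  shows "euler_pair Y T e"
  using assms(1) has_rank_iso[OF abelian_relative_homology_group abelian_relative_homology_group assms(2)]
  unfolding euler_pair_def by blast

lemma euler_pair_homotopy:
  assumes "X homotopy_equivalent_space Y" "euler_pair X {} e"
  shows "euler_pair Y {} e"
  using assms homotopy_equivalent_space_imp_isomorphic_homology_groups
  by (intro euler_pair_iso[OF assms(2)]) blast

lemma euler_pair_contractible:
  assumes "contractible_space X" "topspace X \<noteq> {}"
  shows "euler_pair X {} 1"
proof -
  obtain a where a: "a \<in> topspace X" "X homotopy_equivalent_space subtopology X {a}"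
    using assms by (auto simp: contractible_eq_homotopy_equivalent_singleton_subtopology)
  moreover have "euler_pair (subtopology X {a}) {} 1"
    unfolding euler_pair_def
  proof (intro exI conjI allI)
    let ?X = "subtopology X {a}"
    have top: "topspace ?X = {a}" using a(1) by auto
    fix n :: nat
    show "has_rank (homology_group (int n) ?X) (carrier (homology_group (int n) ?X)) (if n = 0 then 1 else 0)"
    proof (cases "n = 0")
      case True
      then show ?thesis
        using has_rank_iso[OF abelian_integer_group abelian_homology_group _ has_rank_integer_group, of 0 ?X]
          group.iso_sym[OF _ homology_coefficients[OF top]] by simp
    next
      case False
      then have "trivial_group (homology_group (int n) ?X)"
        by (intro homology_dimension_axiom[OF top]) auto
      then show ?thesis
        using False has_rank_one[OF abelian_homology_group, of "int n" ?X]
        by (simp add: trivial_group_def)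
    qed
    show "1 \<le> n \<longrightarrow> (if n = 0 then 1 else 0) = (0::nat)" for n :: nat by auto
  qed auto
  ultimately show ?thesis
    using a(2) euler_pair_homotopy homotopy_equivalent_space_sym by blast
qed

text \<open>In the application \<open>c n\<close> is the rank of the connecting map out of degree
  \<open>n\<close>. It occurs in the relative group of degree \<open>n\<close> and in the homology
  of the subspace in degree \<open>n - 1\<close>, with opposite signs.\<close>

lemma alternating_sum_telescope:
  fixes c :: "nat \<Rightarrow> nat"
  assumes "c 0 = 0"
  shows "(\<Sum>n<M. (- 1) ^ n * (int (c (Suc n)) + int (c n))) = - ((- 1) ^ M * int (c M))"
  by (induction M) (auto simp: assms algebra_simps)

lemma has_rank_le:
  assumes "comm_group G" "has_rank G S r" "has_rank G T s" "S \<subseteq> T"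
  shows "r \<le> s"
  using assms unfolding has_rank_def by (metis card_lessThan subset_trans)

lemma has_rank_image_le:
  assumes "comm_group G" "comm_group H" "\<phi> \<in> hom G H" "has_rank G (carrier G) t"
    "has_rank H (\<phi> ` carrier G) s"
  shows "s \<le> t"
proof -
  interpret G: comm_group G by fact
  obtain r where r: "has_rank G (kernel G H \<phi>) r"
    by (rule has_rank_mono[OF assms(1,4), of "kernel G H \<phi>"]) (auto simp: kernel_def)
  show ?thesis
    using has_rank_unique[OF assms(4) has_rank_kernel_image[OF assms(1-3) r assms(5)]] by simp
qed

section \<open>The long exact sequence of a pair\<close>

locale homology_pair =
  fixes X :: "'a topology" and S :: "'a set"
begin

abbreviation "Y \<equiv> subtopology X S"
abbreviation "i p \<equiv> hom_induced p Y {} X {} id"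
abbreviation "j p \<equiv> hom_induced p X {} X S id"
abbreviation "bd p \<equiv> hom_boundary p X S"

lemma homs:
  "i p \<in> hom (homology_group p Y) (homology_group p X)"
  "j p \<in> hom (homology_group p X) (relative_homology_group p X S)"
  "bd p \<in> hom (relative_homology_group p X S) (homology_group (p - 1) Y)"
  by (simp_all add: hom_induced_hom hom_boundary_hom)

lemma kernels:
  "kernel (homology_group p X) (relative_homology_group p X S) (j p) =
     i p ` carrier (homology_group p Y)"
  "kernel (relative_homology_group p X S) (homology_group (p - 1) Y) (bd p) =
     j p ` carrier (homology_group p X)"
  "kernel (homology_group (p - 1) Y) (homology_group (p - 1) X) (i (p - 1)) =
     bd p ` carrier (relative_homology_group p X S)"
  using homology_exactness_axiom_1[of p X S] homology_exactness_axiom_2[of p X S]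
    homology_exactness_axiom_3[of p X S] by auto

text \<open>By exactness and rank-nullity, the rank of each group is the sum of the ranks of the two
  adjacent maps; \<open>a\<close>, \<open>b\<close>, \<open>c\<close> are the ranks of
  \<open>i\<close>, \<open>j\<close> and \<open>bd\<close>. Taking alternating sums makes the
  connecting maps cancel.\<close>

lemma euler_exact:
  assumes a: "\<And>n::nat. has_rank (homology_group (int n) X)
      (i (int n) ` carrier (homology_group (int n) Y)) (a n)"
    and b: "\<And>n::nat. has_rank (relative_homology_group (int n) X S)
      (j (int n) ` carrier (homology_group (int n) X)) (b n)"
    and c: "\<And>n::nat. has_rank (homology_group (int n - 1) Y)
      (bd (int n) ` carrier (relative_homology_group (int n) X S)) (c n)"
    and N: "\<And>n. n \<ge> N \<Longrightarrow> a n = 0 \<and> b n = 0 \<and> c n = 0"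
  shows "\<exists>e e'. euler_pair Y {} e \<and> euler_pair X S e' \<and> euler_pair X {} (e + e')"
proof -
  have rY: "has_rank (homology_group (int n) Y) (carrier (homology_group (int n) Y)) (c (Suc n) + a n)" for n
    using has_rank_kernel_image[OF abelian_homology_group abelian_homology_group homs(1), of "int n" "c (Suc n)" "a n"]
      a[of n] c[of "Suc n"] kernels(3)[of "int (Suc n)"] by simp
  have rX: "has_rank (homology_group (int n) X) (carrier (homology_group (int n) X)) (a n + b n)" for n
    using has_rank_kernel_image[OF abelian_homology_group abelian_relative_homology_group homs(2), of "int n" "a n" "b n"]
      a[of n] b[of n] kernels(1)[of "int n"] by simp
  have rS: "has_rank (relative_homology_group (int n) X S) (carrier (relative_homology_group (int n) X S)) (b n + c n)" for n
    using has_rank_kernel_image[OF abelian_relative_homology_group abelian_homology_group homs(3), of "int n" "b n" "c n"]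
      b[of n] c[of n] kernels(2)[of "int n"] by simp
  \<comment> \<open>Homology in degree -1 is trivial, which gives \<open>c 0 = 0\<close>, the start
    of the telescoping sum.\<close>
  have "(0::int) - 1 < 0" by simp
  then have "carrier (homology_group (0 - 1) Y) = {\<one>\<^bsub>homology_group (0 - 1) Y\<^esub>}"
    using trivial_homology_group[of "0 - 1" Y] unfolding trivial_group_def by blast
  then have "bd 0 ` carrier (relative_homology_group 0 X S) \<subseteq> {\<one>\<^bsub>homology_group (0 - 1) Y\<^esub>}"
    using hom_carrier[OF homs(3)[of 0]] by (simp only:)
  moreover have "has_rank (homology_group (0 - 1) Y) (bd 0 ` carrier (relative_homology_group 0 X S)) (c 0)"
    using c[of 0] by (simp only: of_nat_0)
  ultimately have c0: "c 0 = 0"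
    using has_rank_le[OF abelian_homology_group _ has_rank_one[OF abelian_homology_group]] by blast
  let ?e = "\<Sum>n<N. (- 1) ^ n * int (c (Suc n) + a n)"
  let ?e' = "\<Sum>n<N. (- 1) ^ n * int (b n + c n)"
  have "?e + ?e' = (\<Sum>n<N. (- 1) ^ n * int (a n + b n)) + (\<Sum>n<N. (- 1) ^ n * (int (c (Suc n)) + int (c n)))"
    unfolding sum.distrib[symmetric] by (rule sum.cong) (auto simp: algebra_simps)
  also have "(\<Sum>n<N. (- 1) ^ n * (int (c (Suc n)) + int (c n))) = 0"
    using alternating_sum_telescope[of c N, OF c0] N by simp
  finally have sum: "?e + ?e' = (\<Sum>n<N. (- 1) ^ n * int (a n + b n))" by simp
  have "euler_pair Y {} ?e"
    unfolding euler_pair_def using rY N by (intro exI[of _ "\<lambda>n. c (Suc n) + a n"] exI[of _ N]) auto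
  moreover have "euler_pair X S ?e'"
    unfolding euler_pair_def using rS N by (intro exI[of _ "\<lambda>n. b n + c n"] exI[of _ N]) auto
  moreover have "euler_pair X {} (?e + ?e')"
    unfolding euler_pair_def using rX N sum by (intro exI[of _ "\<lambda>n. a n + b n"] exI[of _ N]) auto
  ultimately show ?thesis by blast
qed

text \<open>The ranks of the subspace and of the pair bound those of all three kinds of maps. With
  these, \<open>euler_exact\<close> produces values that uniqueness identifies with the given
  ones.\<close>

lemma euler_pair_total:
  assumes "euler_pair Y {} e" "euler_pair X S e'"
  shows "euler_pair X {} (e + e')"
proof -
  obtain r N where r: "\<And>n. has_rank (homology_group (int n) Y)
            (carrier (homology_group (int n) Y)) (r n)" "\<forall>n\<ge>N. r n = 0"
    using assms(1) unfolding euler_pair_def by blast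
  obtain s M where s: "\<And>n. has_rank (relative_homology_group (int n) X S)
            (carrier (relative_homology_group (int n) X S)) (s n)" "\<forall>n\<ge>M. s n = 0"
    using assms(2) unfolding euler_pair_def by blast
  have "\<exists>a. has_rank (homology_group (int n) X) (i (int n) ` carrier (homology_group (int n) Y)) a" for n
    using has_rank_image[OF abelian_homology_group abelian_homology_group homs(1) r(1)] by blast
  then obtain a where a: "\<And>n. has_rank (homology_group (int n) X) (i (int n) ` carrier (homology_group (int n) Y)) (a n)"
    by metis
  have "\<exists>b. has_rank (relative_homology_group (int n) X S) (j (int n) ` carrier (homology_group (int n) X)) b" for n
    using has_rank_mono[OF abelian_relative_homology_group s(1) hom_carrier[OF homs(2)]] by blast
  then obtain b where b: "\<And>n. has_rank (relative_homology_group (int n) X S) (j (int n) ` carrier (homology_group (int n) X)) (b n)"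
    by metis
  have "\<exists>c. has_rank (homology_group (int n - 1) Y) (bd (int n) ` carrier (relative_homology_group (int n) X S)) c" for n
    using has_rank_image[OF abelian_relative_homology_group abelian_homology_group homs(3) s(1)] by blast
  then obtain c where c: "\<And>n. has_rank (homology_group (int n - 1) Y) (bd (int n) ` carrier (relative_homology_group (int n) X S)) (c n)"
    by metis
  have "a n = 0 \<and> b n = 0 \<and> c n = 0" if "n \<ge> max N M" for n
    using has_rank_image_le[OF abelian_homology_group abelian_homology_group homs(1) r(1) a, of n]
      has_rank_le[OF abelian_relative_homology_group b s(1) hom_carrier[OF homs(2)], of n]
      has_rank_image_le[OF abelian_relative_homology_group abelian_homology_group homs(3) s(1) c, of n]
      r(2) s(2) that by simp
  then obtain f f' where f: "euler_pair Y {} f" "euler_pair X S f'" "euler_pair X {} (f + f')"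
    using euler_exact[OF a b c] by blast
  then show ?thesis using euler_pair_unique assms by metis
qed

lemma euler_pair_relative:
  assumes "euler_pair Y {} e" "euler_pair X {} e'"
  shows "euler_pair X S (e' - e)"
proof -
  obtain r N where r: "\<And>n. has_rank (homology_group (int n) Y)
            (carrier (homology_group (int n) Y)) (r n)" "\<forall>n\<ge>N. r n = 0"
    using assms(1) unfolding euler_pair_def by blast
  obtain s M where s: "\<And>n. has_rank (homology_group (int n) X)
            (carrier (homology_group (int n) X)) (s n)" "\<forall>n\<ge>M. s n = 0"
    using assms(2) unfolding euler_pair_def by blast
  have "\<exists>a. has_rank (homology_group (int n) X) (i (int n) ` carrier (homology_group (int n) Y)) a" for n
    using has_rank_image[OF abelian_homology_group abelian_homology_group homs(1) r(1)] by blast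
  then obtain a where a: "\<And>n. has_rank (homology_group (int n) X) (i (int n) ` carrier (homology_group (int n) Y)) (a n)"
    by metis
  have "\<exists>b. has_rank (relative_homology_group (int n) X S) (j (int n) ` carrier (homology_group (int n) X)) b" for n
    using has_rank_image[OF abelian_homology_group abelian_relative_homology_group homs(2) s(1)] by blast
  then obtain b where b: "\<And>n. has_rank (relative_homology_group (int n) X S) (j (int n) ` carrier (homology_group (int n) X)) (b n)"
    by metis
  have triv: "has_rank (homology_group (-1) Y) (carrier (homology_group (-1) Y)) 0"
    using has_rank_one[OF abelian_homology_group, of "-1" Y] trivial_homology_group[of "-1" Y]
    by (simp add: trivial_group_def)
  \<comment> \<open>The rank of the subspace in degree \<open>n - 1\<close>, with 0 in degree -1.
    This shift is why the range of vanishing below starts at \<open>Suc N\<close>.\<close>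
  define t where "t = (\<lambda>n. case n of 0 \<Rightarrow> 0 | Suc m \<Rightarrow> r m)"
  have t: "has_rank (homology_group (int n - 1) Y) (carrier (homology_group (int n - 1) Y)) (t n)" for n
    using triv r(1) by (cases n) (auto simp: t_def)
  have "\<exists>c. has_rank (homology_group (int n - 1) Y) (bd (int n) ` carrier (relative_homology_group (int n) X S)) c" for n
    using has_rank_mono[OF abelian_homology_group t hom_carrier[OF homs(3)]] by blast
  then obtain c where c: "\<And>n. has_rank (homology_group (int n - 1) Y) (bd (int n) ` carrier (relative_homology_group (int n) X S)) (c n)"
    by metis
  have "a n = 0 \<and> b n = 0 \<and> c n = 0" if "n \<ge> max (Suc N) M" for n
  proof -
    have "t n = 0" using that r(2) by (auto simp: t_def split: nat.split)
    then show ?thesis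
    using has_rank_image_le[OF abelian_homology_group abelian_homology_group homs(1) r(1) a, of n]
      has_rank_image_le[OF abelian_homology_group abelian_relative_homology_group homs(2) s(1) b, of n]
      has_rank_le[OF abelian_homology_group c t hom_carrier[OF homs(3)], of n]
      r(2) s(2) that by simp
  qed
  then obtain f f' where f: "euler_pair Y {} f" "euler_pair X S f'" "euler_pair X {} (f + f')"
    using euler_exact[OF a b c] by blast
  then have "e = f" "e' = f + f'" using euler_pair_unique assms by metis+
  then show ?thesis using f by simp
qed

end

subsection \<open>The Euler valuation\<close>

text \<open>
  Compact convex sets have Euler characteristic 1; relatively open bounded ones have the
  compactly supported Euler characteristic of an open cell.
\<close>

definition convex_cell :: "'a::euclidean_space set \<Rightarrow> bool" where
  "convex_cell S \<longleftrightarrow> convex S \<and> bounded S \<and> (compact S \<or> rel_interior S = S)"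

definition eul :: "'a::euclidean_space set \<Rightarrow> int" where
  "eul S = (if S = {} then 0 else if compact S then 1 else (- 1) ^ nat (aff_dim S))"

lemma eul_empty [simp]: "eul {} = 0"
  by (simp add: eul_def)

lemma eul_compact: "compact S \<Longrightarrow> S \<noteq> {} \<Longrightarrow> eul S = 1"
  by (simp add: eul_def)

text \<open>The two clauses of \<open>eul\<close> agree where they overlap: a nonempty compact set
  that is relatively open is a bounded affine set, hence a point, and both give 1.\<close>

lemma eul_rel_open:
  assumes "rel_interior S = S" "bounded S" "S \<noteq> {}"
  shows "eul S = (- 1) ^ nat (aff_dim S)"
proof (cases "compact S")
  case True
  then have "rel_frontier S = {}"
    using assms(1) by (simp add: rel_frontier_def compact_imp_closed)
  then have "affine S" by (simp add: rel_frontier_eq_empty)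
  then obtain a where "S = {a}" using affine_bounded_eq_trivial assms(2,3) by blast
  then show ?thesis by (simp add: eul_def)
qed (simp add: eul_def assms)

lemma convex_cell_slice:
  assumes "convex_cell S"
  shows "convex_cell (S \<inter> {y. b \<bullet> y = t})"
proof (cases "S \<inter> {y. b \<bullet> y = t} = {}")
  case True
  then show ?thesis unfolding True by (simp add: convex_cell_def)
next
  case False
  have "convex (S \<inter> {y. b \<bullet> y = t})" "bounded (S \<inter> {y. b \<bullet> y = t})"
    using assms by (auto simp: convex_cell_def convex_hyperplane intro: convex_Int)
  moreover have "compact (S \<inter> {y. b \<bullet> y = t})" if "compact S"
    using that by (simp add: compact_Int_closed closed_hyperplane)
  moreover have "rel_interior (S \<inter> {y. b \<bullet> y = t}) = S \<inter> {y. b \<bullet> y = t}" if "rel_interior S = S"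
    using convex_affine_rel_interior_Int[of S "{y. b \<bullet> y = t}"] assms False that
    by (auto simp: convex_cell_def affine_hyperplane)
  ultimately show ?thesis using assms unfolding convex_cell_def by blast
qed

lemma convex_cell_slices:
  assumes "finite B" "convex_cell S"
  shows "convex_cell (S \<inter> {y. \<forall>b\<in>B. b \<bullet> y = b \<bullet> x})"
  using assms(1)
proof (induction B)
  case (insert b B)
  have "S \<inter> {y. \<forall>b\<in>insert b B. b \<bullet> y = b \<bullet> x} = (S \<inter> {y. \<forall>b\<in>B. b \<bullet> y = b \<bullet> x}) \<inter> {y. b \<bullet> y = b \<bullet> x}"
    by auto
  then show ?case using convex_cell_slice[OF insert.IH] by simp
qed (use assms in simp)

text \<open>
  If \<open>T\<close> contains the discontinuities of \<open>h\<close> and \<open>\<eta>\<close> is smaller than the gaps of \<open>T\<close>, this is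
  the sum of the jumps \<open>h(t) - h(t+)\<close>, which is how the Euler characteristic is read off from slices.
\<close>

definition jump_sum :: "real set \<Rightarrow> real \<Rightarrow> (real \<Rightarrow> int) \<Rightarrow> int" where
  "jump_sum T \<eta> h = (\<Sum>t\<in>T. h t - h (t + \<eta>))"

definition gap_below :: "real set \<Rightarrow> real \<Rightarrow> bool" where
  "gap_below T \<eta> \<longleftrightarrow> \<eta> > 0 \<and> (\<forall>s\<in>T. \<forall>t\<in>T. s < t \<longrightarrow> s + \<eta> < t)"

lemma gap_below_exists:
  assumes "finite T"
  obtains \<eta> where "gap_below T \<eta>"
proof -
  define D where "D = (\<lambda>(s,t). t - s) ` {(s,t). s \<in> T \<and> t \<in> T \<and> s < t}"
  have fin: "finite D" unfolding D_def
    by (rule finite_imageI, rule finite_subset[of _ "T \<times> T"]) (use assms in auto)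
  have "\<exists>\<eta>>0. \<forall>d\<in>D. \<eta> < d"
  proof (cases "D = {}")
    case False
    have "Min D > 0" using fin False by (auto simp: D_def)
    moreover have "\<forall>d\<in>D. Min D \<le> d" using fin by auto
    ultimately show ?thesis by (intro exI[of _ "Min D / 2"]) auto
  qed (auto intro: exI[of _ 1])
  then obtain \<eta> where "\<eta> > 0" "\<forall>d\<in>D. \<eta> < d" by blast
  then have "gap_below T \<eta>" by (force simp: gap_below_def D_def)
  then show ?thesis using that by blast
qed

lemma jump_sum_point:
  assumes "finite T" "gap_below T \<eta>" "t0 \<in> T"
  shows "jump_sum T \<eta> (\<lambda>t. if t = t0 then e else 0) = e"
proof -
  have "t + \<eta> \<noteq> t0" if "t \<in> T" for t
    using assms that unfolding gap_below_def by (metis less_add_same_cancel1 less_irrefl)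
  then have "jump_sum T \<eta> (\<lambda>t. if t = t0 then e else 0) = (\<Sum>t\<in>T. if t = t0 then e else 0)"
    unfolding jump_sum_def by (intro sum.cong) auto
  then show ?thesis using assms by simp
qed

text \<open>Sampling to the right detects only the right end: the sample after \<open>b\<close> has
  left the interval, while the sample after an element of \<open>T\<close> below \<open>a\<close>
  does not reach \<open>a\<close>.\<close>

lemma jump_sum_closed:
  assumes "finite T" "gap_below T \<eta>" "a \<in> T" "b \<in> T" "a \<le> b"
  shows "jump_sum T \<eta> (\<lambda>t. if a \<le> t \<and> t \<le> b then 1 else 0) = 1"
proof -
  have g: "\<And>s t. s \<in> T \<Longrightarrow> t \<in> T \<Longrightarrow> s < t \<Longrightarrow> s + \<eta> < t" and \<eta>: "\<eta> > 0"
    using assms(2) by (auto simp: gap_below_def)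
  have "a \<le> t + \<eta> \<and> t + \<eta> \<le> b \<longleftrightarrow> a \<le> t \<and> t < b" if "t \<in> T" for t
    using g[OF that assms(3)] g[OF that assms(4)] \<eta> by argo
  then have "jump_sum T \<eta> (\<lambda>t. if a \<le> t \<and> t \<le> b then 1 else 0) = (\<Sum>t\<in>T. if t = b then 1 else 0)"
    unfolding jump_sum_def using assms(5) by (intro sum.cong) auto
  then show ?thesis using assms by simp
qed

text \<open>The only jump seen is at \<open>a\<close>, from 0 to \<open>- e\<close> just after it.
  At \<open>b\<close> both values are 0, and samples after earlier elements of \<open>T\<close> do
  not reach \<open>b\<close>.\<close>

lemma jump_sum_open:
  assumes "finite T" "gap_below T \<eta>" "a \<in> T" "b \<in> T" "a < b"
  shows "jump_sum T \<eta> (\<lambda>t. if a < t \<and> t < b then - e else 0) = e"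
proof -
  have g: "\<And>s t. s \<in> T \<Longrightarrow> t \<in> T \<Longrightarrow> s < t \<Longrightarrow> s + \<eta> < t" and \<eta>: "\<eta> > 0"
    using assms(2) by (auto simp: gap_below_def)
  have "a < t + \<eta> \<and> t + \<eta> < b \<longleftrightarrow> a \<le> t \<and> t < b" if "t \<in> T" for t
    using g[OF that assms(3)] g[OF that assms(4)] \<eta> by argo
  then have "jump_sum T \<eta> (\<lambda>t. if a < t \<and> t < b then - e else 0) = (\<Sum>t\<in>T. if t = a then e else 0)"
    unfolding jump_sum_def using assms(5) by (intro sum.cong) auto
  then show ?thesis using assms by simp
qed

lemma bounded_open_interval_eq:
  fixes J :: "real set"
  assumes "convex J" "open J" "bounded J" "J \<noteq> {}"
  obtains a b where "a < b" "J = {a<..<b}"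
proof -
  have bdd: "bdd_above J" "bdd_below J"
    using assms(3) by (simp_all add: bounded_imp_bdd_above bounded_imp_bdd_below)
  have "t < Sup J \<and> Inf J < t" if t: "t \<in> J" for t
  proof -
    obtain e where e: "e > 0" "cball t e \<subseteq> J" using assms(2) t by (metis open_contains_cball)
    then have "t + e \<in> J" "t - e \<in> J" by (auto simp: dist_real_def subset_iff)
    then have "t + e \<le> Sup J" "Inf J \<le> t - e"
      using bdd by (auto intro: cSup_upper cInf_lower)
    then show ?thesis using e(1) by simp
  qed
  moreover have "t \<in> J" if t: "Inf J < t" "t < Sup J" for t
  proof -
    obtain p where "p \<in> J" "p < t" using t(1) cInf_less_iff[OF assms(4) bdd(2)] by blast
    moreover obtain q where "q \<in> J" "t < q" using t(2) less_cSup_iff[OF assms(4) bdd(1)] by blast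
    ultimately show ?thesis
      using assms(1) by (meson is_interval_convex_1 less_imp_le mem_is_interval_1_I)
  qed
  ultimately have "J = {Inf J<..<Sup J}" by auto
  then show ?thesis using assms(4) that[of "Inf J" "Sup J"] by (cases "Inf J < Sup J") auto
qed

text \<open>Slices of a compact cell have value 1 over a closed interval. A relatively open cell
  lies in a single slice or has slices of one dimension less over an open interval; the change of
  sign is undone by \<open>jump_sum_open\<close>. The set \<open>T0\<close> holds the end
  points.\<close>

lemma jump_sum_cell:
  fixes S :: "'a::euclidean_space set"
  assumes S: "convex_cell S"
  obtains T0 where "finite T0"
    "\<And>T \<eta>. finite T \<Longrightarrow> T0 \<subseteq> T \<Longrightarrow> gap_below T \<eta> \<Longrightarrow>
       jump_sum T \<eta> (\<lambda>t. eul (S \<inter> {y. b \<bullet> y = t})) = eul S"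
proof (cases "S = {}")
  case True
  then show ?thesis using that[of "{}"] by (simp add: jump_sum_def)
next
  case ne: False
  have cv: "convex S" and bd: "bounded S" using S by (auto simp: convex_cell_def)
  have lin: "linear (\<lambda>y. b \<bullet> y)" by (simp add: bounded_linear.linear bounded_linear_inner_right)
  have cvJ: "convex ((\<lambda>y. b \<bullet> y) ` S)" using cv lin by (rule convex_linear_image[rotated])
  show ?thesis
  proof (cases "compact S")
    case True
    have "compact ((\<lambda>y. b \<bullet> y) ` S)" "connected ((\<lambda>y. b \<bullet> y) ` S)"
      using True cvJ by (auto intro!: compact_continuous_image continuous_intros convex_connected)
    then obtain a c where ac: "(\<lambda>y. b \<bullet> y) ` S = {a..c}"
      using connected_compact_interval_1 by (metis box_real(2))
    then have "a \<le> c" using ne by (metis atLeastatMost_empty_iff image_is_empty)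
    have "eul (S \<inter> {y. b \<bullet> y = t}) = (if a \<le> t \<and> t \<le> c then 1 else 0)" for t
    proof (cases "a \<le> t \<and> t \<le> c")
      case t: True
      then have "t \<in> (\<lambda>y. b \<bullet> y) ` S" using ac by auto
      then have "S \<inter> {y. b \<bullet> y = t} \<noteq> {}" by auto
      then show ?thesis using t True by (simp add: eul_compact compact_Int_closed closed_hyperplane)
    next
      case False
      then have "S \<inter> {y. b \<bullet> y = t} = {}" using ac by (auto simp: set_eq_iff image_iff)
      then show ?thesis using False by simp
    qed
    then show ?thesis
      using jump_sum_closed \<open>a \<le> c\<close> ne True that[of "{a,c}"] by (simp add: eul_compact)
  next
    case False
    then have ro: "rel_interior S = S" using S by (auto simp: convex_cell_def)
    show ?thesis
    proof (cases "\<exists>t0. S \<subseteq> {y. b \<bullet> y = t0}")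
      case True
      then obtain t0 where t0: "S \<subseteq> {y. b \<bullet> y = t0}" by blast
      then have "eul (S \<inter> {y. b \<bullet> y = t}) = (if t = t0 then eul S else 0)" for t
        by (cases "t = t0") (auto simp: Int_absorb2 intro!: arg_cong[of _ "{}" eul, simplified])
      then show ?thesis
        using jump_sum_point that[of "{t0}"] by simp
    next
      case nt: False
      define J where "J = (\<lambda>y. b \<bullet> y) ` S"
      have "rel_interior J = J"
        using rel_interior_convex_linear_image[OF lin cv] ro by (simp add: J_def)
      moreover have "interior J \<noteq> {}"
      proof -
        obtain y z where yz: "y \<in> S" "z \<in> S" "b \<bullet> y < b \<bullet> z"
          using ne nt by (metis (mono_tags, lifting) all_not_in_conv linorder_neqE_linordered_idom mem_Collect_eq subsetI)
        then have "b \<bullet> y \<in> J" "b \<bullet> z \<in> J" "is_interval J"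
          using cvJ by (auto simp: J_def is_interval_convex_1)
        then have "{b \<bullet> y <..< b \<bullet> z} \<subseteq> J"
          by (meson greaterThanLessThan_iff less_imp_le mem_is_interval_1_I subsetI)
        then have "{b \<bullet> y <..< b \<bullet> z} \<subseteq> interior J" by (simp add: interior_maximal)
        then show ?thesis using yz(3) by (metis greaterThanLessThan_empty_iff not_le subset_empty)
      qed
      ultimately have "open J"
        by (metis rel_interior_nonempty_interior open_interior)
      moreover have "bounded J" "J \<noteq> {}"
        using bd ne lin by (auto simp: J_def linear_conv_bounded_linear intro!: bounded_linear_image)
      ultimately obtain a c where ac: "a < c" "J = {a<..<c}"
        using bounded_open_interval_eq cvJ by (metis J_def)
      have e: "eul S = (-1) ^ nat (aff_dim S)" by (rule eul_rel_open[OF ro bd ne])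
      have "eul (S \<inter> {y. b \<bullet> y = t}) = (if a < t \<and> t < c then - eul S else 0)" for t
      proof (cases "a < t \<and> t < c")
        case t: True
        then have "t \<in> J" using ac by auto
        then have ne_t: "S \<inter> {y. b \<bullet> y = t} \<noteq> {}" by (auto simp: J_def)
        have ro_t: "rel_interior (S \<inter> {y. b \<bullet> y = t}) = S \<inter> {y. b \<bullet> y = t}"
          using convex_affine_rel_interior_Int[of S "{y. b \<bullet> y = t}"] cv ne_t ro
          by (simp add: affine_hyperplane)
        have op: "openin (top_of_set (affine hull S)) S" using ro by (metis openin_rel_interior)
        \<comment> \<open>The slice is open in the sliced hull and so spans it; a hyperplane that
          meets the hull without containing it lowers the dimension by exactly 1.\<close>
        have "affine hull (S \<inter> {y. b \<bullet> y = t}) = affine hull S \<inter> {y. b \<bullet> y = t}"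
        proof -
          have aff: "affine (affine hull S \<inter> {y. b \<bullet> y = t})"
            by (simp add: affine_Int affine_hyperplane)
          have "openin (top_of_set (affine hull S \<inter> {y. b \<bullet> y = t})) (S \<inter> {y. b \<bullet> y = t})"
            using op by (auto simp: openin_open)
          then have "openin (top_of_set (affine hull (affine hull S \<inter> {y. b \<bullet> y = t}))) (S \<inter> {y. b \<bullet> y = t})"
            using aff by (simp add: hull_same)
          then have "affine hull (S \<inter> {y. b \<bullet> y = t}) = affine hull (affine hull S \<inter> {y. b \<bullet> y = t})"
            by (rule affine_hull_openin[OF _ ne_t])
          then show ?thesis using aff by (simp add: hull_same)
        qed
        moreover have "aff_dim (affine hull S \<inter> {y. b \<bullet> y = t}) = aff_dim S - 1"
          using aff_dim_affine_Int_hyperplane[of "affine hull S" b t] ne_t nt hull_subset[of S affine]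
          by (auto simp: aff_dim_affine_hull)
        ultimately have d: "aff_dim (S \<inter> {y. b \<bullet> y = t}) = aff_dim S - 1"
          by (metis aff_dim_affine_hull)
        have "aff_dim S - 1 \<ge> 0" using d ne_t by (metis aff_dim_negative_iff not_less)
        then have "nat (aff_dim S) = Suc (nat (aff_dim S - 1))" by simp
        then show ?thesis
          using eul_rel_open[OF ro_t _ ne_t] bd t d e by (simp add: bounded_Int)
      next
        case t: False
        then have "S \<inter> {y. b \<bullet> y = t} = {}" using ac by (auto simp: J_def set_eq_iff image_iff)
        then show ?thesis using t by auto
      qed
      then show ?thesis
        using jump_sum_open ac(1) that[of "{a,c}"] by simp
    qed
  qed
qed

text \<open>One finite \<open>T\<close> and one step \<open>\<eta>\<close> serve all cells at once,
  so the weighted sum becomes a combination of slice sums at \<open>t\<close> and at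
  \<open>t + \<eta>\<close>, all of them 0.\<close>

lemma euler_slices:
  fixes R :: "'i \<Rightarrow> 'a::euclidean_space set"
  assumes I: "finite I" and R: "\<And>i. i \<in> I \<Longrightarrow> convex_cell (R i)"
    and z: "\<And>t. (\<Sum>i\<in>I. c i * eul (R i \<inter> {y. b \<bullet> y = t})) = 0"
  shows "(\<Sum>i\<in>I. c i * eul (R i)) = 0"
proof -
  have "\<exists>T0. finite T0 \<and> (\<forall>T \<eta>. finite T \<longrightarrow> T0 \<subseteq> T \<longrightarrow> gap_below T \<eta> \<longrightarrow>
       jump_sum T \<eta> (\<lambda>t. eul (R i \<inter> {y. b \<bullet> y = t})) = eul (R i))" if "i \<in> I" for i
    using jump_sum_cell[OF R[OF that], of b] by metis
  then obtain T0 where T0: "\<And>i. i \<in> I \<Longrightarrow> finite (T0 i)"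
    "\<And>i T \<eta>. i \<in> I \<Longrightarrow> finite T \<Longrightarrow> T0 i \<subseteq> T \<Longrightarrow> gap_below T \<eta> \<Longrightarrow>
       jump_sum T \<eta> (\<lambda>t. eul (R i \<inter> {y. b \<bullet> y = t})) = eul (R i)" by metis
  define T where "T = (\<Union>i\<in>I. T0 i)"
  have T: "finite T" using I T0(1) by (auto simp: T_def)
  obtain \<eta> where \<eta>: "gap_below T \<eta>" using gap_below_exists[OF T] .
  have "(\<Sum>i\<in>I. c i * eul (R i)) = (\<Sum>i\<in>I. c i * jump_sum T \<eta> (\<lambda>t. eul (R i \<inter> {y. b \<bullet> y = t})))"
  proof (rule sum.cong[OF refl])
    fix i assume i: "i \<in> I"
    then have "T0 i \<subseteq> T" by (auto simp: T_def)
    then show "c i * eul (R i) = c i * jump_sum T \<eta> (\<lambda>t. eul (R i \<inter> {y. b \<bullet> y = t}))"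
      using T0(2)[OF i T _ \<eta>] by simp
  qed
  also have "\<dots> = (\<Sum>t\<in>T. \<Sum>i\<in>I. c i * (eul (R i \<inter> {y. b \<bullet> y = t}) - eul (R i \<inter> {y. b \<bullet> y = t + \<eta>})))"
    unfolding jump_sum_def sum_distrib_left by (rule sum.swap)
  also have "\<dots> = 0"
    using z by (simp add: right_diff_distrib sum_subtractf)
  finally show ?thesis .
qed

text \<open>Fubini for the Euler valuation: a weighted sum vanishes if it does so on every fibre of
  the linear map with components \<open>B\<close>. One component is sliced at a time.\<close>

lemma euler_fibres:
  fixes R :: "'i \<Rightarrow> 'a::euclidean_space set"
  assumes B: "finite B" and I: "finite I" and R: "\<And>i. i \<in> I \<Longrightarrow> convex_cell (R i)"
    and z: "\<And>x. (\<Sum>i\<in>I. c i * eul (R i \<inter> {y. \<forall>b\<in>B. b \<bullet> y = b \<bullet> x})) = 0"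
  shows "(\<Sum>i\<in>I. c i * eul (R i)) = 0"
  using B z
proof (induction B)
  case (insert b B)
  show ?case
  proof (rule insert.IH)
    fix x
    show "(\<Sum>i\<in>I. c i * eul (R i \<inter> {y. \<forall>b\<in>B. b \<bullet> y = b \<bullet> x})) = 0"
    proof (rule euler_slices[OF I convex_cell_slices[OF insert.hyps(1) R]])
      fix t
      show "(\<Sum>i\<in>I. c i * eul (R i \<inter> {y. \<forall>b\<in>B. b \<bullet> y = b \<bullet> x} \<inter> {y. b \<bullet> y = t})) = 0"
      \<comment> \<open>The functionals may be dependent, so not all combinations of values occur;
        the slices belonging to the others are empty.\<close>
      proof (cases "\<exists>x'. (\<forall>b\<in>B. b \<bullet> x' = b \<bullet> x) \<and> b \<bullet> x' = t")
        case True
        then obtain x' where x': "\<forall>b\<in>B. b \<bullet> x' = b \<bullet> x" "b \<bullet> x' = t" by blast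
        have "R i \<inter> {y. \<forall>b\<in>B. b \<bullet> y = b \<bullet> x} \<inter> {y. b \<bullet> y = t} = R i \<inter> {y. \<forall>b\<in>insert b B. b \<bullet> y = b \<bullet> x'}" for i
          using x' by auto
        then show ?thesis using insert.prems[of x'] by simp
      next
        case False
        then have "R i \<inter> {y. \<forall>b\<in>B. b \<bullet> y = b \<bullet> x} \<inter> {y. b \<bullet> y = t} = {}" for i by blast
        then show ?thesis by simp
      qed
    qed
  qed
qed simp

text \<open>Fibres over all coordinates are points. Hence \<open>eul\<close> respects every linear
  relation between indicator functions of cells.\<close>

lemma euler_pointwise:
  fixes R :: "'i \<Rightarrow> 'a::euclidean_space set"
  assumes I: "finite I" and R: "\<And>i. i \<in> I \<Longrightarrow> convex_cell (R i)"
    and z: "\<And>x. (\<Sum>i\<in>I. c i * of_bool (x \<in> R i)) = 0"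
  shows "(\<Sum>i\<in>I. c i * eul (R i)) = 0"
proof (rule euler_fibres[OF finite_Basis I R])
  fix x :: 'a
  have "{y. \<forall>b\<in>Basis. b \<bullet> y = b \<bullet> x} = {x}"
    by (auto simp: euclidean_eq_iff[where 'a='a] inner_commute)
  then have "eul (R i \<inter> {y. \<forall>b\<in>Basis. b \<bullet> y = b \<bullet> x}) = of_bool (x \<in> R i)" for i
    by (cases "x \<in> R i") (auto simp: eul_compact)
  then show "(\<Sum>i\<in>I. c i * eul (R i \<inter> {y. \<forall>b\<in>Basis. b \<bullet> y = b \<bullet> x})) = 0"
    using z[of x] by simp
qed

lemma eul_disjoint_Union:
  fixes \<R> :: "'a::euclidean_space set set"
  assumes "finite \<R>" "\<And>R. R \<in> \<R> \<Longrightarrow> convex_cell R" "disjoint \<R>" "convex_cell (\<Union>\<R>)"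
  shows "eul (\<Union>\<R>) = (\<Sum>R\<in>\<R>. eul R)"
proof -
  \<comment> \<open>\<open>None\<close> stands for the union, with weight -1, and
    \<open>Some R\<close> for a piece, with weight 1; disjointness makes the weighted indicators
    cancel.\<close>
  define S where "S = case_option (\<Union>\<R>) (\<lambda>R. R)"
  define c where "c = case_option (-1 :: int) (\<lambda>_ :: 'a set. 1)"
  have split: "(\<Sum>i\<in>insert None (Some ` \<R>). f i) = f None + (\<Sum>R\<in>\<R>. f (Some R))" for f :: "'a set option \<Rightarrow> int"
    using assms(1) by (simp add: sum.reindex)
  have "(\<Sum>i\<in>insert None (Some ` \<R>). c i * eul (S i)) = 0"
  proof (rule euler_pointwise)
    show "convex_cell (S i)" if "i \<in> insert None (Some ` \<R>)" for i
      using that assms by (auto simp: S_def)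
    fix x
    have "(\<Sum>R\<in>\<R>. of_bool (x \<in> R)) = (of_bool (x \<in> \<Union>\<R>) :: int)"
    proof (cases "x \<in> \<Union>\<R>")
      case True
      then obtain R where R: "R \<in> \<R>" "x \<in> R" by blast
      then have uniq: "x \<in> R' \<longleftrightarrow> R' = R" if "R' \<in> \<R>" for R'
        using that assms(3) by (auto simp: disjoint_def)
      have "(\<Sum>R'\<in>\<R>. of_bool (x \<in> R')) = (\<Sum>R'\<in>\<R>. if R' = R then 1 else 0 :: int)"
        by (intro sum.cong refl) (simp add: uniq)
      then show ?thesis using assms(1) R True by (simp add: sum.delta del: sum_of_bool_eq Union_iff)
    qed (auto intro!: sum.neutral)
    then show "(\<Sum>i\<in>insert None (Some ` \<R>). c i * of_bool (x \<in> S i)) = 0"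
      unfolding split by (simp add: c_def S_def del: Union_iff sum_of_bool_eq)
  qed (use assms in auto)
  then show ?thesis unfolding split by (simp add: c_def S_def)
qed

subsection \<open>Radial retraction of a polytopal complex\<close>

lemma polytopal_complexD:
  assumes "polytopal_complex \<C>"
  shows "finite \<C>" "\<And>P. P \<in> \<C> \<Longrightarrow> polytope P"
    "\<And>P F. P \<in> \<C> \<Longrightarrow> F face_of P \<Longrightarrow> F \<in> \<C>"
    "\<And>P Q. P \<in> \<C> \<Longrightarrow> Q \<in> \<C> \<Longrightarrow> (P \<inter> Q) face_of P"
    "\<And>P Q. P \<in> \<C> \<Longrightarrow> Q \<in> \<C> \<Longrightarrow> (P \<inter> Q) face_of Q"
    "\<And>P Q. P \<in> \<C> \<Longrightarrow> Q \<in> \<C> \<Longrightarrow> P \<inter> Q \<in> \<C>"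
  using assms unfolding polytopal_complex_def face_closed_def by blast+

lemma complex_cell:
  assumes "polytopal_complex \<C>" "P \<in> \<C>"
  shows "compact P" "convex P" "closed P" "bounded P"
  using polytopal_complexD(2)[OF assms]
  by (simp_all add: polytope_imp_compact polytope_imp_convex polytope_imp_closed polytope_imp_bounded)

lemma polytopal_complex_subset:
  assumes "polytopal_complex \<C>" "\<D> \<subseteq> \<C>" "face_closed \<D>"
  shows "polytopal_complex \<D>"
  using assms unfolding polytopal_complex_def by (meson finite_subset subset_iff)

definition antistar :: "'a set set \<Rightarrow> 'a \<Rightarrow> 'a set set" where
  "antistar \<C> x = {G \<in> \<C>. x \<notin> G}"

lemma antistar_complex:
  assumes "polytopal_complex \<C>"
  shows "polytopal_complex (antistar \<C> x)"
proof (rule polytopal_complex_subset[OF assms])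
  show "face_closed (antistar \<C> x)"
    using polytopal_complexD(3)[OF assms] face_of_imp_subset
    unfolding face_closed_def antistar_def by blast
qed (auto simp: antistar_def)

lemma closed_Union_complex:
  assumes "polytopal_complex \<C>"
  shows "closed (\<Union>\<C>)" "compact (\<Union>\<C>)"
  using polytopal_complexD(1)[OF assms] complex_cell[OF assms] by (auto intro!: closed_Union compact_Union)

text \<open>The face is the intersection of all faces containing \<open>x\<close>. On its relative
  boundary, \<open>x\<close> would lie in one of its facets, a smaller face.\<close>

lemma rel_interior_cell_exists:
  fixes P :: "'a::euclidean_space set"
  assumes "polytope P" "x \<in> P"
  obtains F where "F face_of P" "x \<in> rel_interior F"
proof -
  have "polyhedron P" using assms by (simp add: polytope_imp_polyhedron)
  define \<F> where "\<F> = {F. F face_of P \<and> x \<in> F}"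
  define F where "F = \<Inter>\<F>"
  have "P \<in> \<F>" using assms by (auto simp: \<F>_def face_of_refl polytope_imp_convex)
  then have F: "F face_of P" "x \<in> F" unfolding F_def
    by (auto simp: \<F>_def intro!: face_of_Inter)
  have "polyhedron F" using F(1) \<open>polyhedron P\<close> by (rule face_of_polyhedron_polyhedron[rotated])
  have "x \<in> rel_interior F"
  proof (rule ccontr)
    assume "x \<notin> rel_interior F"
    then obtain G where "G facet_of F" "x \<in> G"
      using rel_boundary_of_polyhedron[OF \<open>polyhedron F\<close>] F(2) by auto
    then have "G \<in> \<F>" "G \<subset> F"
      using F(1) by (auto simp: \<F>_def facet_of_imp_face_of dest: facet_of_imp_face_of face_of_trans facet_of_imp_subset)
    then show False by (auto simp: F_def)
  qed
  then show ?thesis using that F by blast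
qed

lemma face_subset_of_rel_interior:
  fixes S :: "'a::euclidean_space set"
  assumes "T face_of S" "x \<in> rel_interior U" "x \<in> T" "U \<subseteq> S"
  shows "U \<subseteq> T"
  using assms subset_of_face_of[OF assms(1,4)] by blast

text \<open>A face that meets the relative interior of a subset contains that subset. Applied to the
  face \<open>F \<inter> G\<close> of \<open>F\<close>, this gives
  \<open>F \<subseteq> G\<close>.\<close>

lemma complex_cell_subset:
  assumes "polytopal_complex \<C>" "F \<in> \<C>" "G \<in> \<C>" "x \<in> rel_interior F" "x \<in> G"
  shows "F face_of G"
proof -
  have "F \<subseteq> F \<inter> G"
    by (rule face_subset_of_rel_interior[OF polytopal_complexD(4)[OF assms(1-3)] assms(4)])
       (use assms rel_interior_subset in auto)
  then have "F \<inter> G = F" by auto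
  then show ?thesis using polytopal_complexD(5)[OF assms(1-3)] by simp
qed

lemma polytope_halfspaces:
  fixes P :: "'a::euclidean_space set"
  assumes "polytope P"
  obtains I :: "'a set set" and a b where "finite I" "P = {y. \<forall>i\<in>I. a i \<bullet> y \<le> (b i::real)}"
proof -
  have "polyhedron P" using assms by (simp add: polytope_imp_polyhedron)
  then obtain F where F: "finite F" "P = \<Inter>F" "\<forall>h\<in>F. \<exists>a b. a \<noteq> 0 \<and> h = {x. a \<bullet> x \<le> b}"
    by (auto simp: polyhedron_def)
  then have "\<forall>h\<in>F. \<exists>a b. h = {x. a \<bullet> x \<le> b}" by blast
  then obtain a b where "\<And>h. h \<in> F \<Longrightarrow> h = {x. a h \<bullet> x \<le> (b h)}" by metis
  then have "P = {y. \<forall>h\<in>F. a h \<bullet> y \<le> b h}" unfolding F(2) by blast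
  then show ?thesis using that F(1) by blast
qed

text \<open>
  The constraints that are inactive at \<open>x\<close> bound the distance to the exit point along rays from \<open>x\<close>.
\<close>

lemma exit_map:
  fixes P :: "'a::euclidean_space set"
  assumes P: "polytope P" and x: "x \<in> P"
  obtains r where "continuous_on (P - {x}) r"
    "\<And>y. y \<in> P - {x} \<Longrightarrow> r y \<in> P \<and> (\<exists>s\<ge>1. r y = x + s *\<^sub>R (y - x) \<and> (\<forall>s'>s. x + s' *\<^sub>R (y - x) \<notin> P))"
proof (cases "P = {x}")
  case True
  then show ?thesis using that by auto
next
  case ne: False
  obtain I :: "'a set set" and a b where I: "finite I" "P = {y. \<forall>i\<in>I. a i \<bullet> y \<le> (b i::real)}"
    using polytope_halfspaces[OF P] .
  define J where "J = {i\<in>I. a i \<bullet> x < b i}"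
  \<comment> \<open>The inactive constraint with the largest ratio is the first one violated along
    the ray, so \<open>1 / g y\<close> is the exit parameter. A maximum of finitely many affine
    functions, \<open>g\<close> is continuous.\<close>
  define g where "g = (\<lambda>y. Max ((\<lambda>i. a i \<bullet> (y - x) / (b i - a i \<bullet> x)) ` J))"
  have fJ: "finite J" using I by (auto simp: J_def)
  have bP: "bounded P" using P polytope_imp_bounded by blast
  have escape: "\<exists>s>0. x + s *\<^sub>R v \<notin> P" if "v \<noteq> 0" for v
  proof -
    obtain B where B: "\<And>y. y \<in> P \<Longrightarrow> norm y \<le> B" using bP bounded_iff by blast
    define s where "s = (B + norm x + 1) / norm v"
    have "B \<ge> 0" using B[OF x] norm_ge_zero order_trans by blast
    then have "s > 0" "norm (s *\<^sub>R v) = B + norm x + 1" using that by (auto simp: s_def divide_pos_pos add_nonneg_pos)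
    moreover have "norm (s *\<^sub>R v) \<le> norm (x + s *\<^sub>R v) + norm x"
      by (metis add.commute add_diff_cancel_left' norm_triangle_ineq4)
    ultimately show ?thesis using B by (intro exI[of _ s]) force
  qed
  have in_P: "x + s *\<^sub>R v \<in> P \<longleftrightarrow> (\<forall>i\<in>J. s * (a i \<bullet> v / (b i - a i \<bullet> x)) \<le> 1)"
    if v: "\<forall>i\<in>I - J. a i \<bullet> v \<le> 0" and s: "s \<ge> 0" for s v
  proof -
    have "a i \<bullet> (x + s *\<^sub>R v) \<le> b i" if "i \<in> I - J" for i
    proof -
      have "a i \<bullet> x \<le> b i" using x I that by auto
      moreover have "s * (a i \<bullet> v) \<le> 0" using v s that by (simp add: mult_nonneg_nonpos)
      ultimately show ?thesis by (simp add: inner_add_right)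
    qed
    moreover have "a i \<bullet> (x + s *\<^sub>R v) \<le> b i \<longleftrightarrow> s * (a i \<bullet> v / (b i - a i \<bullet> x)) \<le> 1" if "i \<in> J" for i
      using that by (auto simp: J_def inner_add_right field_simps)
    ultimately show ?thesis using I by (auto simp: J_def)
  qed
  have act: "\<forall>i\<in>I - J. a i \<bullet> (y - x) \<le> 0" if "y \<in> P" for y
    using that x I by (auto simp: J_def inner_diff_right)
  \<comment> \<open>Without inactive constraints \<open>P\<close> would contain a whole ray,
    contrary to boundedness.\<close>
  have Jne: "J \<noteq> {}"
  proof
    assume "J = {}"
    obtain y where y: "y \<in> P" "y \<noteq> x" using ne x by blast
    obtain s where "s > 0" "x + s *\<^sub>R (y - x) \<notin> P" using escape[of "y - x"] y by auto
    then show False using in_P[OF act[OF y(1)], of s] \<open>J = {}\<close> by auto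
  qed
  have in_P': "x + s *\<^sub>R (y - x) \<in> P \<longleftrightarrow> s * g y \<le> 1" if "y \<in> P" "s \<ge> 0" for s y
  proof -
    let ?A = "(\<lambda>i. a i \<bullet> (y - x) / (b i - a i \<bullet> x)) ` J"
    have "g y \<in> ?A" unfolding g_def using fJ Jne by (intro Max_in) auto
    moreover have "\<And>q. q \<in> ?A \<Longrightarrow> q \<le> g y" unfolding g_def using fJ by simp
    ultimately have "s * g y \<le> 1 \<longleftrightarrow> (\<forall>q\<in>?A. s * q \<le> 1)"
      using that(2) by (meson mult_left_mono order_trans)
    then show ?thesis using in_P[OF act[OF that(1)] that(2)] by simp
  qed
  have gpos: "g y > 0" if y: "y \<in> P - {x}" for y
  proof (rule ccontr)
    assume "\<not> g y > 0"
    moreover obtain s where "s > 0" "x + s *\<^sub>R (y - x) \<notin> P" using escape[of "y - x"] y by auto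
    ultimately show False using in_P'[of y s] y by (smt (verit) DiffD1 mult_nonneg_nonpos)
  qed
  have contg: "continuous_on S g" for S
  proof -
    have "continuous_on S (\<lambda>y. Max ((\<lambda>i. a i \<bullet> (y - x) / (b i - a i \<bullet> x)) ` K))" if "finite K" "K \<noteq> {}" "K \<subseteq> J" for K
      using that
    proof (induction K rule: finite_ne_induct)
      case (singleton i)
      then show ?case by (auto intro!: continuous_intros simp: J_def)
    next
      case (insert i K)
      have "continuous_on S (\<lambda>y. max (a i \<bullet> (y - x) / (b i - a i \<bullet> x)) (Max ((\<lambda>i. a i \<bullet> (y - x) / (b i - a i \<bullet> x)) ` K)))"
        using insert by (intro continuous_intros) (auto simp: J_def)
      then show ?case using insert by (simp add: Max_insert)
    qed
    then show ?thesis unfolding g_def using fJ Jne by blast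
  qed
  define r where "r = (\<lambda>y. x + (1 / g y) *\<^sub>R (y - x))"
  show ?thesis
  proof (rule that[of r])
    have "\<forall>y\<in>P - {x}. g y \<noteq> 0" using gpos by force
    then show "continuous_on (P - {x}) r"
      unfolding r_def by (intro continuous_intros contg)
    fix y assume y: "y \<in> P - {x}"
    have g: "0 < g y" "g y \<le> 1"
      using gpos[OF y] in_P'[of y 1] y by auto
    have "r y \<in> P" using in_P'[of y "1 / g y"] y g by (auto simp: r_def)
    moreover have "x + s' *\<^sub>R (y - x) \<notin> P" if "s' > 1 / g y" for s'
    proof -
      have "s' > 0" using that g by (meson divide_pos_pos less_trans zero_less_one)
      then show ?thesis using in_P'[of y s'] y g that by (auto simp: field_simps)
    qed
    ultimately show "r y \<in> P \<and> (\<exists>s\<ge>1. r y = x + s *\<^sub>R (y - x) \<and> (\<forall>s'>s. x + s' *\<^sub>R (y - x) \<notin> P))"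
      using g by (intro conjI exI[of _ "1 / g y"]) (auto simp: r_def)
  qed
qed

lemma exit_unique:
  assumes "\<forall>s'>s. x + s' *\<^sub>R v \<notin> P" "x + s *\<^sub>R v \<in> P"
    "\<forall>s'>t. x + s' *\<^sub>R v \<notin> P" "x + t *\<^sub>R v \<in> P"
  shows "s = (t::real)"
  using assms by (meson linorder_neqE_linordered_idom)

lemma face_ray:
  assumes F: "F face_of G" and x: "x \<in> F" "y \<in> F" "y \<noteq> x" and s: "1 \<le> s" "x + s *\<^sub>R (y - x) \<in> G"
  shows "x + s *\<^sub>R (y - x) \<in> F"
proof (cases "s = 1")
  case True
  then show ?thesis using x by simp
next
  case False
  let ?z = "x + s *\<^sub>R (y - x)"
  have "y = (1 - 1/s) *\<^sub>R x + (1/s) *\<^sub>R ?z" using s by (simp add: algebra_simps)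
  moreover have "?z \<noteq> x" using s x by auto
  ultimately have "y \<in> open_segment x ?z"
    using s False by (auto simp: in_segment intro!: exI[of _ "1/s"])
  then show ?thesis
    using face_ofD[OF F, of y x ?z] x s face_of_imp_subset[OF F] by blast
qed

text \<open>Each cell containing \<open>x\<close> is pushed along rays from \<open>x\<close> to the
  exit points. These maps agree on overlaps, because a ray from \<open>x\<close> through a point of
  a common face leaves both cells at the same place, and cells avoiding \<open>x\<close> stay fixed.
  The straight-line homotopy remains in one cell and misses \<open>x\<close>.\<close>

lemma antistar_retraction:
  fixes \<C> :: "'a::euclidean_space set set"
  assumes \<C>: "polytopal_complex \<C>" and x: "x \<in> \<Union>\<C>"
  shows "top_of_set (\<Union>\<C> - {x}) homotopy_equivalent_space top_of_set (\<Union>(antistar \<C> x))"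
proof -
  define exits where "exits = (\<lambda>G y z. z \<in> G \<and> (\<exists>s\<ge>1::real. z = x + s *\<^sub>R (y - x) \<and> (\<forall>s'>s. x + s' *\<^sub>R (y - x) \<notin> G)))"
  have "\<exists>r. continuous_on (G - {x}) r \<and>
       (\<forall>y\<in>G - {x}. if x \<in> G then exits G y (r y) else r y = y)" if "G \<in> \<C>" for G
  proof (cases "x \<in> G")
    case True
    then show ?thesis
      using exit_map[OF polytopal_complexD(2)[OF \<C> that] True] unfolding exits_def by (metis (no_types, lifting))
  qed (auto intro: continuous_on_id)
  then obtain R where R: "\<And>G. G \<in> \<C> \<Longrightarrow> continuous_on (G - {x}) (R G)"
    "\<And>G y. G \<in> \<C> \<Longrightarrow> y \<in> G - {x} \<Longrightarrow> if x \<in> G then exits G y (R G y) else R G y = y"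
    by metis
  have exits_face: "exits F y z \<longleftrightarrow> exits G y z" if "F face_of G" "x \<in> F" "y \<in> F" "y \<noteq> x" for F G y z
    using face_ray[OF that(1-4)] face_of_imp_subset[OF that(1)] unfolding exits_def
    by (smt (verit, best) subsetD)
  have exits_unique: "z = z'" if "exits G y z" "exits G y z'" for G y z z'
    using that exit_unique unfolding exits_def by metis
  have agree: "R G y = R H y" if "G \<in> \<C>" "H \<in> \<C>" "y \<in> G" "y \<in> H" "y \<noteq> x" for G H y
  proof -
    \<comment> \<open>If \<open>y\<close> also lies in a cell avoiding \<open>x\<close>, the ray
      ends at \<open>y\<close> already: were \<open>y\<close> strictly between \<open>x\<close> and
      the exit point, the common face through \<open>y\<close> would contain
      \<open>x\<close>.\<close>
    have out: "R H y = y" if H: "H \<in> \<C>" "G \<in> \<C>" "y \<in> G" "y \<in> H" "x \<notin> G" "x \<in> H" for G H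
    proof -
      have F: "(H \<inter> G) face_of H" using polytopal_complexD(4)[OF \<C>] H by blast
      have e: "exits H y (R H y)" using R(2)[of H y] H \<open>y \<noteq> x\<close> by simp
      then obtain s where s: "s \<ge> 1" "R H y = x + s *\<^sub>R (y - x)" "R H y \<in> H"
        by (auto simp: exits_def)
      show ?thesis
      proof (cases "s = 1")
        case False
        have "y = (1 - 1/s) *\<^sub>R x + (1/s) *\<^sub>R R H y" unfolding s(2) using s(1) by (simp add: algebra_simps)
        moreover have "R H y \<noteq> x" using s \<open>y \<noteq> x\<close> by auto
        ultimately have "y \<in> open_segment x (R H y)"
          using s False by (auto simp: in_segment intro!: exI[of _ "1/s"])
        then have "x \<in> H \<inter> G" using face_ofD[OF F, of y x "R H y"] H s by blast
        then show ?thesis using H by blast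
      qed (use s in simp)
    qed
    show ?thesis
    proof (cases "x \<in> G \<and> x \<in> H")
      case True
      have F: "(G \<inter> H) face_of G" "(G \<inter> H) face_of H" using polytopal_complexD(4,5)[OF \<C>] that by blast+
      have "exits G y (R G y)" "exits H y (R H y)" using R(2) that True by fastforce+
      then have "exits (G \<inter> H) y (R G y)" "exits (G \<inter> H) y (R H y)"
        using exits_face[OF F(1)] exits_face[OF F(2)] that True by blast+
      then show ?thesis by (rule exits_unique)
    next
      case False
      show ?thesis
      proof (cases "x \<in> G")
        case True
        then have "x \<notin> H" using False by blast
        then show ?thesis using out[OF that(1,2,4,3) _ True] R(2)[OF that(2), of y] that by simp
      next
        case xG: False
        show ?thesis
        proof (cases "x \<in> H")
          case True
          then show ?thesis using out[OF that(2,1,3,4) xG] R(2)[OF that(1), of y] that xG by simp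
        next
          case False
          then show ?thesis using R(2)[OF that(1), of y] R(2)[OF that(2), of y] that xG by simp
        qed
      qed
    qed
  qed
  define U where "U = \<Union>\<C> - {x}"
  define A where "A = \<Union>(antistar \<C> x)"
  define r where "r = (\<lambda>y. R (SOME G. G \<in> \<C> \<and> y \<in> G) y)"
  have r_eq: "r y = R G y" if "G \<in> \<C>" "y \<in> G" "y \<noteq> x" for G y
    unfolding r_def
    by (rule agree) (use someI[of "\<lambda>G. G \<in> \<C> \<and> y \<in> G" G] that in auto)
  have cont: "continuous_on U r"
  proof -
    have "continuous_on (\<Union>\<C>' - {x}) r" if "finite \<C>'" "\<C>' \<subseteq> \<C>" for \<C>'
      using that
    proof (induction \<C>')
      case (insert G \<C>')
      then have G: "G \<in> \<C>" and cl: "closed G" "closed (\<Union>\<C>')"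
        using complex_cell(3)[OF \<C>] by auto
      have "continuous_on (G - {x}) r"
        using R(1)[OF G] by (rule continuous_on_cong[THEN iffD1, rotated 2]) (use r_eq[OF G] in auto)
      moreover have "closedin (top_of_set (G - {x} \<union> (\<Union>\<C>' - {x}))) (G - {x})"
        "closedin (top_of_set (G - {x} \<union> (\<Union>\<C>' - {x}))) (\<Union>\<C>' - {x})"
        using cl by (auto simp: closedin_closed)
      moreover have "\<Union>(insert G \<C>') - {x} = (G - {x}) \<union> (\<Union>\<C>' - {x})" by auto
      ultimately show ?case using insert by (simp add: continuous_on_Un_local)
    qed simp
    then show ?thesis using polytopal_complexD(1)[OF \<C>] by (simp add: U_def)
  qed
  have AU: "A \<subseteq> U" by (auto simp: A_def U_def antistar_def)
  have r_id: "r y = y" if y: "y \<in> A" for y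
  proof -
    obtain G where G: "G \<in> \<C>" "x \<notin> G" "y \<in> G" using y by (auto simp: A_def antistar_def)
    then show ?thesis using r_eq[of G y] R(2)[of G y] by auto
  qed
  have r_main: "r y \<in> A \<and> closed_segment y (r y) \<subseteq> U" if y: "y \<in> U" for y
  proof -
    obtain G where G: "G \<in> \<C>" "y \<in> G" "y \<noteq> x" using y by (auto simp: U_def)
    show ?thesis
    proof (cases "x \<in> G")
      case False
      then have "y \<in> A" using G by (auto simp: A_def antistar_def)
      then show ?thesis using r_id y by auto
    next
      case True
      then have "exits G y (r y)" using R(2)[of G y] r_eq[OF G] G by simp
      then obtain s where s: "s \<ge> 1" "r y = x + s *\<^sub>R (y - x)" "r y \<in> G"
        "\<And>s'. s' > s \<Longrightarrow> x + s' *\<^sub>R (y - x) \<notin> G"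
        by (auto simp: exits_def)
      obtain K where K: "K face_of G" "r y \<in> rel_interior K"
        using rel_interior_cell_exists[OF polytopal_complexD(2)[OF \<C> G(1)] s(3)] .
      \<comment> \<open>The exit point is relatively interior to \<open>K\<close>; if
        \<open>K\<close> contained \<open>x\<close>, the segment from \<open>x\<close> could be
        prolonged inside \<open>K\<close> beyond the exit.\<close>
      have "x \<notin> K"
      proof
        assume xK: "x \<in> K"
        obtain e where e: "e > 1" "(1 - e) *\<^sub>R x + e *\<^sub>R r y \<in> K"
          using convex_rel_interior_if[OF face_of_imp_convex[OF K(1)] K(2)] hull_inc[OF xK] by (metis order_refl)
        have "(1 - e) *\<^sub>R x + e *\<^sub>R r y = x + (e * s) *\<^sub>R (y - x)" by (simp add: s(2) algebra_simps)
        moreover have "e * s > s" using e s by simp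
        ultimately show False using s(4) e(2) face_of_imp_subset[OF K(1)] by auto
      qed
      then have "r y \<in> A"
        using K polytopal_complexD(3)[OF \<C> G(1) K(1)] rel_interior_subset
        by (auto simp: A_def antistar_def)
      moreover have "closed_segment y (r y) \<subseteq> G"
        using s(3) G(2) complex_cell(2)[OF \<C> G(1)] by (simp add: closed_segment_subset)
      moreover have "x \<notin> closed_segment y (r y)"
      proof
        assume "x \<in> closed_segment y (r y)"
        then obtain u where u: "0 \<le> u" "u \<le> 1" "x = (1 - u) *\<^sub>R y + u *\<^sub>R r y" by (auto simp: in_segment)
        then have "(1 - u + u * s) *\<^sub>R (y - x) = 0" by (simp add: s(2) algebra_simps)
        moreover have "1 - u + u * s > 0" using u s
          by (smt (verit, best) mult_left_mono mult_cancel_left2)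
        ultimately show False using G(3) by auto
      qed
      ultimately show ?thesis using G(1) by (auto simp: U_def)
    qed
  qed
  have "homotopic_with_canon (\<lambda>h. True) U U id r"
    by (rule homotopic_with_linear) (use cont r_main in auto)
  then have "homotopic_with (\<lambda>h. True) (top_of_set U) (top_of_set U) (id \<circ> r) id"
    by (simp add: homotopic_with_sym)
  moreover have "homotopic_with (\<lambda>h. True) (top_of_set A) (top_of_set A) (r \<circ> id) id"
    by (rule homotopic_with_equal) (use r_id in auto)
  moreover have "continuous_map (top_of_set U) (top_of_set A) r"
    using cont r_main by auto
  moreover have "continuous_map (top_of_set A) (top_of_set U) id"
    using AU by auto
  ultimately show ?thesis
    unfolding homotopy_equivalent_space_def U_def[symmetric] A_def[symmetric] by blast
qed

subsection \<open>Euler characteristics of polytopal complexes\<close>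

definition cell_sign :: "'a::euclidean_space set \<Rightarrow> int" where
  "cell_sign F = (- 1) ^ nat (aff_dim F)"

definition cell_sum :: "'a::euclidean_space set set \<Rightarrow> int" where
  "cell_sum \<C> = (\<Sum>F\<in>\<C> - {{}}. cell_sign F)"

text \<open>The number \<open>\<lambda>(F)\<close> of the introduction, for \<open>x\<close> in the relative interior of \<open>F\<close>.\<close>

definition star_sum :: "'a::euclidean_space set set \<Rightarrow> 'a \<Rightarrow> int" where
  "star_sum \<C> x = (\<Sum>F\<in>{F\<in>\<C>. x \<in> F}. cell_sign F)"

abbreviation faces :: "'a::euclidean_space set \<Rightarrow> 'a set set" where
  "faces P \<equiv> {F. F face_of P}"

lemma polytopal_complex_faces:
  assumes "polytope P"
  shows "polytopal_complex (faces P)"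
  unfolding polytopal_complex_def face_closed_def
proof (intro conjI ballI allI impI)
  fix F G assume "F \<in> faces P" "G \<in> faces P"
  then have FG: "F face_of P" "G face_of P" by auto
  then show "F \<inter> G face_of F" "F \<inter> G face_of G"
    using face_of_Int[OF FG] face_of_subset[of "F \<inter> G" P F] face_of_subset[of "F \<inter> G" P G]
      face_of_imp_subset by auto
qed (use assms finite_polytope_faces face_of_polytope_polytope in \<open>auto intro: face_of_trans\<close>)

lemma Union_faces: "polytope P \<Longrightarrow> \<Union>(faces P) = P"
  using face_of_imp_subset face_of_refl polytope_imp_convex by blast

lemma faces_subset_complex:
  assumes "polytopal_complex \<C>" "P \<in> \<C>"
  shows "faces P \<subseteq> \<C>"
  using polytopal_complexD(3)[OF assms] by blast

lemma complex_rel_interior_eq: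
  assumes "polytopal_complex \<C>" "F \<in> \<C>" "G \<in> \<C>" "x \<in> rel_interior F" "x \<in> rel_interior G"
  shows "F = G"
  using complex_cell_subset[OF assms(1-3)] complex_cell_subset[OF assms(1,3,2)] assms(4,5)
    rel_interior_subset face_of_imp_subset by (metis subset_antisym subsetD)

lemma complex_rel_interior_exists:
  assumes "polytopal_complex \<C>" "x \<in> \<Union>\<C>"
  obtains F where "F \<in> \<C>" "x \<in> rel_interior F"
proof -
  obtain P where P: "P \<in> \<C>" "x \<in> P" using assms(2) by blast
  then show ?thesis
    using rel_interior_cell_exists[OF polytopal_complexD(2)[OF assms(1) P(1)] P(2)]
      polytopal_complexD(3)[OF assms(1) P(1)] that by metis
qed

lemma convex_cell_rel_interior:
  assumes "polytope F"
  shows "convex_cell (rel_interior F)" "eul (rel_interior F) = (if F = {} then 0 else cell_sign F)"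
proof -
  have cv: "convex F" "bounded F" using assms polytope_imp_convex polytope_imp_bounded by auto
  then have b: "bounded (rel_interior F)" using bounded_subset rel_interior_subset by blast
  have r: "rel_interior (rel_interior F) = rel_interior F" using cv by (simp add: rel_interior_rel_interior)
  show "convex_cell (rel_interior F)"
    using cv b r by (simp add: convex_cell_def convex_rel_interior)
  show "eul (rel_interior F) = (if F = {} then 0 else cell_sign F)"
    using eul_rel_open[OF r b] cv by (auto simp: cell_sign_def rel_interior_eq_empty rel_interior_aff_dim)
qed

text \<open>The relative interiors of the nonempty faces partition \<open>P\<close>. Their values
  under \<open>eul\<close> are the signs, and the compact set \<open>P\<close> has value 1.\<close>

lemma euler_relation:
  fixes P :: "'a::euclidean_space set"
  assumes P: "polytope P" "P \<noteq> {}"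
  shows "cell_sum (faces P) = 1"
proof -
  note C = polytopal_complex_faces[OF P(1)]
  let ?F = "faces P - {{}}"
  have inj: "inj_on rel_interior ?F"
  proof (rule inj_onI)
    fix F G assume FG: "F \<in> ?F" "G \<in> ?F" "rel_interior F = rel_interior G"
    then obtain x where "x \<in> rel_interior F"
      using rel_interior_eq_empty face_of_imp_convex by (metis DiffD1 DiffD2 all_not_in_conv mem_Collect_eq singletonI)
    then show "F = G" using FG complex_rel_interior_eq[OF C] by auto
  qed
  have U: "\<Union>(rel_interior ` ?F) = P"
  proof
    show "\<Union>(rel_interior ` ?F) \<subseteq> P"
      using rel_interior_subset face_of_imp_subset by blast
    show "P \<subseteq> \<Union>(rel_interior ` ?F)"
    proof
      fix x assume "x \<in> P"
      then obtain F where "F face_of P" "x \<in> rel_interior F" using rel_interior_cell_exists[OF P(1)] by blast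
      then show "x \<in> \<Union>(rel_interior ` ?F)" by (auto intro!: bexI[of _ F])
    qed
  qed
  have pF: "polytope F" if "F \<in> ?F" for F using that polytopal_complexD(2)[OF C] by auto
  have "eul (\<Union>(rel_interior ` ?F)) = (\<Sum>R\<in>rel_interior ` ?F. eul R)"
  proof (rule eul_disjoint_Union)
    show "finite (rel_interior ` ?F)" using polytopal_complexD(1)[OF C] by auto
    show "disjoint (rel_interior ` ?F)"
      using complex_rel_interior_eq[OF C] unfolding disjoint_def by blast
    show "convex_cell (\<Union>(rel_interior ` ?F))" unfolding U
      using P by (simp add: convex_cell_def polytope_imp_convex polytope_imp_bounded polytope_imp_compact)
  qed (use pF convex_cell_rel_interior in blast)
  also have "\<dots> = (\<Sum>F\<in>?F. eul (rel_interior F))" using inj by (simp add: sum.reindex)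
  also have "\<dots> = cell_sum (faces P)" unfolding cell_sum_def
  proof (rule sum.cong[OF refl])
    fix F assume F: "F \<in> ?F"
    show "eul (rel_interior F) = cell_sign F"
      using convex_cell_rel_interior(2)[OF pF[OF F]] F by simp
  qed
  finally show ?thesis unfolding U using P by (simp add: eul_compact polytope_imp_compact)
qed

lemma cell_sum_antistar:
  assumes "polytopal_complex \<C>"
  shows "cell_sum \<C> = cell_sum (antistar \<C> x) + star_sum \<C> x"
proof -
  have "\<C> - {{}} = (antistar \<C> x - {{}}) \<union> {F\<in>\<C>. x \<in> F}" by (auto simp: antistar_def)
  moreover have "(antistar \<C> x - {{}}) \<inter> {F\<in>\<C>. x \<in> F} = {}" by (auto simp: antistar_def)
  ultimately show ?thesis
    using polytopal_complexD(1)[OF assms] unfolding cell_sum_def star_sum_def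
    by (simp add: sum.union_disjoint antistar_def)
qed

lemma euler_pair_contractible_set:
  "contractible S \<Longrightarrow> S \<noteq> {} \<Longrightarrow> euler_pair (top_of_set S) {} 1"
  using euler_pair_contractible[of "top_of_set S"] by simp

text \<open>A cell \<open>P\<close> of maximal dimension is removed: puncturing at a relatively
  interior point \<open>q\<close> retracts the space onto the other cells. Excision identifies the
  pair formed by the space and its puncture with the same pair for \<open>P\<close> alone, which is
  known because \<open>P\<close> is contractible.\<close>

theorem euler_complex:
  fixes \<C> :: "'a::euclidean_space set set"
  assumes "polytopal_complex \<C>"
  shows "euler_pair (top_of_set (\<Union>\<C>)) {} (cell_sum \<C>)"
  using assms
proof (induction "card \<C>" arbitrary: \<C> rule: less_induct)
  case less
  note C = less.prems
  have fin: "finite \<C>" using polytopal_complexD(1)[OF C] .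
  show ?case
  proof (cases "\<C> - {{}} = {}")
    case True
    then have U: "\<Union>\<C> = {}" by auto
    have "has_rank (homology_group (int n) (top_of_set ({}::'a set))) (carrier (homology_group (int n) (top_of_set ({}::'a set)))) 0" for n
      using trivial_homology_group_empty[of "top_of_set ({}::'a set)" "int n"]
        has_rank_one[OF abelian_homology_group, of "int n" "top_of_set ({}::'a set)"]
      by (simp add: trivial_group_def)
    then have "has_rank (homology_group (int n) (top_of_set (\<Union>\<C>))) (carrier (homology_group (int n) (top_of_set (\<Union>\<C>)))) 0" for n
      unfolding U .
    moreover have "cell_sum \<C> = 0" unfolding cell_sum_def True by simp
    ultimately show ?thesis unfolding euler_pair_def
      by (intro exI[of _ "\<lambda>_. 0"] exI[of _ 0]) auto
  next
    case False
    then obtain P where P: "P \<in> \<C> - {{}}" and Pmax: "\<And>Q. Q \<in> \<C> - {{}} \<Longrightarrow> aff_dim Q \<le> aff_dim P"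
      using fin obtains_MAX[of "\<C> - {{}}" aff_dim] by (metis Max_ge finite_Diff finite_imageI imageI)
    have pP: "polytope P" and PC: "P \<in> \<C>" and Pne: "P \<noteq> {}" using P polytopal_complexD(2)[OF C] by auto
    have cvP: "convex P" using pP polytope_imp_convex by auto
    note CP = polytopal_complex_faces[OF pP]
    have eP: "euler_pair (top_of_set P) {} 1"
      by (rule euler_pair_contractible_set[OF convex_imp_contractible[OF cvP] Pne])
    show ?thesis
    \<comment> \<open>For a single polytope, excision would compare the space with itself; Euler's
      relation settles this case directly.\<close>
    proof (cases "\<C> = faces P")
      case True
      then show ?thesis using eP euler_relation[OF pP Pne] Union_faces[OF pP] by simp
    next
      case ne: False
      have sub: "faces P \<subset> \<C>" using faces_subset_complex[OF C PC] ne by auto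
      obtain q where q: "q \<in> rel_interior P" using rel_interior_eq_empty[OF cvP] Pne by auto
      have qP: "q \<in> P" using q rel_interior_subset by blast
      have only_P: "G = P" if G: "G \<in> \<C>" "q \<in> G" for G
      proof (rule ccontr)
        assume "G \<noteq> P"
        moreover have "P face_of G" by (rule complex_cell_subset[OF C PC G(1) q G(2)])
        ultimately have "aff_dim P < aff_dim G"
          using face_of_aff_dim_lt[of G P] complex_cell(2)[OF C G(1)] by auto
        then show False using Pmax[of G] G by fastforce
      qed
      have anti: "antistar \<C> q = \<C> - {P}" using only_P qP by (auto simp: antistar_def)
      have antiP: "antistar (faces P) q = faces P - {P}" using only_P qP sub by (auto simp: antistar_def)
      have PP: "P \<in> faces P" using cvP by (simp add: face_of_refl)
      have card1: "card (\<C> - {P}) < card \<C>" using fin PC by (meson card_Diff1_less)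
      have card2: "card (faces P - {P}) < card \<C>"
        using card_mono[of "faces P" "faces P - {P}"] psubset_card_mono[OF fin sub] polytopal_complexD(1)[OF CP]
        by (meson Diff_subset le_less_trans)
      have e1: "euler_pair (top_of_set (\<Union>\<C> - {q})) {} (cell_sum (\<C> - {P}))"
        using less.hyps[OF card1] antistar_complex[OF C, of q] antistar_retraction[OF C, of q] qP PC
        by (metis UnionI anti homotopy_equivalent_space_sym euler_pair_homotopy)
      have e2: "euler_pair (top_of_set (P - {q})) {} (cell_sum (faces P - {P}))"
        using less.hyps[OF card2] antistar_complex[OF CP, of q] antistar_retraction[OF CP, of q] qP
        by (metis Union_faces[OF pP] antiP homotopy_equivalent_space_sym euler_pair_homotopy)
      have s2: "subtopology (top_of_set P) (P - {q}) = top_of_set (P - {q})"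
        by (simp add: subtopology_subtopology Int_absorb1 Diff_subset)
      have s1: "subtopology (top_of_set (\<Union>\<C>)) (\<Union>\<C> - {q}) = top_of_set (\<Union>\<C> - {q})"
        by (simp add: subtopology_subtopology Int_absorb1 Diff_subset)
      have rP: "euler_pair (top_of_set P) (P - {q}) (1 - cell_sum (faces P - {P}))"
        by (rule homology_pair.euler_pair_relative[OF _ eP]) (use e2 s2 in simp)
      have rC: "euler_pair (top_of_set (\<Union>\<C>)) (\<Union>\<C> - {q}) (1 - cell_sum (faces P - {P}))"
      proof (rule euler_pair_iso[OF rP])
        fix n :: nat
        let ?X = "top_of_set (\<Union>\<C>)"
        \<comment> \<open>All points outside \<open>P\<close> may be cut out: their closure lies in
          the union of the other cells, which by maximality of \<open>P\<close> misses
          \<open>q\<close>.\<close>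
        have "?X closure_of (\<Union>\<C> - P) \<subseteq> ?X interior_of (\<Union>\<C> - {q})"
        proof -
          have cl: "closed (\<Union>(\<C> - {P}))"
            using closed_Union_complex(1)[OF antistar_complex[OF C, of q]] anti by simp
          have "closedin ?X (\<Union>(\<C> - {P}))" using cl by (intro closed_subset) auto
          then have "?X closure_of (\<Union>\<C> - P) \<subseteq> \<Union>(\<C> - {P})"
            by (intro closure_of_minimal) auto
          also have "\<dots> \<subseteq> \<Union>\<C> - {q}" using anti by (auto simp: antistar_def)
          also have "\<dots> = ?X interior_of (\<Union>\<C> - {q})"
            by (rule interior_of_openin[symmetric]) (auto simp: openin_open intro!: exI[of _ "- {q}"])
          finally show ?thesis .
        qed
        then have iso: "hom_induced (int n) (subtopology ?X (\<Union>\<C> - (\<Union>\<C> - P))) (\<Union>\<C> - {q} - (\<Union>\<C> - P)) (subtopology ?X (\<Union>\<C>)) (\<Union>\<C> - {q}) id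
            \<in> iso (relative_homology_group (int n) (subtopology ?X (\<Union>\<C> - (\<Union>\<C> - P))) (\<Union>\<C> - {q} - (\<Union>\<C> - P)))
              (relative_homology_group (int n) (subtopology ?X (\<Union>\<C>)) (\<Union>\<C> - {q}))"
          by (rule homology_excision_axiom) auto
        have *: "\<Union>\<C> - (\<Union>\<C> - P) = P" "\<Union>\<C> - {q} - (\<Union>\<C> - P) = P - {q}" "\<Union>\<C> \<inter> P = P" using PC by auto
        have "subtopology ?X P = top_of_set P" by (simp add: subtopology_subtopology *)
        then show "relative_homology_group (int n) (top_of_set P) (P - {q}) \<cong>
            relative_homology_group (int n) ?X (\<Union>\<C> - {q})"
          using iso unfolding * by (auto simp: is_iso_def subtopology_subtopology)
      qed
      have "euler_pair (top_of_set (\<Union>\<C>)) {} (cell_sum (\<C> - {P}) + (1 - cell_sum (faces P - {P})))"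
        by (rule homology_pair.euler_pair_total[OF _ rC]) (use e1 s1 in simp)
      moreover have "cell_sum \<C> = cell_sum (\<C> - {P}) + cell_sign P"
        unfolding cell_sum_def using fin P
        by (subst sum.remove[of _ P]) (auto simp: insert_commute Diff_insert2[symmetric])
      moreover have "cell_sum (faces P) = cell_sum (faces P - {P}) + cell_sign P"
        unfolding cell_sum_def using polytopal_complexD(1)[OF CP] PP Pne
        by (subst sum.remove[of _ P]) (auto simp: insert_commute Diff_insert2[symmetric])
      ultimately have "cell_sum (\<C> - {P}) + (1 - cell_sum (faces P - {P})) = cell_sum \<C>"
        using euler_relation[OF pP Pne] by linarith
      then show ?thesis
        using \<open>euler_pair (top_of_set (\<Union>\<C>)) {} (cell_sum (\<C> - {P}) + (1 - cell_sum (faces P - {P})))\<close>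
        by (simp only:)
    qed
  qed
qed

lemma star_sum_eq:
  assumes "polytopal_complex \<C>" "x \<in> \<Union>\<C>"
    "euler_pair (top_of_set (\<Union>\<C>)) {} a" "euler_pair (top_of_set (\<Union>\<C> - {x})) {} b"
  shows "star_sum \<C> x = a - b"
proof -
  have "cell_sum \<C> = a" by (rule euler_pair_unique[OF euler_complex[OF assms(1)] assms(3)])
  moreover have "cell_sum (antistar \<C> x) = b"
    using euler_pair_unique[OF euler_complex[OF antistar_complex[OF assms(1)]]]
      euler_pair_homotopy[OF antistar_retraction[OF assms(1,2)] assms(4)] by blast
  ultimately show ?thesis using cell_sum_antistar[OF assms(1), of x] by simp
qed

text \<open>Without a point that is not relatively interior, the set is still star-shaped from its
  relatively interior points.\<close>

lemma contractible_convex_minus_boundary_point: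
  fixes S :: "'a::euclidean_space set"
  assumes "convex S" "closed S" "S \<noteq> {}" "y \<notin> rel_interior S"
  shows "contractible (S - {y})" "S - {y} \<noteq> {}"
proof -
  have "rel_interior S \<subseteq> S - {y}" using rel_interior_subset assms(4) by auto
  then show "contractible (S - {y})"
    using assms closure_subset by (intro starlike_imp_contractible starlike_convex_tweak_boundary_points[of S]) auto
  show "S - {y} \<noteq> {}" using \<open>rel_interior S \<subseteq> S - {y}\<close> rel_interior_eq_empty assms by blast
qed

lemma homeomorphic_minus_point:
  assumes "homeomorphism S T f g" "x \<in> S"
  shows "(T - {f x}) homotopy_eqv (S - {x})" "T homotopy_eqv S"
proof -
  have "homeomorphism (S - {x}) (T - {f x}) f g"
  proof (rule homeomorphism_of_subsets[OF assms(1)])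
    show "f ` (S - {x}) = T - {f x}"
      using assms unfolding homeomorphism_def by (auto simp: image_iff) (metis DiffI imageI singletonD)+
  qed auto
  then have "(S - {x}) homeomorphic (T - {f x})" unfolding homeomorphic_def by blast
  then show "(T - {f x}) homotopy_eqv (S - {x})"
    using homeomorphic_imp_homotopy_eqv homotopy_equivalent_space_sym by blast
  show "T homotopy_eqv S"
    using assms(1) homeomorphic_imp_homotopy_eqv homotopy_equivalent_space_sym homeomorphic_def by blast
qed

text \<open>Both the convex set and its puncture at \<open>f x\<close> are contractible, so the two
  Euler characteristics cancel.\<close>

lemma star_sum_homeomorphic_boundary:
  fixes \<C> :: "'a::euclidean_space set set" and S :: "'b::euclidean_space set"
  assumes C: "polytopal_complex \<C>" "x \<in> \<Union>\<C>" and h: "homeomorphism (\<Union>\<C>) S f g"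
    and S: "convex S" "closed S" "f x \<notin> rel_interior S"
  shows "star_sum \<C> x = 0"
proof -
  have ne: "S \<noteq> {}" using h C(2) by (auto simp: homeomorphism_def)
  have "euler_pair (top_of_set (\<Union>\<C>)) {} 1"
    by (rule euler_pair_homotopy[OF homeomorphic_minus_point(2)[OF h C(2)]])
       (rule euler_pair_contractible_set[OF convex_imp_contractible[OF S(1)] ne])
  moreover have "euler_pair (top_of_set (\<Union>\<C> - {x})) {} 1"
    by (rule euler_pair_homotopy[OF homeomorphic_minus_point(1)[OF h C(2)]])
       (use euler_pair_contractible_set contractible_convex_minus_boundary_point[OF S(1,2) ne S(3)] in blast)
  ultimately show ?thesis using star_sum_eq[OF C] by fastforce
qed

lemma star_sum_polytope:
  assumes "polytope P" "x \<in> P" "x \<notin> rel_interior P"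
  shows "star_sum (faces P) x = 0"
  using assms star_sum_homeomorphic_boundary[OF polytopal_complex_faces[OF assms(1)], of x P "\<lambda>x. x" "\<lambda>x. x"]
  by (simp add: Union_faces homeomorphism_ident polytope_imp_convex polytope_imp_closed)

section \<open>Balls and discs known up to homeomorphism\<close>

lemma ball_homeomorphism:
  fixes X :: "'a::euclidean_space set"
  assumes "homeomorphic_to_ball DIM('a) X"
  obtains f g where "homeomorphism X (cball (0::'a) 1) f g"
proof -
  obtain T :: "'a set" where T: "subspace T" "dim T = DIM('a)" "X homeomorphic (cball 0 1 \<inter> T)"
    using assms by (auto simp: homeomorphic_to_ball_def)
  then have "T = UNIV" by (metis dim_eq_full span_eq_iff)
  then show ?thesis using T(3) that by (auto simp: homeomorphic_def)
qed

text \<open>Invariance of domain: the open ball corresponds to an open subset of \<open>X\<close>,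
  so a frontier point cannot come from it.\<close>

lemma ball_frontier_image:
  fixes X :: "'a::euclidean_space set"
  assumes h: "homeomorphism X (cball (0::'a) 1) f g" and x: "x \<in> frontier X" "x \<in> X"
  shows "norm (f x) = 1"
proof (rule ccontr)
  assume "norm (f x) \<noteq> 1"
  moreover have "f x \<in> cball 0 1" using h x(2) by (auto simp: homeomorphism_def)
  ultimately have "f x \<in> ball 0 1" by auto
  moreover have "open (g ` ball 0 1)"
    by (rule invariance_of_domain_ball)
       (use h in \<open>auto simp: homeomorphism_def intro: inj_on_inverseI[of _ f]\<close>)
  moreover have "g ` ball 0 1 \<subseteq> X" using h by (auto simp: homeomorphism_def)
  moreover have "g (f x) = x" using h x(2) by (auto simp: homeomorphism_def)
  ultimately have "x \<in> interior X" by (metis imageI interiorI)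
  then show False using x(1) by (simp add: frontier_def)
qed

lemma star_sum_ball:
  fixes \<B> :: "'a::euclidean_space set set"
  assumes "polytopal_complex \<B>" "homeomorphic_to_ball DIM('a) (\<Union>\<B>)" "x \<in> \<Union>\<B>" "x \<in> frontier (\<Union>\<B>)"
  shows "star_sum \<B> x = 0"
proof -
  obtain f g where h: "homeomorphism (\<Union>\<B>) (cball (0::'a) 1) f g" using ball_homeomorphism[OF assms(2)] .
  have "norm (f x) = 1" using ball_frontier_image[OF h assms(4,3)] .
  then show ?thesis
    by (intro star_sum_homeomorphic_boundary[OF assms(1,3) h]) (auto simp: rel_interior_nonempty_interior)
qed

text \<open>The simplex spanned by 0 and a basis of a subspace of dimension \<open>k\<close>. For
  \<open>k = 2\<close> it is the model from which the punctured disc is computed.\<close>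

lemma exists_polytope_aff_dim:
  assumes "k \<le> DIM('a::euclidean_space)"
  obtains Q :: "'a::euclidean_space set" where "polytope Q" "aff_dim Q = int k"
proof -
  obtain T :: "'a set" where T: "subspace T" "dim T = k"
    using choose_subspace_of_subspace[of k "UNIV::'a set"] assms by auto
  obtain B where B: "B \<subseteq> T" "independent B" "T = span B" "card B = k"
    using basis_exists[of T] T by (metis span_subspace)
  have fin: "finite B" using B(2) by (simp add: finiteI_independent)
  have "aff_dim (convex hull (insert 0 B)) = aff_dim (insert 0 B)" by (simp add: aff_dim_convex_hull)
  also have "\<dots> = int (dim (insert 0 B))" by (rule aff_dim_zero) (simp add: hull_inc)
  also have "dim (insert 0 B) = k" using B T by (metis dim_span span_insert_0)
  finally show ?thesis using that fin by (metis finite.insertI polytope_convex_hull)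
qed

text \<open>The value is 0 on the rim of the disc and 1 at its inner points. In the second case the
  punctured disc is homotopy equivalent to the rim of a polygon, whose Euler characteristic is
  0.\<close>

lemma star_sum_disc:
  fixes \<D> :: "'a::euclidean_space set set"
  assumes D: "polytopal_complex \<D>" "homeomorphic_to_ball 2 (\<Union>\<D>)" "x \<in> \<Union>\<D>"
  shows "star_sum \<D> x \<ge> 0"
proof -
  obtain T :: "'a set" and f g where T: "subspace T" "dim T = 2" and h: "homeomorphism (\<Union>\<D>) (cball 0 1 \<inter> T) f g"
    using D(2) by (auto simp: homeomorphic_to_ball_def homeomorphic_def)
  let ?S = "cball 0 1 \<inter> T"
  have S: "convex ?S" "closed ?S" "bounded ?S"
    using T by (auto simp: convex_Int subspace_imp_convex closed_subspace bounded_Int)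
  show ?thesis
  proof (cases "f x \<in> rel_interior ?S")
    case False
    then show ?thesis using star_sum_homeomorphic_boundary[OF D(1,3) h S(1,2)] by simp
  next
    case True
    have "2 \<le> DIM('a)" using T dim_subset_UNIV[of T] by simp
    then obtain Q :: "'a set" where Q: "polytope Q" "aff_dim Q = 2"
      using exists_polytope_aff_dim[of 2, where 'a='a] by auto
    have cQ: "convex Q" "closed Q" "bounded Q" "Q \<noteq> {}"
      using Q by (auto simp: polytope_imp_convex polytope_imp_closed polytope_imp_bounded)
    obtain q where q: "q \<in> rel_interior Q" using cQ rel_interior_eq_empty by blast
    have qQ: "q \<in> Q" using q rel_interior_subset by blast
    have affS: "aff_dim ?S = 2"
    proof -
      have "0 \<in> T \<inter> interior (cball 0 1)" using subspace_0[OF T(1)] by simp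
      then have "T \<inter> interior (cball 0 1) \<noteq> {}" by blast
      then show ?thesis
        using aff_dim_convex_Int_nonempty_interior[of T "cball 0 1"] T
        by (simp add: subspace_imp_convex aff_dim_subspace Int_commute)
    qed
    note CQ = polytopal_complex_faces[OF Q(1)]
    have "{F \<in> faces Q. q \<in> F} = {Q}"
      using complex_cell_subset[OF CQ, of Q _ q] q qQ face_of_imp_subset cQ(1)
      by (auto simp: face_of_refl)
    \<comment> \<open>Only \<open>Q\<close> itself contains \<open>q\<close>, and its dimension is
      even; subtracting from Euler's relation leaves cell sum 0 for the rim of the polygon.\<close>
    then have "star_sum (faces Q) q = 1" using Q(2) by (simp add: star_sum_def cell_sign_def)
    then have "cell_sum (antistar (faces Q) q) = 0"
      using cell_sum_antistar[OF CQ, of q] euler_relation[OF Q(1) cQ(4)] by simp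
    then have eQ: "euler_pair (top_of_set (Q - {q})) {} 0"
      using euler_complex[OF antistar_complex[OF CQ, of q]] antistar_retraction[OF CQ, of q] qQ
      by (metis Union_faces[OF Q(1)] homotopy_equivalent_space_sym euler_pair_homotopy)
    have 1: "rel_frontier Q homotopy_eqv (Q - {q})"
      using cQ q by (intro homotopy_eqv_rel_frontier_punctured_convex) (auto simp: rel_frontier_def hull_subset)
    have 2: "rel_frontier ?S homotopy_eqv (?S - {f x})"
      using S True by (intro homotopy_eqv_rel_frontier_punctured_convex) (auto simp: rel_frontier_def hull_subset)
    have 3: "rel_frontier Q homotopy_eqv rel_frontier ?S"
      by (intro homeomorphic_imp_homotopy_eqv homeomorphic_rel_frontiers_convex_bounded_sets)
         (use S cQ Q affS in auto)
    have "euler_pair (top_of_set (rel_frontier Q)) {} 0"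
      using euler_pair_homotopy[OF _ eQ] 1 homotopy_equivalent_space_sym by blast
    then have "euler_pair (top_of_set (?S - {f x})) {} 0"
      using euler_pair_homotopy 2 3 by blast
    then have a: "euler_pair (top_of_set (\<Union>\<D> - {x})) {} 0"
      using euler_pair_homotopy homeomorphic_minus_point(1)[OF h D(3)] by blast
    have "0 \<in> ?S" using subspace_0[OF T(1)] by simp
    then have "?S \<noteq> {}" by blast
    then have "euler_pair (top_of_set (\<Union>\<D>)) {} 1"
      using euler_pair_contractible_set[OF convex_imp_contractible[OF S(1)]]
        euler_pair_homotopy homeomorphic_minus_point(2)[OF h D(3)] by blast
    then show ?thesis using star_sum_eq[OF D(1,3) _ a] by simp
  qed
qed

subsection \<open>Gram's relation, direction by direction\<close>

text \<open>For convex \<open>P\<close> and \<open>x \<in> P\<close> this is the interior of the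
  cone of feasible directions at \<open>x\<close>.\<close>

definition inward :: "'a::euclidean_space set \<Rightarrow> 'a \<Rightarrow> 'a set" where
  "inward P x = {u. \<exists>\<epsilon>>0. x + \<epsilon> *\<^sub>R u \<in> interior P}"

lemma inward_shrink:
  fixes P :: "'a::euclidean_space set"
  assumes "convex P" "x \<in> P" "x + \<epsilon> *\<^sub>R u \<in> interior P" "0 < \<delta>" "\<delta> \<le> \<epsilon>"
  shows "x + \<delta> *\<^sub>R u \<in> interior P"
proof -
  have "x - (\<delta>/\<epsilon>) *\<^sub>R (x - (x + \<epsilon> *\<^sub>R u)) \<in> interior P"
    by (rule mem_interior_convex_shrink[OF assms(1,3,2)]) (use assms(4,5) in auto)
  moreover have "x - (\<delta>/\<epsilon>) *\<^sub>R (x - (x + \<epsilon> *\<^sub>R u)) = x + \<delta> *\<^sub>R u"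
  proof -
    have "\<epsilon> \<noteq> 0" using assms by linarith
    then show ?thesis by simp
  qed
  ultimately show ?thesis by (simp only:)
qed

text \<open>The segment from \<open>x\<close> to \<open>y\<close> extends beyond \<open>y\<close> to
  a point \<open>z\<close> of \<open>F\<close>. A contraction of \<open>P\<close> towards
  \<open>z\<close> that takes \<open>x\<close> to \<open>y\<close> carries interior points seen from
  \<open>x\<close> in direction \<open>u\<close> to interior points seen from
  \<open>y\<close>.\<close>

lemma inward_rel_interior_subset:
  fixes P :: "'a::euclidean_space set"
  assumes P: "convex P" and F: "F face_of P" "x \<in> rel_interior F" "y \<in> rel_interior F"
  shows "inward P x \<subseteq> inward P y"
proof
  fix u assume "u \<in> inward P x"
  then obtain \<epsilon> where \<epsilon>: "\<epsilon> > 0" "x + \<epsilon> *\<^sub>R u \<in> interior P" by (auto simp: inward_def)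
  have xF: "x \<in> F" using F rel_interior_subset by blast
  obtain e where e: "e > 1" "(1 - e) *\<^sub>R x + e *\<^sub>R y \<in> F"
    using convex_rel_interior_if[OF face_of_imp_convex[OF F(1)] F(3)] hull_inc[OF xF] by (metis order_refl)
  define z where "z = (1 - e) *\<^sub>R x + e *\<^sub>R y"
  \<comment> \<open>The factor of the contraction towards \<open>z\<close>; it is chosen with
    \<open>(1 - t) * e = 1\<close>, which sends \<open>x\<close> to \<open>y\<close>.\<close>
  define t where "t = 1 - 1 / e"
  have z: "z \<in> P" using e face_of_imp_subset[OF F(1)] by (auto simp: z_def)
  have t: "0 < t" "t \<le> 1" using e by (auto simp: t_def)
  have "z - t *\<^sub>R (z - (x + \<epsilon> *\<^sub>R u)) \<in> interior P"
    by (rule mem_interior_convex_shrink[OF P \<epsilon>(2) z t])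
  moreover have "z - t *\<^sub>R (z - (x + \<epsilon> *\<^sub>R u)) = y + (t * \<epsilon>) *\<^sub>R u"
  proof -
    have "(1 - t) * e = 1" using e by (simp add: t_def)
    then have "(1 - t) *\<^sub>R z = ((1 - t) - 1) *\<^sub>R x + y"
      by (simp add: z_def scaleR_add_right right_diff_distrib)
    moreover have "z - t *\<^sub>R (z - (x + \<epsilon> *\<^sub>R u)) = (1 - t) *\<^sub>R z + t *\<^sub>R x + (t * \<epsilon>) *\<^sub>R u"
      by (simp add: algebra_simps)
    ultimately show ?thesis by (simp add: algebra_simps)
  qed
  ultimately show "u \<in> inward P y" using t \<epsilon> by (auto simp: inward_def intro!: exI[of _ "t * \<epsilon>"])
qed

text \<open>For faces of a convex set all members of this union coincide; taking the union avoids
  choosing a point of the face.\<close>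

definition inward_face :: "'a::euclidean_space set \<Rightarrow> 'a set \<Rightarrow> 'a set" where
  "inward_face P F = (\<Union>x\<in>rel_interior F. inward P x)"

lemma inward_face_eq:
  assumes "convex P" "F face_of P" "x \<in> rel_interior F"
  shows "inward_face P F = inward P x"
  using inward_rel_interior_subset[OF assms(1,2)] assms(3) unfolding inward_face_def by blast

lemma eul_equal_covers:
  fixes R :: "'i \<Rightarrow> 'a::euclidean_space set" and S :: "'j \<Rightarrow> 'a set"
  assumes fin: "finite I" "finite J"
    and R: "\<And>i. i \<in> I \<Longrightarrow> convex_cell (R i)" and S: "\<And>j. j \<in> J \<Longrightarrow> convex_cell (S j)"
    and eq: "\<And>x. (\<Sum>i\<in>I. of_bool (x \<in> R i)) = (\<Sum>j\<in>J. of_bool (x \<in> S j) :: int)"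
  shows "(\<Sum>i\<in>I. eul (R i)) = (\<Sum>j\<in>J. eul (S j))"
proof -
  define Q where "Q = case_sum R S"
  define c where "c = case_sum (\<lambda>_::'i. 1) (\<lambda>_::'j. -1 :: int)"
  have split: "(\<Sum>k\<in>I <+> J. f k) = (\<Sum>i\<in>I. f (Inl i)) + (\<Sum>j\<in>J. f (Inr j))" for f :: "'i + 'j \<Rightarrow> int"
    using fin by (simp add: sum.Plus)
  have "(\<Sum>k\<in>I <+> J. c k * eul (Q k)) = 0"
  proof (rule euler_pointwise)
    show "(\<Sum>k\<in>I <+> J. c k * of_bool (x \<in> Q k)) = 0" for x
      unfolding split using eq[of x] by (simp add: c_def Q_def sum_negf del: sum_of_bool_eq)
  qed (use fin R S in \<open>auto simp: Q_def\<close>)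
  then show ?thesis unfolding split by (simp add: c_def Q_def sum_negf)
qed

lemma sum_of_bool_rel_interior:
  assumes C: "polytopal_complex \<C>" and S: "\<S> \<subseteq> \<C>"
  shows "(\<Sum>F\<in>\<S>. of_bool (x \<in> rel_interior F \<inter> L)) = (of_bool (x \<in> (\<Union>F\<in>\<S>. rel_interior F) \<inter> L) :: int)"
proof (cases "x \<in> (\<Union>F\<in>\<S>. rel_interior F) \<inter> L")
  case True
  then obtain F where F: "F \<in> \<S>" "x \<in> rel_interior F" "x \<in> L" by blast
  have uniq: "x \<in> rel_interior G \<longleftrightarrow> G = F" if "G \<in> \<S>" for G
    using complex_rel_interior_eq[OF C] that F S by blast
  have "(\<Sum>G\<in>\<S>. of_bool (x \<in> rel_interior G \<inter> L)) = (\<Sum>G\<in>\<S>. if G = F then 1 else 0 :: int)"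
    by (intro sum.cong refl) (use uniq F(3) in auto)
  then show ?thesis using polytopal_complexD(1)[OF C] S F(1) True
    by (simp add: sum.delta finite_subset del: sum_of_bool_eq)
next
  case False
  then show ?thesis by (auto intro!: sum.neutral)
qed

text \<open>The functionals are the basis vectors projected orthogonally to \<open>u\<close>, so
  together they determine a point up to multiples of \<open>u\<close>.\<close>

lemma line_as_slices:
  fixes u x :: "'a::euclidean_space"
  assumes "u \<noteq> 0"
  shows "{y. \<forall>b\<in>(\<lambda>b. b - ((b \<bullet> u) / (u \<bullet> u)) *\<^sub>R u) ` Basis. b \<bullet> y = b \<bullet> x} = range (\<lambda>t. x + t *\<^sub>R u)"
proof (intro equalityI subsetI)
  fix y assume "y \<in> {y. \<forall>b\<in>(\<lambda>b. b - ((b \<bullet> u) / (u \<bullet> u)) *\<^sub>R u) ` Basis. b \<bullet> y = b \<bullet> x}"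
  then have "b \<bullet> (y - x) = ((u \<bullet> (y - x)) / (u \<bullet> u)) * (b \<bullet> u)" if "b \<in> Basis" for b
    using that by (auto simp: inner_diff_left inner_diff_right diff_divide_distrib algebra_simps)
  then have "y - x = ((u \<bullet> (y - x)) / (u \<bullet> u)) *\<^sub>R u"
    by (intro euclidean_eqI[where 'a='a]) (simp add: inner_commute)
  then obtain s where "y - x = s *\<^sub>R u" by blast
  then have "y = x + s *\<^sub>R u" by (metis add.commute diff_add_cancel)
  then show "y \<in> range (\<lambda>t. x + t *\<^sub>R u)" by blast
next
  fix y assume "y \<in> range (\<lambda>t. x + t *\<^sub>R u)"
  then obtain t where "y = x + t *\<^sub>R u" by blast
  then show "y \<in> {y. \<forall>b\<in>(\<lambda>b. b - ((b \<bullet> u) / (u \<bullet> u)) *\<^sub>R u) ` Basis. b \<bullet> y = b \<bullet> x}"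
  proof -
    have "(b - ((b \<bullet> u) / (u \<bullet> u)) *\<^sub>R u) \<bullet> u = 0" for b
      using assms by (simp add: inner_diff_left)
    then show ?thesis by (auto simp: \<open>y = x + t *\<^sub>R u\<close> inner_add_right)
  qed
qed

text \<open>If the line meets the interior, every point of the chord except the last one has
  interior points ahead of it. The half-open chord is given as a point and an open segment, because
  these two are cells to which \<open>eul\<close> applies.\<close>

lemma inward_line:
  fixes P :: "'a::euclidean_space set"
  assumes P: "convex P" "compact P" and u: "u \<noteq> 0"
    and L: "L = range (\<lambda>t. x + t *\<^sub>R u)" and ne: "\<exists>y\<in>P \<inter> L. u \<in> inward P y"
  obtains p q where "p \<noteq> q" "{y \<in> P. u \<in> inward P y} \<inter> L = insert p (open_segment p q)"
proof -
  define J where "J = {t. x + t *\<^sub>R u \<in> P}"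
  have "J = (\<lambda>t. x + t *\<^sub>R u) -` P" by (auto simp: J_def)
  moreover have "closed ((\<lambda>t. x + t *\<^sub>R u) -` P)"
    by (rule continuous_closed_vimage[OF compact_imp_closed[OF P(2)]]) (intro continuous_intros)
  ultimately have cJ: "closed J" by simp
  have bJ: "bounded J"
  proof -
    obtain B where B: "\<And>y. y \<in> P \<Longrightarrow> norm y \<le> B" using compact_imp_bounded[OF P(2)] by (auto simp: bounded_iff)
    have "norm t \<le> (B + norm x) / norm u" if "t \<in> J" for t
    proof -
      have "norm (t *\<^sub>R u) \<le> norm (x + t *\<^sub>R u) + norm x"
        using norm_triangle_ineq4[of "x + t *\<^sub>R u" x] by simp
      also have "\<dots> \<le> B + norm x" using B[of "x + t *\<^sub>R u"] that by (simp add: J_def)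
      finally show ?thesis using u by (simp add: field_simps)
    qed
    then show ?thesis by (auto simp: bounded_iff)
  qed
  have cvJ: "convex J"
    unfolding J_def
  proof (rule convexI, simp)
    fix s t a b :: real assume h: "x + s *\<^sub>R u \<in> P" "x + t *\<^sub>R u \<in> P" "0 \<le> a" "0 \<le> b" "a + b = 1"
    have "a *\<^sub>R (x + s *\<^sub>R u) + b *\<^sub>R (x + t *\<^sub>R u) \<in> P" using h P(1) convexD by blast
    moreover have "a *\<^sub>R (x + s *\<^sub>R u) + b *\<^sub>R (x + t *\<^sub>R u) = (a + b) *\<^sub>R x + (a * s + b * t) *\<^sub>R u"
      by (simp add: algebra_simps)
    ultimately show "x + (a * s + b * t) *\<^sub>R u \<in> P" using h(5) by simp
  qed
  obtain a b where ab: "J = {a..b}"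
    using cJ bJ cvJ connected_compact_interval_1[of J] by (metis compact_eq_bounded_closed convex_connected)
  obtain y where y: "y \<in> P" "y \<in> L" "u \<in> inward P y" using ne by blast
  then obtain s \<epsilon> where s: "y = x + s *\<^sub>R u" "\<epsilon> > 0" "y + \<epsilon> *\<^sub>R u \<in> interior P" by (auto simp: L inward_def)
  define t0 where "t0 = s + \<epsilon>"
  have t0: "x + t0 *\<^sub>R u \<in> interior P" using s by (simp add: t0_def algebra_simps)
  \<comment> \<open>An interior point leaves room to move on in direction \<open>u\<close>, so it is
    never the end of the chord.\<close>
  have int_lt: "t < b" if t: "x + t *\<^sub>R u \<in> interior P" for t
  proof -
    obtain e where e: "e > 0" "cball (x + t *\<^sub>R u) e \<subseteq> P" using t mem_interior_cball by blast
    have "x + t *\<^sub>R u + (e / norm u) *\<^sub>R u \<in> cball (x + t *\<^sub>R u) e" using e u by (simp add: dist_norm)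
    then have "x + (t + e / norm u) *\<^sub>R u \<in> P" using e by (auto simp: algebra_simps)
    then have "t + e / norm u \<in> J" by (simp add: J_def)
    then have "t + e / norm u \<le> b" using ab by simp
    moreover have "e / norm u > 0" using e u by simp
    ultimately show ?thesis by linarith
  qed
  have "t0 \<in> J" using t0 interior_subset by (auto simp: J_def)
  then have "a \<le> t0" and aJ: "a \<in> J" "b \<in> J" using ab by auto
  have "t0 < b" using int_lt t0 .
  then have alb: "a < b" using \<open>a \<le> t0\<close> by simp
  have inw: "u \<in> inward P (x + t *\<^sub>R u) \<longleftrightarrow> t < b" if t: "t \<in> J" for t
  proof
    assume "u \<in> inward P (x + t *\<^sub>R u)"
    then obtain \<delta> where "\<delta> > 0" "x + t *\<^sub>R u + \<delta> *\<^sub>R u \<in> interior P" by (auto simp: inward_def)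
    then have "t + \<delta> < b" by (intro int_lt) (simp add: algebra_simps)
    then show "t < b" using \<open>\<delta> > 0\<close> by simp
  next
    assume tb: "t < b"
    show "u \<in> inward P (x + t *\<^sub>R u)"
    proof (cases "t < t0")
      case True
      then show ?thesis using t0 by (auto simp: inward_def algebra_simps intro!: exI[of _ "t0 - t"])
    next
      case False
      define m where "m = (t + b) / 2"
      have m: "t0 < m" "m < b" "t < m" using tb False by (auto simp: m_def)
      \<comment> \<open>Contraction towards the end of the chord with factor \<open>l\<close> takes
        the interior point at \<open>t0\<close> to the point at \<open>m\<close>.\<close>
      define l where "l = (b - m) / (b - t0)"
      have l: "0 < l" "l \<le> 1" using m by (auto simp: l_def field_simps)
      have "(x + b *\<^sub>R u) - l *\<^sub>R ((x + b *\<^sub>R u) - (x + t0 *\<^sub>R u)) \<in> interior P"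
        using aJ by (intro mem_interior_convex_shrink[OF P(1) t0 _ l]) (simp add: J_def)
      moreover have "l * (b - t0) = b - m" using m by (simp add: l_def)
      then have "b - l * (b - t0) = m" by simp
      then have "(x + b *\<^sub>R u) - l *\<^sub>R ((x + b *\<^sub>R u) - (x + t0 *\<^sub>R u)) = x + m *\<^sub>R u"
        by (simp add: algebra_simps)
           (metis (no_types, lifting) add.commute add_diff_eq diff_add_eq scaleR_left_distrib scaleR_left_diff_distrib)
      ultimately have "x + t *\<^sub>R u + (m - t) *\<^sub>R u \<in> interior P" by (simp add: algebra_simps)
      then show ?thesis using m unfolding inward_def by (intro CollectI exI[of _ "m - t"]) simp
    qed
  qed
  define p where "p = x + a *\<^sub>R u"
  define q where "q = x + b *\<^sub>R u"
  have pq: "p \<noteq> q" using alb u by (simp add: p_def q_def)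
  have "{y \<in> P. u \<in> inward P y} \<inter> L = (\<lambda>t. x + t *\<^sub>R u) ` {a..<b}"
  proof (intro equalityI subsetI)
    fix y assume y: "y \<in> {y \<in> P. u \<in> inward P y} \<inter> L"
    then obtain t where t: "y = x + t *\<^sub>R u" by (auto simp: L)
    then have "t \<in> J" using y by (simp add: J_def)
    then show "y \<in> (\<lambda>t. x + t *\<^sub>R u) ` {a..<b}" using inw[of t] y t ab by auto
  next
    fix y assume "y \<in> (\<lambda>t. x + t *\<^sub>R u) ` {a..<b}"
    then obtain t where "y = x + t *\<^sub>R u" "t \<in> {a..<b}" by blast
    then have t: "y = x + t *\<^sub>R u" "a \<le> t" "t < b" by simp_all
    then have "t \<in> J" using ab by auto
    then show "y \<in> {y \<in> P. u \<in> inward P y} \<inter> L" using inw[of t] t by (auto simp: L J_def)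
  qed
  also have "\<dots> = insert p (open_segment p q)"
  proof -
    have "open_segment p q = (\<lambda>t. x + t *\<^sub>R u) ` {a<..<b}"
    proof (intro equalityI subsetI)
      fix y assume "y \<in> open_segment p q"
      then obtain l where l: "0 < l" "l < 1" "y = (1 - l) *\<^sub>R p + l *\<^sub>R q" by (auto simp: in_segment)
      then have "y = x + (a + l * (b - a)) *\<^sub>R u" by (simp add: p_def q_def algebra_simps)
      moreover have "l * (b - a) < 1 * (b - a)"
        by (rule mult_strict_right_mono) (use l alb in auto)
      then have "a + l * (b - a) < b" unfolding mult_1 by linarith
      ultimately show "y \<in> (\<lambda>t. x + t *\<^sub>R u) ` {a<..<b}" using l alb by auto
    next
      fix y assume "y \<in> (\<lambda>t. x + t *\<^sub>R u) ` {a<..<b}"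
      then obtain t where "y = x + t *\<^sub>R u" "t \<in> {a<..<b}" by blast
      then have t: "y = x + t *\<^sub>R u" "a < t" "t < b" by simp_all
      define l where "l = (t - a) / (b - a)"
      have l: "0 < l" "l < 1" "l * (b - a) = t - a" using t by (auto simp: l_def)
      have "(1 - l) *\<^sub>R p + l *\<^sub>R q = x + (a + l * (b - a)) *\<^sub>R u" by (simp add: p_def q_def algebra_simps)
      then have "y = (1 - l) *\<^sub>R p + l *\<^sub>R q" using t l by simp
      then show "y \<in> open_segment p q" using l pq by (auto simp: in_segment)
    qed
    moreover have "{a..<b} = insert a {a<..<b}" using alb by auto
    ultimately show ?thesis by (simp add: p_def)
  qed
  finally show ?thesis using that[of p q] pq by blast
qed

lemma eul_open_segment:
  fixes p q :: "'a::euclidean_space"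
  assumes "p \<noteq> q"
  shows "convex_cell (open_segment p q)" "eul (open_segment p q) = -1"
proof -
  have pt: "polytope (closed_segment p q)" by (simp add: segment_convex_hull polytope_convex_hull)
  have r: "rel_interior (closed_segment p q) = open_segment p q" using assms by (simp add: rel_interior_closed_segment)
  have "aff_dim (closed_segment p q) = 1"
    using assms by (simp add: segment_convex_hull aff_dim_convex_hull aff_dim_2)
  then show "convex_cell (open_segment p q)" "eul (open_segment p q) = -1"
    using convex_cell_rel_interior[OF pt] r by (auto simp: cell_sign_def)
qed

lemma gram_direction:
  fixes P :: "'a::euclidean_space set"
  assumes P: "polytope P" and u: "u \<noteq> 0"
  shows "(\<Sum>F\<in>{F \<in> faces P - {{}}. u \<in> inward_face P F}. cell_sign F) = 0"
proof -
  note C = polytopal_complex_faces[OF P]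
  have cvP: "convex P" "compact P" using P polytope_imp_convex polytope_imp_compact by auto
  define \<F> where "\<F> = {F \<in> faces P - {{}}. u \<in> inward_face P F}"
  have fin: "finite \<F>" using polytopal_complexD(1)[OF C] by (auto simp: \<F>_def)
  have sub: "\<F> \<subseteq> faces P" by (auto simp: \<F>_def)
  have pF: "polytope F" "F \<noteq> {}" if "F \<in> \<F>" for F using that polytopal_complexD(2)[OF C] by (auto simp: \<F>_def)
  have U: "(\<Union>F\<in>\<F>. rel_interior F) = {y \<in> P. u \<in> inward P y}"
  proof (intro equalityI subsetI)
    fix y assume "y \<in> (\<Union>F\<in>\<F>. rel_interior F)"
    then obtain F where F: "F \<in> \<F>" "y \<in> rel_interior F" by blast
    then have "F \<subseteq> P" "y \<in> F"
      using rel_interior_subset[of F] face_of_imp_subset[of F P] by (auto simp: \<F>_def)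
    then show "y \<in> {y \<in> P. u \<in> inward P y}"
      using inward_face_eq[OF cvP(1), of F y] F by (auto simp: \<F>_def)
  next
    fix y assume y: "y \<in> {y \<in> P. u \<in> inward P y}"
    then obtain F where F: "F face_of P" "y \<in> rel_interior F" using rel_interior_cell_exists[OF P] by blast
    then have "F \<in> \<F>" using inward_face_eq[OF cvP(1) F] y by (auto simp: \<F>_def)
    then show "y \<in> (\<Union>F\<in>\<F>. rel_interior F)" using F by blast
  qed
  define B where "B = (\<lambda>b. b - ((b \<bullet> u) / (u \<bullet> u)) *\<^sub>R u) ` (Basis :: 'a set)"
  have finB: "finite B" by (simp add: B_def)
  have "(\<Sum>F\<in>\<F>. 1 * eul (rel_interior F)) = 0"
  proof (rule euler_fibres[OF finB fin])
    show "convex_cell (rel_interior F)" if "F \<in> \<F>" for F using convex_cell_rel_interior pF that by blast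
    fix x :: 'a
    define L where "L = range (\<lambda>t. x + t *\<^sub>R u)"
    have LB: "{y. \<forall>b\<in>B. b \<bullet> y = b \<bullet> x} = L" unfolding B_def L_def by (rule line_as_slices[OF u])
    have "(\<Sum>F\<in>\<F>. eul (rel_interior F \<inter> L)) = 0"
    proof (cases "\<exists>y\<in>P \<inter> L. u \<in> inward P y")
      case False
      then have "rel_interior F \<inter> L = {}" if "F \<in> \<F>" for F using U that by blast
      then show ?thesis by simp
    next
      case True
      obtain p q where pq: "p \<noteq> q" "{y \<in> P. u \<in> inward P y} \<inter> L = insert p (open_segment p q)"
        using inward_line[OF cvP u L_def True] .
      have cellR: "convex_cell (rel_interior F \<inter> L)" if "F \<in> \<F>" for F
        using convex_cell_slices[OF finB convex_cell_rel_interior(1)[OF pF(1)[OF that]], of x] LB by simp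
      \<comment> \<open>The selected faces cut the half-open chord into cells; its value is 1 for
        the starting point plus -1 for the open segment.\<close>
      have "(\<Sum>F\<in>\<F>. eul (rel_interior F \<inter> L)) = (\<Sum>S\<in>{{p}, open_segment p q}. eul S)"
      proof (rule eul_equal_covers)
        fix y
        have "{p} \<noteq> open_segment p q" using pq(1) by (auto simp: open_segment_def)
        then show "(\<Sum>F\<in>\<F>. of_bool (y \<in> rel_interior F \<inter> L)) = (\<Sum>S\<in>{{p}, open_segment p q}. of_bool (y \<in> S) :: int)"
          unfolding sum_of_bool_rel_interior[OF C sub] U pq(2)
          by (auto simp: open_segment_def simp del: sum_of_bool_eq)
      qed (use fin cellR eul_open_segment[OF pq(1)] in \<open>auto simp: convex_cell_def\<close>)
      also have "\<dots> = 0"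
      proof -
        have "{p} \<noteq> open_segment p q" using pq(1) by (auto simp: open_segment_def)
        then show ?thesis using eul_open_segment[OF pq(1)] by (simp add: eul_compact)
      qed
      finally show ?thesis .
    qed
    then show "(\<Sum>F\<in>\<F>. 1 * eul (rel_interior F \<inter> {y. \<forall>b\<in>B. b \<bullet> y = b \<bullet> x})) = 0" by (simp add: LB)
  qed
  moreover have "eul (rel_interior F) = cell_sign F" if "F \<in> \<F>" for F
    using convex_cell_rel_interior(2)[OF pF(1)[OF that]] pF(2)[OF that] by simp
  ultimately show ?thesis by (simp add: \<F>_def)
qed

subsection \<open>Solid angles as local volume densities\<close>

text \<open>This makes the share of a small ball independent of the radius. The factor
  \<open>s\<close> may exceed 1 while the scaled vector stays within the radius, so rays are
  followed outwards as well.\<close>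

definition conical_at :: "'a::euclidean_space set \<Rightarrow> 'a \<Rightarrow> real \<Rightarrow> bool" where
  "conical_at X x r \<longleftrightarrow>
     (\<forall>v s. norm v \<le> r \<and> 0 \<le> s \<and> norm (s *\<^sub>R v) \<le> r \<and> x + v \<in> X \<longrightarrow> x + s *\<^sub>R v \<in> X)"

lemma conical_at_mono: "conical_at X x r \<Longrightarrow> r' \<le> r \<Longrightarrow> conical_at X x r'"
  unfolding conical_at_def by (meson order_trans)

lemma conical_at_Union:
  "(\<And>X. X \<in> \<X> \<Longrightarrow> conical_at X x r) \<Longrightarrow> conical_at (\<Union>\<X>) x r"
  unfolding conical_at_def by blast

text \<open>Constraints active at \<open>x\<close> are homogeneous about \<open>x\<close> and hence
  invariant under scaling. The radius is so small that the inactive ones hold automatically.\<close>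

lemma polytope_conical:
  fixes P :: "'a::euclidean_space set"
  assumes P: "polytope P"
  obtains r where "r > 0" "conical_at P x r"
proof (cases "x \<in> P")
  case False
  have "closed P" using P polytope_imp_closed by blast
  then obtain e where e: "e > 0" "ball x e \<subseteq> - P" using False by (metis ComplI open_Compl openE)
  have "x + v \<notin> P" if "norm v \<le> e / 2" for v
  proof -
    have "x + v \<in> ball x e" using that e by (simp add: dist_norm)
    then show ?thesis using e by blast
  qed
  then have "conical_at P x (e / 2)" unfolding conical_at_def by blast
  then show ?thesis using that e by (meson half_gt_zero)
next
  case True
  obtain I :: "'a set set" and a b where I: "finite I" "P = {y. \<forall>i\<in>I. a i \<bullet> y \<le> (b i::real)}"
    using polytope_halfspaces[OF P] .
  define J where "J = {i\<in>I. a i \<bullet> x < b i}"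
  \<comment> \<open>The summand 1 in the denominator avoids division by 0 when \<open>a i\<close>
    vanishes, and the element 1 keeps \<open>D\<close> nonempty.\<close>
  define D where "D = insert 1 ((\<lambda>i. (b i - a i \<bullet> x) / (norm (a i) + 1)) ` J)"
  have fin: "finite D" using I by (simp add: D_def J_def)
  define r where "r = Min D"
  have posn: "norm (a i) + 1 > 0" for i by (simp add: add_nonneg_pos)
  have "\<forall>d\<in>D. d > 0" using posn by (auto simp: D_def J_def intro!: divide_pos_pos)
  then have r0: "r > 0" using fin unfolding r_def by (subst Min_gr_iff) (auto simp: D_def)
  have act: "a i \<bullet> v \<le> b i - a i \<bullet> x" if "i \<in> J" "norm v \<le> r" for i v
  proof -
    have "r \<le> (b i - a i \<bullet> x) / (norm (a i) + 1)" unfolding r_def using fin that(1) by (intro Min_le) (auto simp: D_def)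
    then have "norm v * (norm (a i) + 1) \<le> b i - a i \<bullet> x"
      using that(2) posn[of i] by (simp add: pos_le_divide_eq) (meson order_trans mult_right_mono less_imp_le)
    moreover have "a i \<bullet> v \<le> norm (a i) * norm v" by (rule norm_cauchy_schwarz)
    moreover have "norm v * (norm (a i) + 1) = norm (a i) * norm v + norm v" by (simp add: algebra_simps)
    moreover have "norm v \<ge> 0" by simp
    ultimately show ?thesis by linarith
  qed
  have "conical_at P x r"
    unfolding conical_at_def
  proof (intro allI impI)
    fix v s assume h: "norm v \<le> r \<and> 0 \<le> s \<and> norm (s *\<^sub>R v) \<le> r \<and> x + v \<in> P"
    have "a i \<bullet> (x + s *\<^sub>R v) \<le> b i" if i: "i \<in> I" for i
    proof (cases "i \<in> J")
      case True
      have "a i \<bullet> (s *\<^sub>R v) \<le> b i - a i \<bullet> x" using act[OF True] h by blast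
      then show ?thesis by (simp add: inner_add_right)
    next
      case False
      then have "a i \<bullet> x = b i" using i \<open>x \<in> P\<close> I by (force simp: J_def)
      moreover have "a i \<bullet> (x + v) \<le> b i" using h I i by blast
      ultimately have "a i \<bullet> v \<le> 0" by (simp add: inner_add_right)
      then show ?thesis using h \<open>a i \<bullet> x = b i\<close> by (simp add: inner_add_right mult_nonneg_nonpos)
    qed
    then show "x + s *\<^sub>R v \<in> P" using I by blast
  qed
  then show ?thesis using that r0 by blast
qed

lemma complex_conical:
  fixes \<C> :: "'a::euclidean_space set set"
  assumes C: "polytopal_complex \<C>"
  obtains r where "r > 0" "\<And>P. P \<in> \<C> \<Longrightarrow> conical_at P x r"
    "\<And>P. P \<in> \<C> \<Longrightarrow> x \<notin> P \<Longrightarrow> P \<inter> cball x r = {}"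
proof -
  have "\<exists>r>0. conical_at P x r \<and> (x \<notin> P \<longrightarrow> P \<inter> cball x r = {})" if P: "P \<in> \<C>" for P
  proof -
    obtain r where r: "r > 0" "conical_at P x r" using polytope_conical polytopal_complexD(2)[OF C P] by blast
    show ?thesis
    proof (cases "x \<in> P")
      case False
      obtain e where e: "e > 0" "ball x e \<subseteq> - P" using False complex_cell(3)[OF C P] by (metis ComplI open_Compl openE)
      have "cball x (min r (e/2)) \<subseteq> ball x e" using e by auto
      then have "P \<inter> cball x (min r (e/2)) = {}" using e by blast
      then show ?thesis using conical_at_mono[OF r(2), of "min r (e/2)"] r e by (intro exI[of _ "min r (e/2)"]) auto
    qed (use r in auto)
  qed
  then obtain R where R: "\<And>P. P \<in> \<C> \<Longrightarrow> R P > 0 \<and> conical_at P x (R P) \<and> (x \<notin> P \<longrightarrow> P \<inter> cball x (R P) = {})"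
    by metis
  define r where "r = Min (insert 1 (R ` \<C>))"
  have fin: "finite (insert 1 (R ` \<C>))" using polytopal_complexD(1)[OF C] by simp
  have r0: "r > 0" unfolding r_def using fin R by (subst Min_gr_iff) auto
  have rle: "r \<le> R P" if "P \<in> \<C>" for P unfolding r_def using fin that by (intro Min_le) auto
  show ?thesis
  proof (rule that[OF r0])
    show "conical_at P x r" if "P \<in> \<C>" for P using R[OF that] rle[OF that] conical_at_mono by blast
    show "P \<inter> cball x r = {}" if "P \<in> \<C>" "x \<notin> P" for P
      using R[OF that(1)] rle[OF that(1)] that(2) by (meson disjoint_iff mem_cball order_trans)
  qed
qed

text \<open>Points near the scaled point are dilated by \<open>1 / s\<close> into the interior of
  \<open>X\<close>; conicity brings them back into \<open>X\<close>, so they form a neighbourhood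
  inside \<open>X\<close>.\<close>

lemma conical_interior:
  fixes X :: "'a::euclidean_space set"
  assumes X: "conical_at X x r" and v: "norm v < r" "0 < s" "norm (s *\<^sub>R v) < r" "x + v \<in> interior X"
  shows "x + s *\<^sub>R v \<in> interior X"
proof -
  define f where "f = (\<lambda>y. x + (1 / s) *\<^sub>R (y - x))"
  define W where "W = f -` (interior X \<inter> ball x r) \<inter> ball x r"
  have "open (f -` (interior X \<inter> ball x r))"
    unfolding f_def by (intro continuous_open_vimage open_Int open_interior open_ball continuous_intros)
  then have "open W" by (auto simp: W_def)
  moreover have "x + s *\<^sub>R v \<in> W" using v by (simp add: W_def f_def dist_norm)
  moreover have "W \<subseteq> X"
  proof
    fix y assume y: "y \<in> W"
    define w where "w = (1 / s) *\<^sub>R (y - x)"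
    have sw: "s *\<^sub>R w = y - x" using v(2) by (simp add: w_def)
    have "x + w \<in> X" "norm w \<le> r" "norm (s *\<^sub>R w) \<le> r"
      using y interior_subset[of X] unfolding sw
      by (auto simp: W_def f_def w_def[symmetric] dist_norm norm_minus_commute)
    then have "x + s *\<^sub>R w \<in> X" using X v(2) unfolding conical_at_def by (meson less_imp_le)
    then show "y \<in> X" unfolding sw by simp
  qed
  ultimately show ?thesis by (meson interiorI)
qed

lemma cone_over_sphere:
  fixes x :: "'a::euclidean_space"
  assumes "\<epsilon> > 0"
  shows "{x + t *\<^sub>R (y - x) | t y. 0 \<le> t \<and> t \<le> 1 \<and> y \<in> sphere x \<epsilon>} = cball x \<epsilon>"
proof (intro equalityI subsetI)
  fix z assume "z \<in> {x + t *\<^sub>R (y - x) | t y. 0 \<le> t \<and> t \<le> 1 \<and> y \<in> sphere x \<epsilon>}"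
  then show "z \<in> cball x \<epsilon>" using assms by (auto simp: dist_norm norm_minus_commute mult_left_le_one_le)
next
  fix z assume z: "z \<in> cball x \<epsilon>"
  show "z \<in> {x + t *\<^sub>R (y - x) | t y. 0 \<le> t \<and> t \<le> 1 \<and> y \<in> sphere x \<epsilon>}"
  proof (cases "z = x")
    case True
    \<comment> \<open>The centre is reached with parameter 0, which still requires some point of the
      sphere.\<close>
    obtain b :: 'a where "b \<in> Basis" using nonempty_Basis by blast
    then have "x + \<epsilon> *\<^sub>R b \<in> sphere x \<epsilon>" using assms by (simp add: dist_norm)
    then show ?thesis using True by (intro CollectI exI[of _ 0] exI[of _ "x + \<epsilon> *\<^sub>R b"]) simp
  next
    case False
    define y where "y = x + (\<epsilon> / norm (z - x)) *\<^sub>R (z - x)"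
    have "y \<in> sphere x \<epsilon>" using False assms by (simp add: y_def dist_norm)
    moreover have "z = x + (norm (z - x) / \<epsilon>) *\<^sub>R (y - x)" using False assms by (simp add: y_def)
    moreover have "norm (z - x) / \<epsilon> \<le> 1" using z assms by (simp add: dist_norm norm_minus_commute)
    ultimately show ?thesis using assms by (intro CollectI exI[of _ "norm (z - x) / \<epsilon>"] exI[of _ y]) simp
  qed
qed

text \<open>By conicity, the cone over the interior part of the sphere fills the complex within the
  ball up to \<open>x\<close> and the frontier, which are negligible. The normalising factors of the
  surface measure cancel.\<close>

lemma angle_ratio_conical:
  fixes \<C> :: "'a::euclidean_space set set"
  assumes cl: "compact (\<Union>\<C>)" and con: "conical_at (\<Union>\<C>) x r" and neg: "negligible (frontier (\<Union>\<C>))"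
    and \<epsilon>: "0 < \<epsilon>" "\<epsilon> < r"
  shows "angle_ratio \<C> x \<epsilon> = measure lebesgue (\<Union>\<C> \<inter> cball x \<epsilon>) / measure lebesgue (cball x \<epsilon>)"
proof -
  let ?X = "\<Union>\<C>"
  define A where "A = {x + t *\<^sub>R (y - x) | t y. 0 \<le> t \<and> t \<le> 1 \<and> y \<in> sphere x \<epsilon> \<inter> interior ?X}"
  have A1: "A \<subseteq> ?X \<inter> cball x \<epsilon>"
  proof
    fix z assume "z \<in> A"
    then obtain t y where z: "z = x + t *\<^sub>R (y - x)" "0 \<le> t" "t \<le> 1" "y \<in> sphere x \<epsilon>" "y \<in> interior ?X"
      by (auto simp: A_def)
    have n: "norm (y - x) = \<epsilon>" using z by (simp add: dist_norm norm_minus_commute)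
    then have tn: "norm (t *\<^sub>R (y - x)) \<le> \<epsilon>" using z \<epsilon> by (simp add: mult_left_le_one_le)
    have yX: "x + (y - x) \<in> ?X" using z interior_subset by auto
    have "norm (y - x) \<le> r" "norm (t *\<^sub>R (y - x)) \<le> r" using n tn \<epsilon> by linarith+
    then have "z \<in> ?X" unfolding z(1)
      using con[unfolded conical_at_def] z(2) yX by blast
    then show "z \<in> ?X \<inter> cball x \<epsilon>" using tn z(1) by (simp add: dist_norm)
  qed
  have A2: "?X \<inter> cball x \<epsilon> - A \<subseteq> insert x (frontier ?X)"
  proof
    fix z assume z: "z \<in> ?X \<inter> cball x \<epsilon> - A"
    show "z \<in> insert x (frontier ?X)"
    proof (rule ccontr)
      assume "z \<notin> insert x (frontier ?X)"
      then have zx: "z \<noteq> x" and "z \<in> interior ?X"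
        using z closure_subset[of ?X] unfolding frontier_def by (auto simp del: Union_iff)
      define s where "s = \<epsilon> / norm (z - x)"
      have s: "s > 0" using zx \<epsilon> by (simp add: s_def)
      have nz: "norm (z - x) \<le> \<epsilon>" using z by (simp add: dist_norm norm_minus_commute)
      have ns: "norm (s *\<^sub>R (z - x)) = \<epsilon>" using zx \<epsilon> by (simp add: s_def)
      have "x + s *\<^sub>R (z - x) \<in> interior ?X"
        by (rule conical_interior[OF con]) (use nz ns s \<epsilon> \<open>z \<in> interior ?X\<close> in auto)
      moreover have "x + s *\<^sub>R (z - x) \<in> sphere x \<epsilon>" using ns by (simp add: dist_norm)
      moreover have "z = x + (1 / s) *\<^sub>R ((x + s *\<^sub>R (z - x)) - x)" using s by simp
      moreover have "1 / s \<le> 1" using nz zx \<epsilon> by (simp add: s_def)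
      ultimately have "z \<in> A" unfolding A_def using s
        by (intro CollectI exI[of _ "1 / s"] exI[of _ "x + s *\<^sub>R (z - x)"]) simp
      then show False using z by blast
    qed
  qed
  have mX: "?X \<inter> cball x \<epsilon> \<in> lmeasurable"
    using cl by (intro lmeasurable_compact compact_Int compact_cball)
  have "measure lebesgue A = measure lebesgue (?X \<inter> cball x \<epsilon>)"
  proof (rule measure_negligible_symdiff[OF mX])
    have "negligible (insert x (frontier ?X))" using neg by (simp add: negligible_insert)
    then show "negligible ((?X \<inter> cball x \<epsilon> - A) \<union> (A - ?X \<inter> cball x \<epsilon>))"
      using A1 A2 by (elim negligible_subset) blast
  qed
  moreover have "real DIM('a) / \<epsilon> \<noteq> 0" using \<epsilon> by simp
  ultimately show ?thesis
    unfolding angle_ratio_def sphere_vol_def cone_over_sphere[OF \<epsilon>(1)] A_def[symmetric] by simp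
qed

text \<open>The angle of \<open>P\<close> at \<open>F\<close> through directions instead of points,
  so that all faces of \<open>P\<close> are tested by the same variable \<open>u\<close> when Gram's
  relation is integrated.\<close>

definition face_angle :: "'a::euclidean_space set \<Rightarrow> 'a set \<Rightarrow> real" where
  "face_angle P F = measure lebesgue (inward_face P F \<inter> cball 0 1) / measure lebesgue (cball (0::'a) 1)"

lemma open_inward: "open (inward P x)"
proof -
  have "inward P x = (\<Union>\<epsilon>\<in>{0<..}. (\<lambda>u. x + \<epsilon> *\<^sub>R u) -` interior P)" by (auto simp: inward_def)
  then show ?thesis by (auto intro!: open_UN continuous_open_vimage continuous_intros)
qed

lemma content_cball_scale:
  "\<epsilon> > 0 \<Longrightarrow> measure lebesgue (cball (x::'a::euclidean_space) \<epsilon>) = \<epsilon> ^ DIM('a) * measure lebesgue (cball (0::'a) 1)"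
proof -
  assume e: "\<epsilon> > 0"
  have "cball x \<epsilon> = (\<lambda>y. \<epsilon> *\<^sub>R y + x) ` cball 0 1"
  proof (intro equalityI subsetI)
    fix z assume "z \<in> cball x \<epsilon>"
    then have "(1/\<epsilon>) *\<^sub>R (z - x) \<in> cball 0 1" "z = \<epsilon> *\<^sub>R ((1/\<epsilon>) *\<^sub>R (z - x)) + x"
      using e by (auto simp: dist_norm norm_minus_commute)
    then show "z \<in> (\<lambda>y. \<epsilon> *\<^sub>R y + x) ` cball 0 1" by blast
  qed (use e in \<open>auto simp: dist_norm mult_left_le\<close>)
  then show ?thesis using measure_lebesgue_affine[of \<epsilon> x "cball 0 1"] e by simp
qed

text \<open>Dilation by \<open>\<epsilon>\<close> carries the inward directions of the unit ball
  onto the part of the interior of \<open>P\<close> in the small ball, and the frontier of a convex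
  set is negligible.\<close>

lemma face_angle_density:
  fixes P :: "'a::euclidean_space set"
  assumes P: "polytope P" and F: "F face_of P" "x \<in> rel_interior F" and con: "conical_at P x r"
    and \<epsilon>: "0 < \<epsilon>" "\<epsilon> < r"
  shows "measure lebesgue (P \<inter> cball x \<epsilon>) / measure lebesgue (cball x \<epsilon>) = face_angle P F"
proof -
  have cv: "convex P" "compact P" using P polytope_imp_convex polytope_imp_compact by auto
  have xP: "x \<in> P" using F rel_interior_subset face_of_imp_subset by blast
  have iff: "u \<in> inward P x \<longleftrightarrow> x + \<epsilon> *\<^sub>R u \<in> interior P" if u: "norm u \<le> 1" for u
  proof
    assume "u \<in> inward P x"
    then obtain \<delta> where d: "\<delta> > 0" "x + \<delta> *\<^sub>R u \<in> interior P" by (auto simp: inward_def)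
    define \<eta> where "\<eta> = min \<delta> \<epsilon>"
    have h: "\<eta> > 0" "\<eta> \<le> \<delta>" "\<eta> \<le> \<epsilon>" using d \<epsilon> by (auto simp: \<eta>_def)
    have i: "x + \<eta> *\<^sub>R u \<in> interior P" by (rule inward_shrink[OF cv(1) xP d(2) h(1,2)])
    have n: "norm (t *\<^sub>R u) < r" if "0 < t" "t \<le> \<epsilon>" for t
    proof -
      have "t * norm u \<le> t * 1" using that u by (intro mult_left_mono) auto
      moreover have "norm (t *\<^sub>R u) = t * norm u" using that by simp
      ultimately show ?thesis using that \<epsilon> by linarith
    qed
    have "x + (\<epsilon> / \<eta>) *\<^sub>R (\<eta> *\<^sub>R u) \<in> interior P"
      by (rule conical_interior[OF con]) (use n[of \<eta>] n[of \<epsilon>] h \<epsilon> i in auto)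
    then show "x + \<epsilon> *\<^sub>R u \<in> interior P" using h by simp
  qed (use \<epsilon> in \<open>auto simp: inward_def\<close>)
  have im: "(\<lambda>u. \<epsilon> *\<^sub>R u + x) ` (inward P x \<inter> cball 0 1) = interior P \<inter> cball x \<epsilon>"
  proof (intro equalityI subsetI)
    fix z assume "z \<in> interior P \<inter> cball x \<epsilon>"
    moreover define u where "u = (1/\<epsilon>) *\<^sub>R (z - x)"
    ultimately have "norm u \<le> 1" "z = \<epsilon> *\<^sub>R u + x" "z \<in> interior P"
      using \<epsilon> by (auto simp: dist_norm norm_minus_commute)
    then show "z \<in> (\<lambda>u. \<epsilon> *\<^sub>R u + x) ` (inward P x \<inter> cball 0 1)"
      using iff[of u] by (auto simp: add.commute)
  next
    fix z assume "z \<in> (\<lambda>u. \<epsilon> *\<^sub>R u + x) ` (inward P x \<inter> cball 0 1)"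
    then obtain u where "z = \<epsilon> *\<^sub>R u + x" "u \<in> inward P x \<inter> cball 0 1" by blast
    then show "z \<in> interior P \<inter> cball x \<epsilon>"
      using iff[of u] \<epsilon> by (simp add: add.commute dist_norm mult_left_le)
  qed
  have mP: "P \<inter> cball x \<epsilon> \<in> lmeasurable" using cv by (intro lmeasurable_compact compact_Int compact_cball)
  have "measure lebesgue (interior P \<inter> cball x \<epsilon>) = measure lebesgue (P \<inter> cball x \<epsilon>)"
  proof (rule measure_negligible_symdiff[OF mP])
    show "negligible ((P \<inter> cball x \<epsilon> - interior P \<inter> cball x \<epsilon>) \<union> (interior P \<inter> cball x \<epsilon> - P \<inter> cball x \<epsilon>))"
      by (rule negligible_subset[OF negligible_convex_frontier[OF cv(1)]])
         (use interior_subset closure_subset in \<open>auto simp: frontier_def\<close>)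
  qed
  then have "measure lebesgue (P \<inter> cball x \<epsilon>) = \<epsilon> ^ DIM('a) * measure lebesgue (inward P x \<inter> cball 0 1)"
    using measure_lebesgue_affine[of \<epsilon> x "inward P x \<inter> cball 0 1"] im \<epsilon> by simp
  then show ?thesis
    unfolding face_angle_def inward_face_eq[OF cv(1) F] content_cball_scale[OF \<epsilon>(1)] using \<epsilon> by simp
qed

section \<open>Local densities of the full-dimensional cells\<close>

definition full_cells :: "'a::euclidean_space set set \<Rightarrow> 'a set set" where
  "full_cells \<C> = {P \<in> \<C>. aff_dim P = int DIM('a)}"

lemma geometric_complexD:
  assumes "geometric_complex \<C>"
  shows "polytopal_complex \<C>" "\<Union>(full_cells \<C>) = \<Union>\<C>" "full_cells \<C> \<subseteq> \<C>"
    "\<And>F. F \<in> \<C> \<Longrightarrow> \<exists>P\<in>full_cells \<C>. F face_of P"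
  using assms face_of_imp_subset unfolding geometric_complex_def full_cells_def by (auto; blast)+

text \<open>The intersection is a proper face of at least one of the two cells, so its dimension
  drops.\<close>

lemma full_cells_disjoint_interior:
  fixes \<C> :: "'a::euclidean_space set set"
  assumes C: "polytopal_complex \<C>" and P: "P \<in> full_cells \<C>" "Q \<in> full_cells \<C>" "P \<noteq> Q"
  shows "interior (P \<inter> Q) = {}"
proof -
  have cells: "P \<in> \<C>" "Q \<in> \<C>" using P by (auto simp: full_cells_def)
  have fp: "P \<inter> Q face_of P" "P \<inter> Q face_of Q"
    using polytopal_complexD(4,5)[OF C cells] by auto
  have "P \<inter> Q \<noteq> P \<or> P \<inter> Q \<noteq> Q" using P(3) by blast
  then have "aff_dim (P \<inter> Q) < int DIM('a)"
    using face_of_aff_dim_lt[OF _ fp(1)] face_of_aff_dim_lt[OF _ fp(2)] P(1,2)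
      complex_cell(2)[OF C cells(1)] complex_cell(2)[OF C cells(2)] by (auto simp: full_cells_def)
  then show ?thesis by (intro low_dim_interior) simp
qed

lemma negligible_frontier_complex:
  fixes \<C> :: "'a::euclidean_space set set"
  assumes "polytopal_complex \<C>"
  shows "negligible (frontier (\<Union>\<C>))"
proof -
  have "frontier (\<Union>\<C>') \<subseteq> (\<Union>P\<in>\<C>'. frontier P)" if "finite \<C>'" for \<C>' :: "'a set set"
    using that
  proof (induction \<C>')
    case (insert P \<C>')
    then show ?case using frontier_Un_subset[of P "\<Union>\<C>'"] by auto
  qed simp
  then have "frontier (\<Union>\<C>) \<subseteq> (\<Union>P\<in>\<C>. frontier P)" using polytopal_complexD(1)[OF assms] .
  moreover have "negligible (\<Union>P\<in>\<C>. frontier P)"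
    using polytopal_complexD(1)[OF assms] complex_cell(2)[OF assms] by (auto intro!: negligible_Union negligible_convex_frontier)
  ultimately show ?thesis using negligible_subset by blast
qed

text \<open>A small ball sees only the full-dimensional cells containing \<open>x\<close>, which are
  those with \<open>F\<close> as a face. They overlap in negligible sets, so their densities add up.
  The second form is used at interior faces, where the density is 1.\<close>

lemma angle_ratio_eventually:
  fixes \<C> :: "'a::euclidean_space set set"
  assumes C: "geometric_complex \<C>" and F: "F \<in> \<C>" and x: "x \<in> rel_interior F"
  shows "\<forall>\<^sub>F \<epsilon> in at_right 0. angle_ratio \<C> x \<epsilon> = (\<Sum>P\<in>{P \<in> full_cells \<C>. F face_of P}. face_angle P F)"
    "\<forall>\<^sub>F \<epsilon> in at_right 0. angle_ratio \<C> x \<epsilon> = measure lebesgue (\<Union>\<C> \<inter> cball x \<epsilon>) / measure lebesgue (cball x \<epsilon>)"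
proof -
  note PC = geometric_complexD(1)[OF C]
  obtain r where r: "r > 0" "\<And>P. P \<in> \<C> \<Longrightarrow> conical_at P x r" "\<And>P. P \<in> \<C> \<Longrightarrow> x \<notin> P \<Longrightarrow> P \<inter> cball x r = {}"
    using complex_conical[OF PC] by blast
  have ev: "\<forall>\<^sub>F \<epsilon> in at_right 0. 0 < \<epsilon> \<and> \<epsilon> < r"
    using r(1) by (auto simp: eventually_at_right_field)
  have 1: "angle_ratio \<C> x \<epsilon> = measure lebesgue (\<Union>\<C> \<inter> cball x \<epsilon>) / measure lebesgue (cball x \<epsilon>)" if "0 < \<epsilon>" "\<epsilon> < r" for \<epsilon>
    by (rule angle_ratio_conical[OF closed_Union_complex(2)[OF PC] conical_at_Union[OF r(2)] negligible_frontier_complex[OF PC] that])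
  then show "\<forall>\<^sub>F \<epsilon> in at_right 0. angle_ratio \<C> x \<epsilon> = measure lebesgue (\<Union>\<C> \<inter> cball x \<epsilon>) / measure lebesgue (cball x \<epsilon>)"
    using ev by (elim eventually_mono) blast
  have "angle_ratio \<C> x \<epsilon> = (\<Sum>P\<in>{P \<in> full_cells \<C>. F face_of P}. face_angle P F)" if e: "0 < \<epsilon>" "\<epsilon> < r" for \<epsilon>
  proof -
    have fin: "finite (full_cells \<C>)" using polytopal_complexD(1)[OF PC] by (simp add: full_cells_def)
    have cells: "\<And>P. P \<in> full_cells \<C> \<Longrightarrow> P \<in> \<C>" using geometric_complexD(3)[OF C] by blast
    have "\<Union>\<C> \<inter> cball x \<epsilon> = (\<Union>P\<in>full_cells \<C>. P \<inter> cball x \<epsilon>)"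
      using geometric_complexD(2)[OF C] by blast
    also have "measure lebesgue \<dots> = (\<Sum>P\<in>full_cells \<C>. measure lebesgue (P \<inter> cball x \<epsilon>))"
    proof (rule measure_negligible_finite_Union_image[OF fin])
      show "P \<inter> cball x \<epsilon> \<in> lmeasurable" if "P \<in> full_cells \<C>" for P
        using complex_cell(1)[OF PC cells[OF that]] by (intro lmeasurable_compact compact_Int compact_cball)
      show "pairwise (\<lambda>P Q. negligible (P \<inter> cball x \<epsilon> \<inter> (Q \<inter> cball x \<epsilon>))) (full_cells \<C>)"
      proof (rule pairwiseI)
        fix P Q assume PQ: "P \<in> full_cells \<C>" "Q \<in> full_cells \<C>" "P \<noteq> Q"
        have "interior (P \<inter> Q) = {}" by (rule full_cells_disjoint_interior[OF PC PQ])
        moreover have "convex (P \<inter> Q)" using complex_cell(2)[OF PC cells] PQ by (simp add: convex_Int)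
        ultimately have "negligible (P \<inter> Q)" by (simp add: negligible_convex_interior)
        then show "negligible (P \<inter> cball x \<epsilon> \<inter> (Q \<inter> cball x \<epsilon>))" by (rule negligible_subset) blast
      qed
    qed
    also have "\<dots> = (\<Sum>P\<in>{P \<in> full_cells \<C>. F face_of P}. measure lebesgue (P \<inter> cball x \<epsilon>))"
    proof (rule sum.mono_neutral_right[OF fin])
      show "\<forall>P\<in>full_cells \<C> - {P \<in> full_cells \<C>. F face_of P}. measure lebesgue (P \<inter> cball x \<epsilon>) = 0"
      proof
        fix P assume P: "P \<in> full_cells \<C> - {P \<in> full_cells \<C>. F face_of P}"
        then have "x \<notin> P" using complex_cell_subset[OF PC F _ x, of P] cells by blast
        then have "P \<inter> cball x r = {}" using r(3) P cells by blast
        moreover have "cball x \<epsilon> \<subseteq> cball x r" using e by auto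
        ultimately have "P \<inter> cball x \<epsilon> = {}" by blast
        then show "measure lebesgue (P \<inter> cball x \<epsilon>) = 0" by simp
      qed
    qed auto
    finally have "angle_ratio \<C> x \<epsilon> = (\<Sum>P\<in>{P \<in> full_cells \<C>. F face_of P}. measure lebesgue (P \<inter> cball x \<epsilon>) / measure lebesgue (cball x \<epsilon>))"
      using 1[OF e] by (simp add: sum_divide_distrib)
    also have "\<dots> = (\<Sum>P\<in>{P \<in> full_cells \<C>. F face_of P}. face_angle P F)"
      by (rule sum.cong[OF refl], rule face_angle_density[OF _ _ x r(2) e])
         (use cells polytopal_complexD(2)[OF PC] in auto)
    finally show ?thesis .
  qed
  then show "\<forall>\<^sub>F \<epsilon> in at_right 0. angle_ratio \<C> x \<epsilon> = (\<Sum>P\<in>{P \<in> full_cells \<C>. F face_of P}. face_angle P F)"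
    using ev by (elim eventually_mono) blast
qed

text \<open>\<open>F\<close> has relatively interior points and the filter \<open>at_right 0\<close>
  is nontrivial, so the eventual value is unique and the definite description is met.\<close>

lemma solid_angle_eq:
  assumes C: "geometric_complex \<C>" and F: "F \<in> \<C>" "F \<noteq> {}"
  shows "solid_angle F \<C> = (\<Sum>P\<in>{P \<in> full_cells \<C>. F face_of P}. face_angle P F)" (is "_ = ?a")
  unfolding solid_angle_def
proof (rule the_equality)
  show "\<forall>x\<in>rel_interior F. \<forall>\<^sub>F \<epsilon> in at_right 0. angle_ratio \<C> x \<epsilon> = ?a"
    using angle_ratio_eventually(1)[OF C F(1)] by blast
  fix a assume a: "\<forall>x\<in>rel_interior F. \<forall>\<^sub>F \<epsilon> in at_right 0. angle_ratio \<C> x \<epsilon> = a"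
  obtain x where x: "x \<in> rel_interior F"
    using F complex_cell(2)[OF geometric_complexD(1)[OF C] F(1)] rel_interior_eq_empty by blast
  have "\<forall>\<^sub>F \<epsilon> in at_right (0::real). a = ?a"
    using bspec[OF a x] angle_ratio_eventually(1)[OF C F(1) x] by eventually_elim simp
  then show "a = ?a" by (simp add: trivial_limit_at_right_real)
qed

lemma interior_angle_sum:
  assumes C: "geometric_complex \<C>" and F: "F \<in> \<C>" and x: "x \<in> rel_interior F" "x \<in> interior (\<Union>\<C>)"
  shows "(\<Sum>P\<in>{P \<in> full_cells \<C>. F face_of P}. face_angle P F) = 1" (is "?a = 1")
proof -
  obtain e where e: "e > 0" "cball x e \<subseteq> \<Union>\<C>" using x(2) mem_interior_cball by blast
  have "\<forall>\<^sub>F \<epsilon> in at_right 0. 0 < \<epsilon> \<and> \<epsilon> < e" using e by (auto simp: eventually_at_right_field)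
  then have "\<forall>\<^sub>F \<epsilon> in at_right 0. angle_ratio \<C> x \<epsilon> = 1"
    using angle_ratio_eventually(2)[OF C F x(1)]
  proof eventually_elim
    case (elim \<epsilon>)
    have "\<Union>\<C> \<inter> cball x \<epsilon> = cball x \<epsilon>" using e elim by (auto simp: subset_iff)
    then show ?case using elim content_cball_pos[of \<epsilon> x] by simp
  qed
  then have "\<forall>\<^sub>F \<epsilon> in at_right (0::real). ?a = 1"
    using angle_ratio_eventually(1)[OF C F x(1)] by eventually_elim simp
  then show ?thesis by (simp add: trivial_limit_at_right_real)
qed

lemma gram_relation:
  fixes P :: "'a::euclidean_space set"
  assumes P: "polytope P"
  shows "(\<Sum>F\<in>faces P - {{}}. real_of_int (cell_sign F) * face_angle P F) = 0"
proof -
  have fin: "finite (faces P - {{}})" using finite_polytope_faces[OF P] by simp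
  \<comment> \<open>The direction 0 is taken out because \<open>gram_direction\<close> requires
    \<open>u \<noteq> 0\<close>; a single point has measure 0.\<close>
  define S where "S = (\<lambda>F. inward_face P F \<inter> (cball 0 1 - {0}))"
  have op: "open (inward_face P F)" for F unfolding inward_face_def by (auto intro!: open_UN open_inward)
  have mS: "S F \<in> lmeasurable" for F
  proof -
    have "inward_face P F \<inter> cball 0 1 - {0} \<in> lmeasurable"
      using op by (intro fmeasurable_Diff fmeasurable_Int_fmeasurable[of "cball 0 1", simplified Int_commute[of "cball 0 1"]]) auto
    then show ?thesis unfolding S_def by (metis Int_Diff)
  qed
  have meq: "measure lebesgue (inward_face P F \<inter> cball 0 1) = measure lebesgue (S F)" for F
    by (rule measure_negligible_symdiff[OF mS], rule negligible_subset[of "{0}"]) (auto simp: S_def)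
  have "(\<Sum>F\<in>faces P - {{}}. real_of_int (cell_sign F) * measure lebesgue (S F))
      = (\<Sum>F\<in>faces P - {{}}. (\<integral>u. real_of_int (cell_sign F) * indicator (S F) u \<partial>lebesgue))"
    using mS by (intro sum.cong) (auto simp: fmeasurable_def)
  also have "\<dots> = (\<integral>u. (\<Sum>F\<in>faces P - {{}}. real_of_int (cell_sign F) * indicator (S F) u) \<partial>lebesgue)"
    using mS unfolding lmeasurable_iff_integrable
    by (intro Bochner_Integration.integral_sum[symmetric] integrable_mult_right) auto
  also have "(\<lambda>u. \<Sum>F\<in>faces P - {{}}. real_of_int (cell_sign F) * indicator (S F) u) = (\<lambda>u. 0)"
  proof
    fix u
    show "(\<Sum>F\<in>faces P - {{}}. real_of_int (cell_sign F) * indicator (S F) u) = 0"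
    proof (cases "u \<in> cball 0 1 - {0}")
      case True
      then have "(\<Sum>F\<in>faces P - {{}}. real_of_int (cell_sign F) * indicator (S F) u) =
         (\<Sum>F\<in>faces P - {{}}. if u \<in> inward_face P F then real_of_int (cell_sign F) else 0)"
        by (intro sum.cong) (auto simp: S_def)
      also have "\<dots> = real_of_int (\<Sum>F\<in>{F \<in> faces P - {{}}. u \<in> inward_face P F}. cell_sign F)"
        using fin by (simp add: sum.inter_filter[symmetric])
      also have "\<dots> = 0" using gram_direction[OF P, of u] True by simp
      finally show ?thesis .
    qed (auto simp: S_def intro!: sum.neutral)
  qed
  finally show ?thesis
    unfolding face_angle_def meq by (simp add: sum_divide_distrib[symmetric])
qed

subsection \<open>Local structure of a complex in Euclidean space\<close>

lemma complex_near:
  assumes C: "polytopal_complex \<C>"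
  shows "\<exists>r>0. \<forall>P\<in>\<C>. x \<notin> P \<longrightarrow> P \<inter> cball x r = {}"
  by (rule complex_conical[OF C, of x]) blast

text \<open>The cone over \<open>K\<close> with apex \<open>p\<close> already contains the
  half-ball: a point near \<open>q\<close> on the side of \<open>p\<close> is a convex combination
  of \<open>p\<close> and a point of \<open>K\<close> near \<open>q\<close>.\<close>

lemma half_ball_in_convex:
  fixes S :: "'a::euclidean_space set"
  assumes S: "convex S" "K \<subseteq> S" "p \<in> S" and K: "affine hull K = {y. a \<bullet> y = b}" "q \<in> rel_interior K"
    and p: "a \<bullet> p < b"
  obtains e where "e > 0" "ball q e \<inter> {y. a \<bullet> y \<le> b} \<subseteq> S"
proof -
  obtain d where d: "d > 0" "cball q d \<inter> affine hull K \<subseteq> K" "q \<in> K"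
    using K(2) by (auto simp: mem_rel_interior_cball)
  have aq: "a \<bullet> q = b" using d(3) hull_inc[of q K affine] K(1) by blast
  define w where "w = p - q"
  have aw: "a \<bullet> w < 0" using p aq by (simp add: w_def inner_diff_right)
  \<comment> \<open>\<open>l v\<close> is the weight of the apex, read off from the height over the
    hyperplane; \<open>h\<close> projects along \<open>w\<close> onto the directions of the
    hyperplane.\<close>
  define l where "l = (\<lambda>v. (a \<bullet> v) / (a \<bullet> w))"
  define h where "h = (\<lambda>v. v - l v *\<^sub>R w)"
  define W where "W = {v. l v < 1 / 2} \<inter> {v. norm (h v) < d / 2}"
  have "open W" unfolding W_def h_def l_def
    by (intro open_Int open_Collect_less continuous_intros) (use aw in auto)
  moreover have "0 \<in> W" using d(1) by (simp add: W_def h_def l_def)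
  ultimately obtain e where e: "e > 0" "ball 0 e \<subseteq> W" by (meson openE)
  have "ball q e \<inter> {y. a \<bullet> y \<le> b} \<subseteq> S"
  proof
    fix y assume y: "y \<in> ball q e \<inter> {y. a \<bullet> y \<le> b}"
    define v where "v = y - q"
    have "v \<in> ball 0 e" using y by (simp add: v_def dist_norm norm_minus_commute)
    then have v: "l v < 1 / 2" "norm (h v) < d / 2" using e(2) by (auto simp: W_def)
    have "a \<bullet> v \<le> 0" using y aq by (simp add: v_def inner_diff_right)
    then have l0: "l v \<ge> 0" unfolding l_def using aw by (simp add: divide_nonpos_neg)
    \<comment> \<open>Division by the remaining weight gives the point of \<open>K\<close>. As
      \<open>l v\<close> is below 1/2, this at most doubles the length.\<close>
    define g where "g = (1 / (1 - l v)) *\<^sub>R h v"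
    have "a \<bullet> h v = 0" using aw by (simp add: h_def l_def inner_diff_right)
    then have "q + g \<in> affine hull K" using K(1) aq by (simp add: g_def inner_add_right)
    moreover have "norm g \<le> d"
    proof -
      have "norm g = norm (h v) / (1 - l v)" using v(1) by (simp add: g_def)
      also have "\<dots> \<le> norm (h v) / (1 / 2)" using v(1) by (intro divide_left_mono) auto
      finally show ?thesis using v(2) by simp
    qed
    ultimately have "q + g \<in> cball q d \<inter> affine hull K" by (simp add: dist_norm)
    then have "q + g \<in> S" using d(2) S(2) by blast
    then have "(1 - l v) *\<^sub>R (q + g) + l v *\<^sub>R p \<in> S"
      using S(1,3) l0 v(1) by (intro convexD) auto
    moreover have "(1 - l v) *\<^sub>R (q + g) + l v *\<^sub>R p = y"
    proof -
      have "(1 - l v) *\<^sub>R g = h v" using v(1) by (simp add: g_def)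
      then have "(1 - l v) *\<^sub>R (q + g) + l v *\<^sub>R p = (1 - l v) *\<^sub>R q + h v + l v *\<^sub>R p"
        by (simp add: scaleR_add_right)
      also have "\<dots> = q + v" by (simp add: h_def w_def algebra_simps)
      finally show ?thesis by (simp add: v_def)
    qed
    ultimately show "y \<in> S" by simp
  qed
  then show ?thesis using that e(1) by blast
qed

lemma facet_hyperplane:
  fixes K :: "'a::euclidean_space set"
  assumes "aff_dim K = int DIM('a) - 1"
  obtains a b where "a \<noteq> 0" "affine hull K = {y. a \<bullet> y = (b::real)}"
proof -
  have "int (DIM('a) - 1) = int DIM('a) - 1" by (simp add: of_nat_diff Suc_leI)
  then show ?thesis using aff_dim_eq_hyperplane[of K] assms that by auto
qed

lemma interior_point_off_hyperplane:
  fixes P :: "'a::euclidean_space set"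
  assumes "convex P" "aff_dim P = int DIM('a)" "a \<noteq> 0"
  obtains p where "p \<in> P" "a \<bullet> p < b \<or> (- a) \<bullet> p < - (b::real)"
proof -
  have "\<not> P \<subseteq> {y. a \<bullet> y = b}"
    using aff_dim_subset[of P "{y. a \<bullet> y = b}"] aff_dim_hyperplane[OF assms(3), of b] assms(2) by auto
  then obtain p where "p \<in> P" "a \<bullet> p \<noteq> b" by blast
  then show ?thesis using that by (metis inner_minus_left linorder_neqE_linordered_idom neg_less_iff_less)
qed

section \<open>Full-dimensional cells on the two sides of a facet\<close>

definition on_side :: "'a::euclidean_space set \<Rightarrow> 'a \<Rightarrow> 'a \<Rightarrow> real \<Rightarrow> bool" where
  "on_side P q a b \<longleftrightarrow> (\<exists>e>0. ball q e \<inter> {y. a \<bullet> y \<le> b} \<subseteq> P)"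

lemma on_side_cases:
  fixes \<C> :: "'a::euclidean_space set set"
  assumes C: "polytopal_complex \<C>" and P: "P \<in> full_cells \<C>" and K: "K \<subseteq> P" "q \<in> rel_interior K"
    "affine hull K = {y. a \<bullet> y = b}" "a \<noteq> 0"
  shows "on_side P q a b \<or> on_side P q (- a) (- b)"
proof -
  have PC: "P \<in> \<C>" "aff_dim P = int DIM('a)" using P by (auto simp: full_cells_def)
  have cv: "convex P" by (rule complex_cell(2)[OF C PC(1)])
  obtain p where p: "p \<in> P" "a \<bullet> p < b \<or> (- a) \<bullet> p < - b"
    using interior_point_off_hyperplane[OF cv PC(2) K(4)] .
  have K': "affine hull K = {y. (- a) \<bullet> y = - b}" using K(3) by auto
  show ?thesis
    using p(2) half_ball_in_convex[OF cv K(1) p(1) K(3,2)] half_ball_in_convex[OF cv K(1) p(1) K' K(2)]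
    unfolding on_side_def by metis
qed

text \<open>Two cells on the same side share an open half-ball, whereas distinct full-dimensional
  cells meet in a set without interior.\<close>

lemma on_side_unique:
  fixes \<C> :: "'a::euclidean_space set set"
  assumes C: "polytopal_complex \<C>" and P: "P \<in> full_cells \<C>" "Q \<in> full_cells \<C>"
    and a: "a \<noteq> 0" "a \<bullet> q = b" and on: "on_side P q a b" "on_side Q q a b"
  shows "P = Q"
proof (rule ccontr)
  assume "P \<noteq> Q"
  obtain e e' where e: "e > 0" "ball q e \<inter> {y. a \<bullet> y \<le> b} \<subseteq> P" "e' > 0" "ball q e' \<inter> {y. a \<bullet> y \<le> b} \<subseteq> Q"
    using on by (auto simp: on_side_def)
  define m where "m = min e e'"
  have m: "m > 0" using e by (simp add: m_def)
  have "ball q m \<inter> {y. a \<bullet> y < b} \<subseteq> P \<inter> Q" using e by (force simp: m_def)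
  moreover have "open (ball q m \<inter> {y. a \<bullet> y < b})" by (intro open_Int open_ball open_halfspace_lt)
  moreover have "q - (m / (2 * norm a)) *\<^sub>R a \<in> ball q m \<inter> {y. a \<bullet> y < b}"
    using m a by (simp add: dist_norm inner_diff_right)
  ultimately show False
    using full_cells_disjoint_interior[OF C P \<open>P \<noteq> Q\<close>] interior_maximal by blast
qed

text \<open>The two cells lie on opposite sides of the hyperplane of \<open>K\<close>, and their
  half-balls fill a neighbourhood of \<open>q\<close>.\<close>

lemma facet_two_cells_interior:
  fixes \<C> :: "'a::euclidean_space set set"
  assumes C: "polytopal_complex \<C>" and P: "P \<in> full_cells \<C>" "Q \<in> full_cells \<C>" "P \<noteq> Q"
    and K: "aff_dim K = int DIM('a) - 1" "K \<subseteq> P" "K \<subseteq> Q" "q \<in> rel_interior K"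
  shows "q \<in> interior (P \<union> Q)"
proof -
  obtain a b where ab: "a \<noteq> 0" "affine hull K = {y. a \<bullet> y = b}" using facet_hyperplane[OF K(1)] .
  have aq: "a \<bullet> q = b" using K(4) rel_interior_subset hull_subset[of K affine] ab(2) by blast
  have on: "on_side P q a b \<or> on_side P q (- a) (- b)" "on_side Q q a b \<or> on_side Q q (- a) (- b)"
    using on_side_cases[OF C _ _ K(4) ab(2,1)] P K by blast+
  moreover have "\<not> (on_side P q a b \<and> on_side Q q a b)" "\<not> (on_side P q (- a) (- b) \<and> on_side Q q (- a) (- b))"
    using on_side_unique[OF C P(1,2) _ aq] on_side_unique[OF C P(1,2), of "- a" q "- b"] P(3) ab(1) aq by auto
  ultimately have "\<exists>R S. on_side R q a b \<and> on_side S q (- a) (- b) \<and> R \<subseteq> P \<union> Q \<and> S \<subseteq> P \<union> Q" by blast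
  then obtain e e' R S where e: "e > 0" "ball q e \<inter> {y. a \<bullet> y \<le> b} \<subseteq> R" "e' > 0" "ball q e' \<inter> {y. (- a) \<bullet> y \<le> - b} \<subseteq> S"
    and RS: "R \<subseteq> P \<union> Q" "S \<subseteq> P \<union> Q" by (auto simp: on_side_def)
  have "ball q (min e e') \<subseteq> P \<union> Q"
  proof
    fix y assume y: "y \<in> ball q (min e e')"
    show "y \<in> P \<union> Q"
    proof (cases "a \<bullet> y \<le> b")
      case True
      then show ?thesis using y e(2) RS by (auto simp: subset_iff)
    next
      case False
      then show ?thesis using y e(4) RS by (auto simp: subset_iff)
    qed
  qed
  moreover have "q \<in> ball q (min e e')" using e by simp
  ultimately show ?thesis by (meson interiorI open_ball)
qed

text \<open>The side on which a cell lies determines the cell, which gives an injection into the two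
  truth values.\<close>

lemma facet_at_most_two_cells:
  fixes \<C> :: "'a::euclidean_space set set"
  assumes C: "polytopal_complex \<C>" and K: "K \<in> \<C>" "aff_dim K = int DIM('a) - 1" "K \<noteq> {}"
  shows "card {P \<in> full_cells \<C>. K \<subseteq> P} \<le> 2"
proof -
  obtain a b where ab: "a \<noteq> 0" "affine hull K = {y. a \<bullet> y = b}" using facet_hyperplane[OF K(2)] .
  obtain q where q: "q \<in> rel_interior K" using rel_interior_eq_empty complex_cell(2)[OF C K(1)] K(3) by blast
  have aq: "a \<bullet> q = b" using q rel_interior_subset hull_subset[of K affine] ab(2) by blast
  define s where "s = (\<lambda>P. on_side P q a b)"
  have "inj_on s {P \<in> full_cells \<C>. K \<subseteq> P}"
  proof (rule inj_onI)
    fix P Q assume h: "P \<in> {P \<in> full_cells \<C>. K \<subseteq> P}" "Q \<in> {P \<in> full_cells \<C>. K \<subseteq> P}" "s P = s Q"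
    show "P = Q"
    proof (cases "s P")
      case True
      then show ?thesis using on_side_unique[OF C _ _ ab(1) aq] h by (auto simp: s_def)
    next
      case False
      then have "on_side P q (- a) (- b)" "on_side Q q (- a) (- b)"
        using on_side_cases[OF C _ _ q ab(2,1)] h by (auto simp: s_def)
      then show ?thesis using on_side_unique[OF C, of P Q "- a" q "- b"] h ab(1) aq by auto
    qed
  qed
  then have "card {P \<in> full_cells \<C>. K \<subseteq> P} \<le> card (UNIV :: bool set)"
    by (intro card_inj_on_le[of s]) auto
  then show ?thesis by simp
qed

text \<open>A segment from an interior point to a point outside, in general position, leaves the union of
  the cells \<open>\<Q>\<close> through the relative interior of a facet.\<close>

lemma frontier_facet:
  fixes \<C> :: "'a::euclidean_space set set"
  assumes C: "polytopal_complex \<C>" and Q: "\<Q> \<subseteq> full_cells \<C>" and x: "x \<in> frontier (\<Union>\<Q>)"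
  obtains K P where "K \<in> \<C>" "x \<in> K" "aff_dim K = int DIM('a) - 1" "P \<in> \<Q>" "K \<subseteq> P"
    "\<And>P'. P' \<in> \<Q> \<Longrightarrow> K \<subseteq> P' \<Longrightarrow> P' = P"
proof -
  have QC: "\<And>P. P \<in> \<Q> \<Longrightarrow> P \<in> \<C> \<and> aff_dim P = int DIM('a)" using Q by (auto simp: full_cells_def)
  have finQ: "finite \<Q>" using polytopal_complexD(1)[OF C] QC by (meson finite_subset subsetI)
  have clQ: "closed (\<Union>\<Q>)" using finQ QC complex_cell(3)[OF C] by (auto intro!: closed_Union)
  have intP: "interior P \<noteq> {}" "rel_interior P = interior P" if "P \<in> \<Q>" for P
  proof -
    show r: "rel_interior P = interior P" using QC[OF that] by (simp add: interior_rel_interior)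
    have "P \<noteq> {}" using QC[OF that] by auto
    then show "interior P \<noteq> {}" using r rel_interior_eq_empty complex_cell(2)[OF C] QC[OF that] by metis
  qed
  \<comment> \<open>Every cell meeting this ball contains \<open>x\<close>. The segment is kept
    inside the ball so that the facet found on it contains \<open>x\<close>.\<close>
  obtain r where r: "r > 0" "\<And>P. P \<in> \<C> \<Longrightarrow> x \<notin> P \<Longrightarrow> P \<inter> cball x r = {}"
    using complex_near[OF C, of x] by blast
  have "x \<in> \<Union>\<Q>" using x clQ frontier_subset_closed by blast
  then obtain P0 where P0: "P0 \<in> \<Q>" "x \<in> P0" by blast
  have "x \<in> closure (- \<Union>\<Q>)" using x by (simp add: frontier_closures)
  then obtain z where "z \<in> - \<Union>\<Q>" "dist z x < r" using r(1) unfolding closure_approachable by blast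
  then have z: "z \<in> ball x r" "z \<notin> \<Union>\<Q>" by (auto simp: dist_commute)
  define V where "V = ball x r \<inter> interior P0"
  have "x \<in> closure (interior P0)"
    using convex_closure_interior[OF complex_cell(2)[OF C] intP(1)[OF P0(1)]] QC[OF P0(1)] P0(2) closure_subset by blast
  then obtain w where "w \<in> interior P0" "dist w x < r" using r(1) unfolding closure_approachable by blast
  then have "w \<in> V" by (simp add: V_def dist_commute)
  then have Vne: "V \<noteq> {}" by blast
  have Vop: "open V" by (simp add: V_def open_Int)
  \<comment> \<open>A cell of codimension at least 2 and \<open>z\<close> together span at most a
    hyperplane. Finitely many such spaces are negligible and leave a starting point \<open>y\<close>
    in \<open>V\<close>.\<close>
  define Low where "Low = {G \<in> \<C>. aff_dim G < int DIM('a) - 1}"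
  define Bad where "Bad = (\<Union>G\<in>Low. affine hull (insert z G))"
  have "negligible (affine hull (insert z G))" if "G \<in> Low" for G
  proof -
    have "aff_dim (insert z G) < int DIM('a)" using that by (auto simp: Low_def aff_dim_insert)
    then have "interior (affine hull (insert z G)) = {}" by (intro low_dim_interior) (simp add: aff_dim_affine_hull)
    then show ?thesis by (simp add: negligible_convex_interior affine_imp_convex)
  qed
  then have "negligible Bad" unfolding Bad_def
    using polytopal_complexD(1)[OF C] by (intro negligible_Union) (auto simp: Low_def)
  then have "\<not> V \<subseteq> Bad" using open_not_negligible[OF Vop Vne] negligible_subset by blast
  then obtain y where y: "y \<in> V" "y \<notin> Bad" by blast
  have seg: "closed_segment y z \<subseteq> ball x r" using y z by (intro closed_segment_subset) (auto simp: V_def)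
  have "closed_segment y z \<inter> frontier (\<Union>\<Q>) \<noteq> {}"
  proof (rule connected_Int_frontier)
    show "closed_segment y z \<inter> \<Union>\<Q> \<noteq> {}" using y P0 interior_subset by (auto simp: V_def)
    show "closed_segment y z - \<Union>\<Q> \<noteq> {}" using z by auto
  qed simp
  then obtain q where q: "q \<in> closed_segment y z" "q \<in> frontier (\<Union>\<Q>)" by blast
  have qQ: "q \<in> \<Union>\<Q>" "q \<notin> interior (\<Union>\<Q>)" using q(2) clQ frontier_subset_closed by (auto simp: frontier_def)
  have qz: "q \<noteq> z" using qQ z by blast
  obtain P where P: "P \<in> \<Q>" "q \<in> P" using qQ by blast
  obtain K where K: "K face_of P" "q \<in> rel_interior K"
    using rel_interior_cell_exists[OF polytopal_complexD(2)[OF C] P(2)] QC[OF P(1)] by blast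
  have KC: "K \<in> \<C>" using polytopal_complexD(3)[OF C _ K(1)] QC[OF P(1)] by blast
  have qK: "q \<in> K" using K rel_interior_subset by blast
  have KP: "K \<subseteq> P" using K(1) face_of_imp_subset by blast
  have "aff_dim K \<ge> int DIM('a) - 1"
  proof (rule ccontr)
    assume "\<not> aff_dim K \<ge> int DIM('a) - 1"
    \<comment> \<open>\<open>y\<close> lies on the line through \<open>z\<close> and
      \<open>q\<close>, hence in the hull of \<open>z\<close> and \<open>K\<close>, which the choice
      of \<open>y\<close> excludes.\<close>
    then have KL: "K \<in> Low" using KC by (auto simp: Low_def)
    obtain u where u: "0 \<le> u" "u \<le> 1" "q = (1 - u) *\<^sub>R y + u *\<^sub>R z" using q(1) by (auto simp: in_segment)
    have u1: "u \<noteq> 1" using u qz by auto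
    have "(1 - u) *\<^sub>R y = q - u *\<^sub>R z" using u(3) by simp
    then have "(1 / (1 - u)) *\<^sub>R ((1 - u) *\<^sub>R y) = (1 / (1 - u)) *\<^sub>R (q - u *\<^sub>R z)" by simp
    then have "y = (1 / (1 - u)) *\<^sub>R q + (- (u / (1 - u))) *\<^sub>R z"
      using u1 by (simp add: scaleR_diff_right)
    moreover have "1 / (1 - u) + - (u / (1 - u)) = 1" using u1 by (simp add: field_simps)
    moreover have "q \<in> affine hull (insert z K)" "z \<in> affine hull (insert z K)" using qK by (auto simp: hull_inc)
    ultimately have "y \<in> affine hull (insert z K)"
      using mem_affine[OF affine_affine_hull] by metis
    then show False using y(2) KL by (auto simp: Bad_def)
  qed
  moreover have "aff_dim K \<noteq> int DIM('a)"
  proof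
    assume "aff_dim K = int DIM('a)"
    then have "K = P" using face_of_aff_dim_lt[OF _ K(1)] complex_cell(2)[OF C] QC[OF P(1)] by fastforce
    then have "q \<in> interior P" using K(2) intP(2)[OF P(1)] by simp
    then show False using qQ(2) P(1) by (meson Union_upper interior_mono subsetD)
  qed
  ultimately have dK: "aff_dim K = int DIM('a) - 1" using aff_dim_le_DIM[of K] by linarith
  have "P' = P" if P': "P' \<in> \<Q>" "K \<subseteq> P'" for P'
  proof (rule ccontr)
    assume "P' \<noteq> P"
    then have "q \<in> interior (P' \<union> P)"
      using facet_two_cells_interior[OF C _ _ _ dK _ _ K(2)] P' P(1) KP Q by blast
    moreover have "P' \<union> P \<subseteq> \<Union>\<Q>" using P' P by blast
    ultimately show False using qQ(2) interior_mono by blast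
  qed
  moreover have "x \<in> K" using r(2)[OF KC] qK seg q(1) by force
  ultimately show ?thesis using that KC dK P(1) KP by blast
qed

text \<open>A frontier point lies in a facet \<open>K\<close> of just one full cell
  \<open>P\<close>. Near relatively interior points of \<open>K\<close> the complex looks like
  \<open>P\<close>, so these are frontier points; by closure all of \<open>K\<close> lies in the
  frontier, and \<open>K\<close> contains \<open>F\<close>.\<close>

lemma frontier_cell_boundary:
  fixes \<C> :: "'a::euclidean_space set set"
  assumes C: "geometric_complex \<C>" and F: "F \<in> \<C>" "x \<in> rel_interior F" "x \<in> frontier (\<Union>\<C>)"
  shows "F \<in> boundary_complex \<C>"
proof -
  note PC = geometric_complexD(1)[OF C]
  obtain K P where K: "K \<in> \<C>" "x \<in> K" "aff_dim K = int DIM('a) - 1" "P \<in> full_cells \<C>" "K \<subseteq> P"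
    "\<And>P'. P' \<in> full_cells \<C> \<Longrightarrow> K \<subseteq> P' \<Longrightarrow> P' = P"
    using frontier_facet[OF PC order_refl, of x] F(3) geometric_complexD(2)[OF C] by metis
  have Kface: "K face_of P"
    using polytopal_complexD(5)[OF PC K(4)[THEN subsetD[OF geometric_complexD(3)[OF C]]] K(1)]
      polytopal_complexD(4)[OF PC K(4)[THEN subsetD[OF geometric_complexD(3)[OF C]]] K(1)] K(5) by (simp add: Int_absorb1)
  have KneP: "K \<noteq> P" using K(3,4) by (auto simp: full_cells_def)
  have "rel_interior K \<inter> interior (\<Union>\<C>) = {}"
  proof (rule ccontr)
    assume "rel_interior K \<inter> interior (\<Union>\<C>) \<noteq> {}"
    then obtain y where y: "y \<in> rel_interior K" "y \<in> interior (\<Union>\<C>)" by blast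
    obtain r where r: "r > 0" "\<And>G. G \<in> \<C> \<Longrightarrow> y \<notin> G \<Longrightarrow> G \<inter> cball y r = {}"
      using complex_near[OF PC, of y] by blast
    have "cball y r \<inter> \<Union>\<C> \<subseteq> P"
    proof
      fix w assume w: "w \<in> cball y r \<inter> \<Union>\<C>"
      then obtain G where G: "G \<in> full_cells \<C>" "w \<in> G" using geometric_complexD(2)[OF C] by blast
      then have "y \<in> G" using r(2)[of G] w geometric_complexD(3)[OF C] by blast
      then have "K \<subseteq> G" using complex_cell_subset[OF PC K(1) _ y(1), of G] G geometric_complexD(3)[OF C] face_of_imp_subset by blast
      then show "w \<in> P" using K(6)[OF G(1)] G by blast
    qed
    then have "ball y r \<inter> interior (\<Union>\<C>) \<subseteq> P" using interior_subset ball_subset_cball by blast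
    then have "y \<in> interior P" using y(2) r(1) by (meson IntI centre_in_ball interiorI open_Int open_ball open_interior)
    then show False
      using face_of_disjoint_interior[OF Kface KneP] y(1) rel_interior_subset by blast
  qed
  then have "rel_interior K \<subseteq> frontier (\<Union>\<C>)"
    using K(1) rel_interior_subset[of K] closure_subset[of "\<Union>\<C>"] unfolding frontier_def by blast
  then have "closure (rel_interior K) \<subseteq> frontier (\<Union>\<C>)" by (simp add: closure_minimal)
  then have "K \<subseteq> frontier (\<Union>\<C>)"
    using complex_cell[OF PC K(1)] by (simp add: convex_closure_rel_interior)
  moreover have "F \<subseteq> K" using complex_cell_subset[OF PC F(1) K(1) F(2) K(2)] face_of_imp_subset by blast
  ultimately show ?thesis using F(1) by (auto simp: boundary_complex_def)
qed

text \<open>The cells containing \<open>x\<close> cut a small open ball about \<open>x\<close> into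
  relatively open convex sets of the same dimensions, so the sum is the value of \<open>eul\<close>
  on an open ball.\<close>

lemma star_sum_interior:
  fixes \<C> :: "'a::euclidean_space set set"
  assumes C: "polytopal_complex \<C>" and x: "x \<in> interior (\<Union>\<C>)"
  shows "star_sum \<C> x = (- 1) ^ DIM('a)"
proof -
  obtain r where r: "r > 0" "\<And>G. G \<in> \<C> \<Longrightarrow> x \<notin> G \<Longrightarrow> G \<inter> cball x r = {}"
    using complex_near[OF C, of x] by blast
  obtain e where e: "e > 0" "cball x e \<subseteq> \<Union>\<C>" using x mem_interior_cball by blast
  define W where "W = ball x (min r e)"
  have W: "open W" "convex W" "bounded W" "x \<in> W" "W \<subseteq> \<Union>\<C>" using r(1) e by (auto simp: W_def subset_iff)
  have WG: "x \<in> G" if "G \<in> \<C>" "G \<inter> W \<noteq> {}" for G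
    using r(2)[OF that(1)] that(2) by (force simp: W_def)
  define \<S> where "\<S> = {G\<in>\<C>. x \<in> G}"
  have cell: "convex_cell (rel_interior G \<inter> W) \<and> eul (rel_interior G \<inter> W) = cell_sign G" if G: "G \<in> \<S>" for G
  proof -
    have GC: "G \<in> \<C>" "x \<in> G" using G by (auto simp: \<S>_def)
    note cG = complex_cell[OF C GC(1)]
    let ?R = "rel_interior G \<inter> W"
    have ne: "?R \<noteq> {}"
    proof -
      have "x \<in> closure (rel_interior G)" using GC(2) cG by (simp add: convex_closure_rel_interior)
      then show ?thesis using W(1,4) by (metis closure_iff_nhds_not_empty inf_commute subset_refl)
    qed
    have cv: "convex ?R" using cG(2) W(2) by (intro convex_Int convex_rel_interior)
    have ad: "aff_dim ?R = aff_dim G"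
      using aff_dim_convex_Int_open[OF convex_rel_interior[OF cG(2)] W(1) ne] cG(2) by (simp add: rel_interior_aff_dim)
    have "openin (top_of_set (affine hull G)) ?R"
      using openin_rel_interior[of G] W(1) by (simp add: openin_Int_open)
    moreover have "affine hull ?R = affine hull G"
      using ne affine_hull_openin calculation by blast
    ultimately have ro: "rel_interior ?R = ?R" by (metis rel_interior_eq)
    have bd: "bounded ?R" using W(3) by (simp add: bounded_Int)
    show ?thesis using eul_rel_open[OF ro bd ne] cv ro bd ad by (simp add: convex_cell_def cell_sign_def)
  qed
  have fin: "finite \<S>" using polytopal_complexD(1)[OF C] by (simp add: \<S>_def)
  have "(\<Sum>G\<in>\<S>. eul (rel_interior G \<inter> W)) = (\<Sum>T\<in>{W}. eul T)"
  proof (rule eul_equal_covers)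
    fix y
    have "(\<Union>G\<in>\<S>. rel_interior G) \<inter> W = W"
    proof
      show "W \<subseteq> (\<Union>G\<in>\<S>. rel_interior G) \<inter> W"
      proof
        fix w assume w: "w \<in> W"
        then obtain G where G: "G \<in> \<C>" "w \<in> rel_interior G" using complex_rel_interior_exists[OF C] W(5) by blast
        then have "x \<in> G" using WG[OF G(1)] w rel_interior_subset by blast
        then show "w \<in> (\<Union>G\<in>\<S>. rel_interior G) \<inter> W" using G w by (auto simp: \<S>_def)
      qed
    qed auto
    then show "(\<Sum>G\<in>\<S>. of_bool (y \<in> rel_interior G \<inter> W)) = (\<Sum>T\<in>{W}. of_bool (y \<in> T) :: int)"
      using sum_of_bool_rel_interior[OF C, of \<S> y W] by (simp add: \<S>_def)
  qed (use fin cell W in \<open>auto simp: convex_cell_def rel_interior_open\<close>)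
  moreover have "eul W = (- 1) ^ DIM('a)"
  proof -
    have "aff_dim W = int DIM('a)" using W by (intro aff_dim_open) auto
    then show ?thesis using eul_rel_open[of W] W by (auto simp: rel_interior_open)
  qed
  ultimately show ?thesis using cell by (simp add: star_sum_def \<S>_def)
qed

subsection \<open>Cells at a boundary point of a three-dimensional complex\<close>

text \<open>Here \<open>E\<close> holds the vertices and \<open>F\<close> the edges of a graph.
  Grown from one vertex, a set gains exactly one vertex with each edge that leaves it, so reaching
  all vertices takes \<open>card E - 1\<close> different edges.\<close>

lemma connected_graph_card:
  fixes E :: "'v set" and F :: "'f set"
  assumes E: "finite E" "E \<noteq> {}" and F: "finite F"
    and ends: "\<And>f. f \<in> F \<Longrightarrow> card (ends f) = 2"
    and conn: "\<And>S. S \<subseteq> E \<Longrightarrow> S \<noteq> {} \<Longrightarrow> S \<noteq> E \<Longrightarrow> \<exists>f\<in>F. ends f \<inter> S \<noteq> {} \<and> \<not> ends f \<subseteq> S \<and> ends f \<subseteq> E"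
  shows "card E \<le> card F + 1"
proof -
  have "\<exists>S F'. S \<subseteq> E \<and> F' \<subseteq> F \<and> card S = Suc m \<and> card F' = m \<and> (\<forall>f\<in>F'. ends f \<subseteq> S)" if "Suc m \<le> card E" for m
    using that
  proof (induction m)
    case 0
    obtain v where "v \<in> E" using E(2) by blast
    then show ?case by (intro exI[of _ "{v}"] exI[of _ "{}"]) auto
  next
    case (Suc m)
    then obtain S F' where S: "S \<subseteq> E" "F' \<subseteq> F" "card S = Suc m" "card F' = m" "\<forall>f\<in>F'. ends f \<subseteq> S" by auto
    have finS: "finite S" "finite F'" using S E F finite_subset by blast+
    have "S \<noteq> {}" "S \<noteq> E" using S(3) Suc.prems by auto
    then obtain f where f: "f \<in> F" "ends f \<inter> S \<noteq> {}" "\<not> ends f \<subseteq> S" "ends f \<subseteq> E" using conn[OF S(1)] by blast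
    obtain v w where vw: "ends f = {v, w}" "v \<noteq> w" using ends[OF f(1)] by (auto simp: card_2_iff)
    obtain w' where w': "w' \<in> ends f" "w' \<notin> S" using f(3) by blast
    have "ends f \<subseteq> insert w' S" using vw w' f(2) by auto
    moreover have "f \<notin> F'" using S(5) f(3) by blast
    ultimately show ?case using S f w' finS
      by (intro exI[of _ "insert w' S"] exI[of _ "insert f F'"]) auto
  qed
  from this[of "card E - 1"] obtain F' where "F' \<subseteq> F" "card F' = card E - 1"
    using E by (auto simp: card_gt_0_iff Suc_leI)
  then have "card E - 1 \<le> card F" using card_mono[OF F] by metis
  then show ?thesis by simp
qed

text \<open>
  The link of a vertex: \<open>V\<close>, \<open>E\<close>, \<open>F\<close> are its vertices, edges and polygons. Removing a polygon together
  with an edge that no other polygon contains preserves connectedness, because every cut crosses the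
  boundary of a polygon evenly.
\<close>

lemma connected_planar_link_card:
  fixes V :: "'v set" and E :: "'e set" and F :: "'f set"
  assumes V: "finite V" "V \<noteq> {}" and E: "finite E" and F: "finite F"
    and ends: "\<And>e. e \<in> E \<Longrightarrow> card (ends e) = 2 \<and> ends e \<subseteq> V"
    and bd: "\<And>f. f \<in> F \<Longrightarrow> bd f \<subseteq> E"
    and parity: "\<And>f S. f \<in> F \<Longrightarrow> S \<subseteq> V \<Longrightarrow> even (card {e \<in> bd f. ends e \<inter> S \<noteq> {} \<and> \<not> ends e \<subseteq> S})"
    and conn: "\<And>S. S \<subseteq> V \<Longrightarrow> S \<noteq> {} \<Longrightarrow> S \<noteq> V \<Longrightarrow> \<exists>e\<in>E. ends e \<inter> S \<noteq> {} \<and> \<not> ends e \<subseteq> S"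
    and free: "\<And>Q. Q \<subseteq> F \<Longrightarrow> Q \<noteq> {} \<Longrightarrow> \<exists>f\<in>Q. \<exists>e\<in>bd f. \<forall>f'\<in>Q. e \<in> bd f' \<longrightarrow> f' = f"
  shows "card V + card F \<le> card E + 1"
  using F E ends bd parity conn free
proof (induction "card F" arbitrary: F E)
  case 0
  then have "F = {}" by simp
  moreover have "card V \<le> card E + 1"
  proof (rule connected_graph_card[of V E ends])
    show "card (ends e) = 2" if "e \<in> E" for e using 0(4) that by blast
    show "\<exists>e\<in>E. ends e \<inter> S \<noteq> {} \<and> \<not> ends e \<subseteq> S \<and> ends e \<subseteq> V" if "S \<subseteq> V" "S \<noteq> {}" "S \<noteq> V" for S
      using 0(7)[OF that] 0(4) by blast
  qed (use V 0(3) in auto)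
  ultimately show ?case by simp
next
  case (Suc n)
  have "F \<noteq> {}" using Suc.hyps(2) by auto
  then obtain f e where fe: "f \<in> F" "e \<in> bd f" "\<And>f'. f' \<in> F \<Longrightarrow> e \<in> bd f' \<Longrightarrow> f' = f"
    using Suc.prems(7)[of F] by blast
  have eE: "e \<in> E" using Suc.prems(4)[OF fe(1)] fe(2) by blast
  have "card V + card (F - {f}) \<le> card (E - {e}) + 1"
  proof (rule Suc.hyps(1))
    show "n = card (F - {f})" using Suc.hyps(2) fe(1) Suc.prems(1) by simp
    show "bd f' \<subseteq> E - {e}" if "f' \<in> F - {f}" for f'
      using Suc.prems(4)[of f'] fe(3)[of f'] that by blast
    show "\<exists>e'\<in>E - {e}. ends e' \<inter> S \<noteq> {} \<and> \<not> ends e' \<subseteq> S" if S: "S \<subseteq> V" "S \<noteq> {}" "S \<noteq> V" for S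
    proof -
      obtain e' where e': "e' \<in> E" "ends e' \<inter> S \<noteq> {}" "\<not> ends e' \<subseteq> S" using Suc.prems(6)[OF S] by blast
      show ?thesis
      proof (cases "e' = e")
        case True
        let ?X = "{e \<in> bd f. ends e \<inter> S \<noteq> {} \<and> \<not> ends e \<subseteq> S}"
        have "finite ?X" using Suc.prems(4)[OF fe(1)] by (intro finite_subset[OF _ Suc.prems(2)]) blast
        moreover have "even (card ?X)" using Suc.prems(5)[OF fe(1) S(1)] .
        moreover have "e \<in> ?X" using fe(2) e' True by simp
        \<comment> \<open>An even number of edges of the polygon cross the cut, so the removed edge
          is not the only one and another takes its place.\<close>
        ultimately have "?X \<noteq> {e}" by auto
        then obtain e'' where "e'' \<in> ?X" "e'' \<noteq> e" using \<open>e \<in> ?X\<close> by blast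
        then show ?thesis using Suc.prems(4)[OF fe(1)] by blast
      qed (use e' in blast)
    qed
    show "\<exists>f'\<in>Q. \<exists>e\<in>bd f'. \<forall>f''\<in>Q. e \<in> bd f'' \<longrightarrow> f'' = f'" if "Q \<subseteq> F - {f}" "Q \<noteq> {}" for Q
      using Suc.prems(7)[of Q] that by blast
  qed (use Suc.prems in auto)
  moreover have "card F > 0" "card E > 0" using fe(1) eE Suc.prems by (auto simp: card_gt_0_iff)
  ultimately show ?case using fe(1) eE Suc.prems(1,2) by simp
qed

section \<open>Counting the cells around a point\<close>

definition cells_at :: "'a::euclidean_space set set \<Rightarrow> 'a \<Rightarrow> int \<Rightarrow> 'a set set" where
  "cells_at \<C> x k = {G \<in> \<C>. x \<in> G \<and> aff_dim G = k}"

lemma finite_cells_at: "polytopal_complex \<C> \<Longrightarrow> finite (cells_at \<C> x k)"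
  using polytopal_complexD(1)[of \<C>] by (rule finite_subset[of _ \<C>, rotated]) (auto simp: cells_at_def)

lemma star_sum_counts:
  fixes \<C> :: "'a::euclidean_space set set"
  assumes C: "polytopal_complex \<C>" and d: "\<And>G. G \<in> \<C> \<Longrightarrow> aff_dim G \<le> 3"
  shows "star_sum \<C> x = int (card (cells_at \<C> x 0)) - int (card (cells_at \<C> x 1))
     + int (card (cells_at \<C> x 2)) - int (card (cells_at \<C> x 3))"
proof -
  have fin: "finite {G \<in> \<C>. x \<in> G}" using polytopal_complexD(1)[OF C] by simp
  have "star_sum \<C> x = (\<Sum>k\<in>{0,1,2,3::int}. \<Sum>G\<in>{G \<in> {G \<in> \<C>. x \<in> G}. aff_dim G = k}. cell_sign G)"
    unfolding star_sum_def
  proof (rule sum.group[symmetric, OF fin])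
    show "aff_dim ` {G \<in> \<C>. x \<in> G} \<subseteq> {0, 1, 2, 3}"
    proof
      fix k assume "k \<in> aff_dim ` {G \<in> \<C>. x \<in> G}"
      then obtain G where G: "G \<in> \<C>" "x \<in> G" "k = aff_dim G" by blast
      have "0 \<le> aff_dim G" using G(2) by (metis aff_dim_negative_iff empty_iff not_less)
      then show "k \<in> {0, 1, 2, 3}" using d[OF G(1)] G(3) by auto
    qed
  qed simp
  also have "\<dots> = (\<Sum>k\<in>{0,1,2,3::int}. (- 1) ^ nat k * int (card (cells_at \<C> x k)))"
    by (rule sum.cong[OF refl]) (simp add: cell_sign_def cells_at_def)
  finally show ?thesis by simp
qed

text \<open>Every cell containing \<open>x\<close> has \<open>F\<close> as a face, so
  \<open>F\<close> is the unique cell of lowest dimension at \<open>x\<close>.\<close>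

lemma card_one_dim_cells:
  fixes \<C> :: "'a::euclidean_space set set"
  assumes C: "polytopal_complex \<C>" and F: "F \<in> \<C>" "x \<in> rel_interior F"
  shows "cells_at \<C> x (aff_dim F) = {F}" "k < aff_dim F \<Longrightarrow> cells_at \<C> x k = {}"
proof -
  have xF: "x \<in> F" using F(2) rel_interior_subset by blast
  have *: "G = F \<or> aff_dim F < aff_dim G" if "G \<in> \<C>" "x \<in> G" for G
    using complex_cell_subset[OF C F(1) that(1) F(2) that(2)] face_of_aff_dim_lt complex_cell(2)[OF C that(1)] by blast
  then show "cells_at \<C> x (aff_dim F) = {F}" using F(1) xF by (force simp: cells_at_def)
  show "cells_at \<C> x k = {}" if "k < aff_dim F" using * that by (force simp: cells_at_def)
qed

text \<open>At a vertex with \<open>n\<close> edges, the cell count of the polygon is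
  \<open>1 - n + 1\<close>, and it is 0 because the vertex is not relatively interior.\<close>

lemma two_edges_at_vertex:
  fixes G :: "'a::euclidean_space set"
  assumes G: "polytope G" "aff_dim G = 2" and v: "{v} face_of G"
  shows "card (cells_at (faces G) v 1) = 2"
proof -
  note C = polytopal_complex_faces[OF G(1)]
  have vG: "v \<in> G" using v face_of_imp_subset by blast
  have d: "aff_dim K \<le> 2" "aff_dim K = 2 \<Longrightarrow> K = G" if "K face_of G" for K
  proof -
    show "aff_dim K \<le> 2" using aff_dim_subset[OF face_of_imp_subset[OF that]] G(2) by simp
    show "aff_dim K = 2 \<Longrightarrow> K = G" using face_of_aff_dim_lt[OF _ that] polytope_imp_convex[OF G(1)] G(2) by fastforce
  qed
  have "v \<notin> rel_interior G"
  proof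
    assume "v \<in> rel_interior G"
    then have "G \<subseteq> {v}" using face_subset_of_rel_interior[OF v] by blast
    then show False using aff_dim_subset[of G "{v}"] G(2) by simp
  qed
  then have "star_sum (faces G) v = 0" using star_sum_polytope[OF G(1) vG] by blast
  moreover have "cells_at (faces G) v 0 = {{v}}" using card_one_dim_cells(1)[OF C, of "{v}" v] v by simp
  moreover have "cells_at (faces G) v 2 = {G}"
    using d vG G by (auto simp: cells_at_def face_of_refl polytope_imp_convex)
  moreover have "cells_at (faces G) v 3 = {}" using d(1) by (force simp: cells_at_def)
  ultimately show ?thesis using star_sum_counts[OF C, of v] d(1) by fastforce
qed

text \<open>At a relatively interior point of the edge, the cell count is
  \<open>- 1 + n - 1 = 0\<close>, where \<open>n\<close> is the number of polygons.\<close>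

lemma two_facets_at_edge:
  fixes P :: "'a::euclidean_space set"
  assumes P: "polytope P" "aff_dim P = 3" and e: "e face_of P" "aff_dim e = 1" "x \<in> rel_interior e"
  shows "card (cells_at (faces P) x 2) = 2"
proof -
  note C = polytopal_complex_faces[OF P(1)]
  have xP: "x \<in> P" using e face_of_imp_subset rel_interior_subset by blast
  have d: "aff_dim K \<le> 3" "aff_dim K = 3 \<Longrightarrow> K = P" if "K face_of P" for K
  proof -
    show "aff_dim K \<le> 3" using aff_dim_subset[OF face_of_imp_subset[OF that]] P(2) by simp
    show "aff_dim K = 3 \<Longrightarrow> K = P" using face_of_aff_dim_lt[OF _ that] polytope_imp_convex[OF P(1)] P(2) by fastforce
  qed
  have "x \<notin> rel_interior P"
  proof
    assume "x \<in> rel_interior P"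
    then have "e = P" using complex_rel_interior_eq[OF C, of e P x] e P by (auto simp: face_of_refl polytope_imp_convex)
    then show False using e(2) P(2) by simp
  qed
  then have "star_sum (faces P) x = 0" using star_sum_polytope[OF P(1) xP] by blast
  moreover have "cells_at (faces P) x 1 = {e}" "cells_at (faces P) x 0 = {}"
    using card_one_dim_cells[OF C, of e x] e by auto
  moreover have "cells_at (faces P) x 3 = {P}"
    using d xP P by (auto simp: cells_at_def face_of_refl polytope_imp_convex)
  ultimately show ?thesis using star_sum_counts[OF C, of x] d(1) by fastforce
qed

text \<open>Passing to a facet through \<open>v\<close> lowers the dimension by one, until an edge
  is left.\<close>

lemma edge_at_vertex_exists:
  fixes G :: "'a::euclidean_space set"
  assumes "polytope G" "{v} face_of G" "G \<noteq> {v}"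
  obtains e where "e face_of G" "v \<in> e" "aff_dim e = 1"
  using assms
proof (induction "nat (aff_dim G)" arbitrary: G thesis rule: less_induct)
  case less
  have vG: "v \<in> G" using less.prems(3) face_of_imp_subset by blast
  have d: "aff_dim G \<ge> 1"
    using face_of_aff_dim_lt[OF _ less.prems(3)] less.prems(2,4) polytope_imp_convex by fastforce
  show ?case
  proof (cases "aff_dim G = 1")
    case True
    then show ?thesis using less.prems(1)[of G] vG less.prems(2) by (simp add: face_of_refl polytope_imp_convex)
  next
    case False
    obtain F where F: "F facet_of G" "{v} \<subseteq> F"
      using face_of_polyhedron_subset_facet[OF polytope_imp_polyhedron[OF less.prems(2)] less.prems(3)] less.prems(4) by blast
    then have FG: "F face_of G" "aff_dim F = aff_dim G - 1" by (auto simp: facet_of_def)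
    have "{v} face_of F" using less.prems(3) FG(1) F(2) by (meson face_of_face)
    moreover have "F \<noteq> {v}" using FG(2) False d by auto
    moreover have "polytope F" using FG(1) less.prems(2) face_of_polytope_polytope by blast
    moreover have "nat (aff_dim F) < nat (aff_dim G)" using FG(2) d by simp
    ultimately obtain e where "e face_of F" "v \<in> e" "aff_dim e = 1" using less.hyps[of F] by blast
    then show ?thesis using less.prems(1)[of e] FG(1) face_of_trans by blast
  qed
qed

text \<open>
  The faces at \<open>v\<close> cut a closed curve out of a plane that separates \<open>v\<close> from the other vertices.
\<close>

lemma polytope_vertex_faces_connected:
  fixes P :: "'a::euclidean_space set"
  assumes P: "polytope P" "aff_dim P = 3" and v: "{v} face_of P"
    and e: "e1 \<in> cells_at (faces P) v 1" "e2 \<in> cells_at (faces P) v 1" and S: "e1 \<in> S" "e2 \<notin> S"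
  shows "\<exists>G e e'. G \<in> cells_at (faces P) v 2 \<and> e face_of G \<and> e' face_of G \<and>
     e \<in> cells_at (faces P) v 1 \<and> e' \<in> cells_at (faces P) v 1 \<and> e \<in> S \<and> e' \<notin> S"
proof (rule ccontr)
  assume no: "\<not> ?thesis"
  note C = polytopal_complex_faces[OF P(1)]
  have cvP: "convex P" using P(1) polytope_imp_convex by blast
  have vP: "v \<in> P" using v face_of_imp_subset by blast
  \<comment> \<open>Faces of polyhedra are exposed, so some plane meets \<open>P\<close> only in
    \<open>v\<close>; a parallel copy of it will separate \<open>v\<close> from the other
    vertices.\<close>
  have "{v} exposed_face_of P" using exposed_face_of_polyhedron polytope_imp_polyhedron[OF P(1)] v by blast
  moreover have "P \<noteq> {v}" using P(2) by auto
  ultimately obtain a b where ab: "P \<subseteq> {x. a \<bullet> x \<le> b}" "{v} = P \<inter> {x. a \<bullet> x = b}"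
    unfolding exposed_face_of by blast
  have lt: "a \<bullet> y < b" if "y \<in> P" "y \<noteq> v" for y using ab that by force
  have av: "a \<bullet> v = b" using ab(2) by blast
  define Far where "Far = \<Union>{K. K face_of P \<and> v \<notin> K}"
  have cFar: "compact Far" unfolding Far_def
    using polytopal_complexD(1)[OF C] complex_cell(1)[OF C] by (intro compact_Union) (auto intro: finite_subset)
  \<comment> \<open>The faces avoiding \<open>v\<close> form a compact set strictly below
    \<open>b\<close>. The level \<open>c\<close> lies above all of it, so every face that meets the
    cutting plane contains \<open>v\<close>.\<close>
  obtain c where c: "c < b" "\<And>y. y \<in> Far \<Longrightarrow> a \<bullet> y < c"
  proof (cases "Far = {}")
    case True
    then show ?thesis using that[of "b - 1"] by auto
  next
    case False
    have "\<exists>w\<in>Far. \<forall>y\<in>Far. a \<bullet> y \<le> a \<bullet> w"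
      by (rule continuous_attains_sup[OF cFar False]) (intro continuous_intros)
    then obtain w where w: "w \<in> Far" "\<And>y. y \<in> Far \<Longrightarrow> a \<bullet> y \<le> a \<bullet> w" by blast
    have "a \<bullet> w < b" using w(1) lt face_of_imp_subset unfolding Far_def by blast
    then show ?thesis using that[of "(a \<bullet> w + b) / 2"] w(2) by force
  qed
  define H where "H = {y. a \<bullet> y = c}"
  have H_near: "v \<in> K" if "K face_of P" "y \<in> K" "y \<in> H" for K y
    using that c(2)[of y] by (force simp: Far_def H_def)
  have meets: "K \<inter> H \<noteq> {}" if K: "K face_of P" "v \<in> K" "K \<noteq> {v}" for K
  proof -
    have pK: "polytope K" using K(1) P(1) face_of_polytope_polytope by blast
    obtain w where w: "{w} face_of K" "w \<noteq> v"
    proof -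
      have "K = convex hull {x. x extreme_point_of K}"
        using Krein_Milman_Minkowski polytope_imp_compact[OF pK] polytope_imp_convex[OF pK] by blast
      then have "\<not> {x. x extreme_point_of K} \<subseteq> {v}" using K(2,3)
        by (metis convex_hull_eq_empty convex_hull_singleton empty_iff subset_singletonD)
      then show ?thesis using that by (auto simp: face_of_singleton)
    qed
    have "w \<in> Far" using w face_of_trans[OF w(1) K(1)] unfolding Far_def by blast
    then have aw: "a \<bullet> w < c" using c(2) by blast
    have "connected K" using polytope_imp_convex[OF pK] convex_connected by blast
    moreover have "w \<in> K" using w(1) face_of_imp_subset by blast
    ultimately obtain z where "z \<in> K" "a \<bullet> z = c"
      using connected_ivt_hyperplane[of K w v a c] aw c(1) av K(2) by auto
    then show ?thesis by (auto simp: H_def)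
  qed
  define Q where "Q = P \<inter> H"
  have aff_H: "affine H" by (simp add: H_def affine_hyperplane)
  have clH: "closed H" by (simp add: H_def closed_hyperplane)
  have cvQ: "convex Q" "bounded Q" "closed Q"
    using cvP aff_H clH P(1) by (auto simp: Q_def affine_imp_convex convex_Int bounded_Int polytope_imp_bounded polytope_imp_closed closed_Int)
  have riQ: "rel_interior P \<inter> H \<noteq> {}"
  proof -
    obtain p where p: "p \<in> rel_interior P" using rel_interior_eq_empty[OF cvP] vP by blast
    obtain w where w: "w \<in> P" "a \<bullet> w < c"
    proof -
      have "\<not> {x. x extreme_point_of P} \<subseteq> {v}"
        using Krein_Milman_Minkowski[OF polytope_imp_compact[OF P(1)] cvP] vP \<open>P \<noteq> {v}\<close>
        by (metis convex_hull_eq_empty convex_hull_singleton empty_iff subset_singletonD)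
      then obtain w where w: "w extreme_point_of P" "w \<noteq> v" by blast
      then have "{w} face_of P" by (simp add: face_of_singleton)
      then have "w \<in> Far" using w(2) unfolding Far_def by blast
      then have "a \<bullet> w < c" by (rule c(2))
      then show ?thesis using that w(1) unfolding extreme_point_of_def by blast
    qed
    have "\<exists>z\<in>rel_interior P. a \<bullet> z = c"
    proof (cases "a \<bullet> p" c rule: linorder_cases)
      case equal
      then show ?thesis using p by blast
    next
      case less
      have "open_segment p v \<subseteq> rel_interior P"
        using rel_interior_closure_convex_segment[OF cvP p] vP closure_subset by blast
      moreover have "\<exists>z\<in>closed_segment p v. a \<bullet> z = c"
        using connected_ivt_hyperplane[of "closed_segment p v" p v a c] less c(1) av by auto
      ultimately show ?thesis using less c(1) av by (auto simp: closed_segment_eq_open)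
    next
      case greater
      have "open_segment p w \<subseteq> rel_interior P"
        using rel_interior_closure_convex_segment[OF cvP p] w closure_subset by blast
      moreover have "\<exists>z\<in>closed_segment p w. a \<bullet> z = c"
        using connected_ivt_hyperplane[of "closed_segment p w" w p a c] greater w(2) by auto
      ultimately show ?thesis using greater w(2) by (auto simp: closed_segment_eq_open)
    qed
    then show ?thesis by (auto simp: H_def)
  qed
  have relQ: "rel_interior Q = rel_interior P \<inter> H"
    unfolding Q_def by (rule convex_affine_rel_interior_Int[OF cvP aff_H riQ])
  have dQ: "aff_dim Q = 2"
  proof -
    have "aff_dim Q = aff_dim (rel_interior P \<inter> H)" using relQ cvQ by (metis rel_interior_aff_dim)
    also have "\<dots> = aff_dim (affine hull P \<inter> H)"
    proof -
      have "openin (top_of_set (affine hull P \<inter> H)) (rel_interior P \<inter> H)"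
        using openin_rel_interior[of P] by (auto simp: openin_open)
      moreover have aff: "affine (affine hull P \<inter> H)" using aff_H by (simp add: affine_Int)
      ultimately have "affine hull (rel_interior P \<inter> H) = affine hull P \<inter> H"
        using affine_hull_openin[of "affine hull P \<inter> H" "rel_interior P \<inter> H"] riQ by (simp add: hull_same)
      then show ?thesis by (metis aff_dim_affine_hull)
    qed
    also have "\<dots> = 2"
    proof -
      have "v \<in> affine hull P" "v \<notin> H" using vP av c(1) by (auto simp: hull_inc H_def)
      moreover have "affine hull P \<inter> H \<noteq> {}" using riQ rel_interior_subset hull_subset[of P affine] by blast
      ultimately show ?thesis
        using aff_dim_affine_Int_hyperplane[of "affine hull P" a c] P(2) by (auto simp: H_def)
    qed
    finally show ?thesis .
  qed
  have rf: "rel_frontier Q = Q - rel_interior P"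
    using cvQ relQ by (auto simp: rel_frontier_def Q_def)
  have conn: "connected (rel_frontier Q)"
    using path_connected_sphere_gen[OF cvQ(1,2)] dQ path_connected_imp_connected by simp
  \<comment> \<open>\<open>Y S\<close> and \<open>Y (- S)\<close> collect the sides of the section
    whose polygons have an edge at \<open>v\<close> inside, respectively outside, \<open>S\<close>.
    They would split the connected frontier of the section.\<close>
  define Y where "Y = (\<lambda>T. \<Union>{G \<inter> H |G. G \<in> cells_at (faces P) v 2 \<and> (\<exists>e. e face_of G \<and> e \<in> cells_at (faces P) v 1 \<and> e \<in> T)})"
  have YI: "y \<in> Y T" if "G \<in> cells_at (faces P) v 2" "e face_of G" "e \<in> cells_at (faces P) v 1" "e \<in> T" "y \<in> G" "y \<in> H" for y T G e
    unfolding Y_def using that by blast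
  have edges: "\<exists>e. e face_of G \<and> e \<in> cells_at (faces P) v 1" if G: "G face_of P" "v \<in> G" "G \<noteq> {v}" for G
  proof -
    have "{v} face_of G" using v G(1,2) by (simp add: face_of_face)
    moreover have "polytope G" using G(1) P(1) face_of_polytope_polytope by blast
    ultimately obtain e where "e face_of G" "v \<in> e" "aff_dim e = 1" using edge_at_vertex_exists G(3) by metis
    then show ?thesis using face_of_trans[OF _ G(1)] by (auto simp: cells_at_def)
  qed
  have clY: "closed (Y T)" for T
    unfolding Y_def using finite_cells_at[OF C, of v 2] complex_cell(3)[OF C] clH
    by (intro closed_Union) (auto simp: cells_at_def intro: finite_subset[of _ "(\<lambda>G. G \<inter> H) ` cells_at (faces P) v 2"])
  have YQ: "Y T \<subseteq> rel_frontier Q" for T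
  proof
    fix y assume "y \<in> Y T"
    then obtain G where G: "G face_of P" "aff_dim G = 2" "y \<in> G" "y \<in> H" by (auto simp: Y_def cells_at_def)
    have "G \<noteq> P" using G P(2) by auto
    then have "y \<notin> rel_interior P" using face_of_disjoint_rel_interior[OF G(1)] G(3) by blast
    then show "y \<in> rel_frontier Q" using G(3,4) face_of_imp_subset[OF G(1)] unfolding rf by (auto simp: Q_def)
  qed
  have cover: "rel_frontier Q \<subseteq> Y S \<union> Y (- S)"
  proof
    fix y assume y: "y \<in> rel_frontier Q"
    then have yP: "y \<in> P" "y \<in> H" "y \<notin> rel_interior P" unfolding rf by (auto simp: Q_def)
    obtain G where G: "G facet_of P" "y \<in> G"
      using rel_boundary_of_polyhedron[OF polytope_imp_polyhedron[OF P(1)]] yP by blast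
    then have GP: "G face_of P" "aff_dim G = 2" using P(2) by (auto simp: facet_of_def)
    have vG: "v \<in> G" using H_near[OF GP(1) G(2) yP(2)] .
    have "G \<noteq> {v}" using GP(2) by auto
    then obtain e where e: "e face_of G" "e \<in> cells_at (faces P) v 1" using edges[OF GP(1) vG] by blast
    have "G \<in> cells_at (faces P) v 2" using GP vG by (simp add: cells_at_def)
    then show "y \<in> Y S \<union> Y (- S)" using YI[OF _ e _ G(2) yP(2)] by (cases "e \<in> S") auto
  qed
  \<comment> \<open>A common point lies in the intersection of the two polygons, which then contains
    an edge at \<open>v\<close>. This edge would be both in \<open>S\<close> and outside.\<close>
  have disj: "Y S \<inter> Y (- S) = {}"
  proof (rule ccontr)
    assume "Y S \<inter> Y (- S) \<noteq> {}"
    then obtain y G1 e1 G2 e2 where y: "y \<in> G1" "y \<in> G2" "y \<in> H"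
      and G1: "G1 \<in> cells_at (faces P) v 2" "e1 face_of G1" "e1 \<in> cells_at (faces P) v 1" "e1 \<in> S"
      and G2: "G2 \<in> cells_at (faces P) v 2" "e2 face_of G2" "e2 \<in> cells_at (faces P) v 1" "e2 \<notin> S"
      unfolding Y_def by blast
    have F: "G1 \<inter> G2 face_of G1" "G1 \<inter> G2 face_of G2" "G1 \<inter> G2 face_of P" "v \<in> G1 \<inter> G2"
      using polytopal_complexD(4,5,6)[OF C, of G1 G2] G1(1) G2(1) by (auto simp: cells_at_def)
    have "y \<noteq> v" using y(3) av c(1) by (auto simp: H_def)
    then obtain e where e: "e face_of G1 \<inter> G2" "e \<in> cells_at (faces P) v 1"
      using edges[OF F(3,4)] y by blast
    then have "e face_of G1" "e face_of G2" using F face_of_trans by blast+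
    then show False using no G1 G2 e(2) by blast
  qed
  have ne: "Y T \<noteq> {}" if e: "e \<in> cells_at (faces P) v 1" "e \<in> T" for e T
  proof -
    have eP: "e face_of P" "v \<in> e" "aff_dim e = 1" using e by (auto simp: cells_at_def)
    have "e \<noteq> {v}" using eP by auto
    then obtain y where y: "y \<in> e" "y \<in> H" using meets[OF eP(1,2)] by blast
    obtain x where x: "x \<in> rel_interior e"
      using rel_interior_eq_empty[OF face_of_imp_convex[OF eP(1)]] eP(2) by blast
    have "cells_at (faces P) x 2 \<noteq> {}" using two_facets_at_edge[OF P eP(1,3) x] by auto
    then obtain G where G: "G face_of P" "x \<in> G" "aff_dim G = 2" by (auto simp: cells_at_def)
    have eG: "e face_of G" using complex_cell_subset[OF C, of e G x] eP(1) G(1,2) x by simp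
    then have "G \<in> cells_at (faces P) v 2" using G eP(2) face_of_imp_subset by (auto simp: cells_at_def)
    then have "y \<in> Y T" using YI[of G e T y] eG e y face_of_imp_subset[OF eG] by blast
    then show ?thesis by blast
  qed
  have "closedin (top_of_set (rel_frontier Q)) (Y S)" "closedin (top_of_set (rel_frontier Q)) (Y (- S))"
    using clY YQ by (auto intro: closed_subset)
  moreover have "Y S \<union> Y (- S) = rel_frontier Q" using cover YQ by blast
  moreover have "Y S \<noteq> {}" "Y (- S) \<noteq> {}" using ne[OF e(1)] ne[OF e(2)] S by auto
  ultimately show False using conn disj unfolding connected_closedin_eq by blast
qed

lemma cells_at_faces:
  assumes C: "polytopal_complex \<C>" and P: "P \<in> \<C>"
  shows "cells_at (faces P) x k = {K \<in> cells_at \<C> x k. K \<subseteq> P}"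
proof (intro equalityI subsetI)
  fix K assume "K \<in> cells_at (faces P) x k"
  then show "K \<in> {K \<in> cells_at \<C> x k. K \<subseteq> P}"
    using polytopal_complexD(3)[OF C P] face_of_imp_subset by (auto simp: cells_at_def)
next
  fix K assume K: "K \<in> {K \<in> cells_at \<C> x k. K \<subseteq> P}"
  then have "K \<inter> P = K" "K \<in> \<C>" by (auto simp: cells_at_def)
  then show "K \<in> cells_at (faces P) x k"
    using polytopal_complexD(5)[OF C _ P, of K] K by (auto simp: cells_at_def)
qed

definition star_set :: "'a::euclidean_space set set \<Rightarrow> 'a \<Rightarrow> 'a set" where
  "star_set \<C> x = \<Union>{G \<in> \<C>. x \<in> G}"

text \<open>If no polygon mixes edges of \<open>S\<close> with other edges at \<open>v\<close>, then
  no 3-cell does, by \<open>polytope_vertex_faces_connected\<close>. The cells with edges in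
  \<open>S\<close> and those with edges outside would form two closed sets splitting the punctured
  star.\<close>

lemma vertex_link_connected:
  fixes \<C> :: "'a::euclidean_space set set"
  assumes C: "polytopal_complex \<C>" and d: "\<And>G. G \<in> \<C> \<Longrightarrow> aff_dim G \<le> 3" and v: "{v} \<in> \<C>"
    and conn: "connected (star_set \<C> v - {v})"
    and S: "S \<subseteq> cells_at \<C> v 1" "S \<noteq> {}" "S \<noteq> cells_at \<C> v 1"
  shows "\<exists>G\<in>cells_at \<C> v 2. {e \<in> cells_at \<C> v 1. e \<subseteq> G} \<inter> S \<noteq> {} \<and> \<not> {e \<in> cells_at \<C> v 1. e \<subseteq> G} \<subseteq> S"
proof (rule ccontr)
  assume no: "\<not> ?thesis"
  have vface: "{v} face_of K" if "K \<in> \<C>" "v \<in> K" for K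
    using polytopal_complexD(4)[OF C that(1) v] that(2) by (simp add: Int_insert_right_if1)
  have one_side: "e2 \<in> S" if K: "K \<in> \<C>" "v \<in> K" and e: "e1 \<in> cells_at (faces K) v 1" "e2 \<in> cells_at (faces K) v 1" "e1 \<in> S" for K e1 e2
  proof (rule ccontr)
    assume e2: "e2 \<notin> S"
    have pK: "polytope K" using polytopal_complexD(2)[OF C K(1)] .
    have ef: "e1 face_of K" "e2 face_of K" "aff_dim e1 = 1" "aff_dim e2 = 1" using e by (auto simp: cells_at_def)
    have "aff_dim K \<ge> 1" using aff_dim_subset[OF face_of_imp_subset[OF ef(1)]] ef(3) by simp
    then consider "aff_dim K = 1" | "aff_dim K = 2" | "aff_dim K = 3" using d[OF K(1)] by linarith
    then show False
    proof cases
      case 1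
      then have "e1 = K" "e2 = K"
        using face_of_aff_dim_lt[OF polytope_imp_convex[OF pK] ef(1)] face_of_aff_dim_lt[OF polytope_imp_convex[OF pK] ef(2)] ef by auto
      then show False using e(3) e2 by simp
    next
      case 2
      then have "K \<in> cells_at \<C> v 2" using K by (simp add: cells_at_def)
      then show False using no e e2 unfolding cells_at_faces[OF C K(1)] by blast
    next
      case 3
      then obtain G f f' where G: "G \<in> cells_at (faces K) v 2" "f face_of G" "f' face_of G"
        "f \<in> cells_at (faces K) v 1" "f' \<in> cells_at (faces K) v 1" "f \<in> S" "f' \<notin> S"
        using polytope_vertex_faces_connected[OF pK 3 vface[OF K] e(1,2,3) e2] by blast
      then have "G \<in> cells_at \<C> v 2" "f \<in> cells_at \<C> v 1" "f' \<in> cells_at \<C> v 1" "f \<subseteq> G" "f' \<subseteq> G"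
        using face_of_imp_subset unfolding cells_at_faces[OF C K(1)] by blast+
      then show False using no G(6,7) by blast
    qed
  qed
  define X where "X = (\<lambda>T. \<Union>{K \<in> \<C>. v \<in> K \<and> (\<exists>e\<in>cells_at (faces K) v 1. e \<in> T)})"
  have XI: "y \<in> X T" if "K \<in> \<C>" "v \<in> K" "e \<in> cells_at (faces K) v 1" "e \<in> T" "y \<in> K" for y K e T
    unfolding X_def using that by blast
  have XE: "\<exists>K e. K \<in> \<C> \<and> v \<in> K \<and> e \<in> cells_at (faces K) v 1 \<and> e \<in> T \<and> y \<in> K" if "y \<in> X T" for y T
    using that unfolding X_def by blast
  have clX: "closed (X T)" for T
    unfolding X_def using polytopal_complexD(1)[OF C] complex_cell(3)[OF C] by (intro closed_Union) auto
  have edge: "\<exists>e. e \<in> cells_at (faces K) v 1" if K: "K \<in> \<C>" "v \<in> K" "K \<noteq> {v}" for K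
  proof -
    obtain e where "e face_of K" "v \<in> e" "aff_dim e = 1"
      using edge_at_vertex_exists[OF polytopal_complexD(2)[OF C K(1)] vface[OF K(1,2)] K(3)] .
    then show ?thesis by (auto simp: cells_at_def)
  qed
  have "star_set \<C> v - {v} \<subseteq> X S \<union> X (- S)"
  proof
    fix y assume y: "y \<in> star_set \<C> v - {v}"
    then obtain K where K: "K \<in> \<C>" "v \<in> K" "y \<in> K" "K \<noteq> {v}" by (auto simp: star_set_def)
    obtain e where e: "e \<in> cells_at (faces K) v 1" using edge[OF K(1,2,4)] by blast
    then show "y \<in> X S \<union> X (- S)" using XI[OF K(1,2) e _ K(3)] by (cases "e \<in> S") auto
  qed
  moreover have "X S \<inter> X (- S) \<inter> (star_set \<C> v - {v}) = {}"
  proof (rule ccontr)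
    assume "X S \<inter> X (- S) \<inter> (star_set \<C> v - {v}) \<noteq> {}"
    then obtain y where y: "y \<in> X S" "y \<in> X (- S)" "y \<noteq> v" by blast
    obtain K e where K: "K \<in> \<C>" "v \<in> K" "e \<in> cells_at (faces K) v 1" "e \<in> S" "y \<in> K" using XE[OF y(1)] by blast
    obtain K' e' where K': "K' \<in> \<C>" "v \<in> K'" "e' \<in> cells_at (faces K') v 1" "e' \<in> - S" "y \<in> K'" using XE[OF y(2)] by blast
    \<comment> \<open>Cells that meet in a point other than \<open>v\<close> intersect in a larger
      face through \<open>v\<close>, hence share an edge at \<open>v\<close>.\<close>
    have F: "K \<inter> K' \<in> \<C>" "v \<in> K \<inter> K'" "K \<inter> K' \<noteq> {v}" using polytopal_complexD(6)[OF C K(1) K'(1)] K K' y(3) by auto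
    obtain f where f: "f \<in> cells_at (faces (K \<inter> K')) v 1" using edge[OF F] by blast
    then have "f \<in> cells_at (faces K) v 1" "f \<in> cells_at (faces K') v 1"
      unfolding cells_at_faces[OF C F(1)] cells_at_faces[OF C K(1)] cells_at_faces[OF C K'(1)] by auto
    then show False using one_side[OF K(1,2)] one_side[OF K'(1,2)] K K' by blast
  qed
  moreover have meets: "X T \<inter> (star_set \<C> v - {v}) \<noteq> {}" if e: "e \<in> cells_at \<C> v 1" "e \<in> T" for e T
  proof -
    have eC: "e \<in> \<C>" "v \<in> e" "aff_dim e = 1" using e by (auto simp: cells_at_def)
    have "e \<noteq> {v}" using eC by auto
    then obtain y where y: "y \<in> e" "y \<noteq> v" using eC(2) by blast
    have "e \<in> cells_at (faces e) v 1" using e unfolding cells_at_faces[OF C eC(1)] by blast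
    then have "y \<in> X T" using XI[OF eC(1,2) _ e(2) y(1)] by blast
    then show ?thesis using y eC by (auto simp: star_set_def)
  qed
  moreover have "X S \<inter> (star_set \<C> v - {v}) \<noteq> {}" "X (- S) \<inter> (star_set \<C> v - {v}) \<noteq> {}"
  proof -
    obtain e e' where "e \<in> S" "e' \<in> cells_at \<C> v 1" "e' \<notin> S" using S by blast
    then show "X S \<inter> (star_set \<C> v - {v}) \<noteq> {}" "X (- S) \<inter> (star_set \<C> v - {v}) \<noteq> {}"
      using meets[of e S] meets[of e' "- S"] S(1) by auto
  qed
  ultimately show False using conn clX unfolding connected_closed by blast
qed

lemma frontier_memI: "x \<in> S \<Longrightarrow> x \<notin> interior S \<Longrightarrow> x \<in> frontier S"
  using closure_subset[of S] by (auto simp: frontier_def)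

lemma sum_card_swap:
  assumes "finite A" "finite B"
  shows "(\<Sum>a\<in>A. card {b \<in> B. R a b}) = (\<Sum>b\<in>B. card {a \<in> A. R a b})"
proof -
  have "(\<Sum>a\<in>A. card {b \<in> B. R a b}) = (\<Sum>a\<in>A. \<Sum>b\<in>B. if R a b then 1 else 0)"
    using assms by (simp add: sum.inter_filter[symmetric])
  also have "\<dots> = (\<Sum>b\<in>B. \<Sum>a\<in>A. if R a b then 1 else 0)" by (rule sum.swap)
  also have "\<dots> = (\<Sum>b\<in>B. card {a \<in> A. R a b})"
    using assms by (simp add: sum.inter_filter[symmetric])
  finally show ?thesis .
qed

text \<open>By the dimension of \<open>F\<close>. At a polygon there is a single 3-cell, at an edge
  incidences of polygons and 3-cells are counted twice, at a vertex the link inequality applies.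
  That \<open>x\<close> is a frontier point enters through a polygon lying in only one
  3-cell.\<close>

lemma star_sum_boundary_nonneg:
  fixes \<C> :: "(real ^ 3) set set"
  assumes G: "geometric_complex \<C>" and F: "F \<in> \<C>" "x \<in> rel_interior F" and x: "x \<in> frontier (\<Union>\<C>)"
    and conn: "connected (star_set \<C> x - {x})"
  shows "star_sum \<C> x \<ge> 0"
proof -
  note C = geometric_complexD(1)[OF G]
  have d: "aff_dim K \<le> 3" for K :: "(real ^ 3) set" using aff_dim_le_DIM[of K] by simp
  have xF: "x \<in> F" using F(2) rel_interior_subset by blast
  define A where "A = cells_at \<C> x"
  have fin: "finite (A k)" for k unfolding A_def by (rule finite_cells_at[OF C])
  have full: "P \<in> full_cells \<C> \<longleftrightarrow> P \<in> \<C> \<and> aff_dim P = 3" for P by (simp add: full_cells_def)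
  have star: "star_sum \<C> x = int (card (A 0)) - int (card (A 1)) + int (card (A 2)) - int (card (A 3))"
    unfolding A_def by (rule star_sum_counts[OF C d])
  \<comment> \<open>\<open>x\<close> stays on the frontier of the union of every nonempty family of
    3-cells at \<open>x\<close>, so some polygon through \<open>x\<close> lies in exactly one of
    them.\<close>
  have free: "\<exists>K P. K \<in> A 2 \<and> P \<in> Q \<and> K \<subseteq> P \<and> (\<forall>P'\<in>Q. K \<subseteq> P' \<longrightarrow> P' = P)" if Q: "Q \<subseteq> A 3" "Q \<noteq> {}" for Q
  proof -
    have QF: "Q \<subseteq> full_cells \<C>" using Q(1) by (auto simp: A_def cells_at_def full)
    have "x \<in> \<Union>Q" using Q by (auto simp: A_def cells_at_def)
    moreover have "\<Union>Q \<subseteq> \<Union>\<C>" using Q(1) by (auto simp: A_def cells_at_def)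
    then have "x \<notin> interior (\<Union>Q)" using x interior_mono[of "\<Union>Q" "\<Union>\<C>"] unfolding frontier_def by blast
    ultimately have fr: "x \<in> frontier (\<Union>Q)" by (intro frontier_memI)
    show ?thesis
    proof (rule frontier_facet[OF C QF fr])
      fix K P assume K: "K \<in> \<C>" "x \<in> K" "aff_dim K = int DIM(real ^ 3) - 1" and P: "P \<in> Q" "K \<subseteq> P"
        "\<And>P'. P' \<in> Q \<Longrightarrow> K \<subseteq> P' \<Longrightarrow> P' = P"
      have "K \<in> A 2" using K by (simp add: A_def cells_at_def)
      moreover have "\<forall>P'\<in>Q. K \<subseteq> P' \<longrightarrow> P' = P" using P(3) by blast
      ultimately show ?thesis using P(1,2) by blast
    qed
  qed
  have A3ne: "A 3 \<noteq> {}"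
  proof -
    obtain P where P: "P \<in> full_cells \<C>" "F face_of P" using geometric_complexD(4)[OF G F(1)] by blast
    then have "P \<in> A 3" using xF face_of_imp_subset[OF P(2)] by (auto simp: A_def cells_at_def full)
    then show ?thesis by blast
  qed
  have cF: "A (aff_dim F) = {F}" "\<And>k. k < aff_dim F \<Longrightarrow> A k = {}"
    unfolding A_def using card_one_dim_cells[OF C F] by auto
  have FG: "F \<subseteq> K" if "K \<in> A k" for K k
    using complex_cell_subset[OF C F(1) _ F(2), of K] that face_of_imp_subset by (auto simp: A_def cells_at_def)
  have "aff_dim F \<ge> 0" using xF by (metis aff_dim_negative_iff empty_iff not_less)
  then consider "aff_dim F = 0" | "aff_dim F = 1" | "aff_dim F = 2" | "aff_dim F = 3" using d[of F] by linarith
  then show ?thesis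
  proof cases
    case 4
    then have "x \<in> interior F" using F(2) interior_rel_interior[of F] by simp
    then have "x \<in> interior (\<Union>\<C>)" using F(1) interior_mono[of F "\<Union>\<C>"] by blast
    then show ?thesis using x by (simp add: frontier_def)
  next
    case 3
    obtain K P where K: "K \<in> A 2" "P \<in> A 3" "K \<subseteq> P" "\<forall>P'\<in>A 3. K \<subseteq> P' \<longrightarrow> P' = P"
      using free[OF order_refl A3ne] by blast
    have "K = F" using K(1) cF(1) 3 by simp
    then have "A 3 = {P}" using K FG by blast
    moreover have "A 2 = {F}" "A 1 = {}" "A 0 = {}" using cF 3 by auto
    ultimately show ?thesis using star by simp
  next
    case 2
    have A01: "A 1 = {F}" "A 0 = {}" using cF 2 by auto
    have "card {K \<in> A 2. K \<subseteq> P} = 2" if "P \<in> A 3" for P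
    proof -
      have P: "P \<in> \<C>" "aff_dim P = 3" using that by (auto simp: A_def cells_at_def)
      have "F face_of P" using complex_cell_subset[OF C F(1) P(1) F(2)] that by (auto simp: A_def cells_at_def)
      then show ?thesis
        using two_facets_at_edge[OF polytopal_complexD(2)[OF C P(1)] P(2) _ 2 F(2)] cells_at_faces[OF C P(1), of x 2] by (simp add: A_def)
    qed
    \<comment> \<open>Each 3-cell has two polygons at the edge, each polygon lies in at most two
      3-cells, and one polygon lies in only one. So there are strictly more polygons than
      3-cells.\<close>
    then have "2 * card (A 3) = (\<Sum>P\<in>A 3. card {K \<in> A 2. K \<subseteq> P})" by simp
    also have "\<dots> = (\<Sum>K\<in>A 2. card {P \<in> A 3. K \<subseteq> P})" by (rule sum_card_swap[OF fin fin])
    also have "\<dots> < (\<Sum>K\<in>A 2. 2)"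
    proof (rule sum_strict_mono_ex1[OF fin])
      show "\<forall>K\<in>A 2. card {P \<in> A 3. K \<subseteq> P} \<le> 2"
      proof
        fix K assume K: "K \<in> A 2"
        have "{P \<in> A 3. K \<subseteq> P} \<subseteq> {P \<in> full_cells \<C>. K \<subseteq> P}" by (auto simp: A_def cells_at_def full)
        moreover have "finite {P \<in> full_cells \<C>. K \<subseteq> P}" using polytopal_complexD(1)[OF C] by (simp add: full_cells_def)
        ultimately have "card {P \<in> A 3. K \<subseteq> P} \<le> card {P \<in> full_cells \<C>. K \<subseteq> P}" by (rule card_mono[rotated])
        also have "\<dots> \<le> 2" using K by (intro facet_at_most_two_cells[OF C]) (auto simp: A_def cells_at_def)
        finally show "card {P \<in> A 3. K \<subseteq> P} \<le> 2" .
      qed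
      obtain K P where K: "K \<in> A 2" "P \<in> A 3" "K \<subseteq> P" "\<forall>P'\<in>A 3. K \<subseteq> P' \<longrightarrow> P' = P"
        using free[OF order_refl A3ne] by blast
      then have "{P \<in> A 3. K \<subseteq> P} = {P}" by blast
      then show "\<exists>K\<in>A 2. card {P \<in> A 3. K \<subseteq> P} < 2" using K(1) by (intro bexI[of _ K]) auto
    qed
    finally have "card (A 3) < card (A 2)" by simp
    then show ?thesis using star A01 by simp
  next
    case 1
    then obtain w where "F = {w}" by (auto simp: aff_dim_eq_0)
    then have Fx: "F = {x}" using xF by simp
    have vface: "{x} face_of K" if "K \<in> \<C>" "x \<in> K" for K
      using complex_cell_subset[OF C F(1) that(1) F(2) that(2)] Fx by simp
    define ends where "ends = (\<lambda>K. {e \<in> A 1. e \<subseteq> K})"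
    define bd where "bd = (\<lambda>P. {K \<in> A 2. K \<subseteq> P})"
    have ends2: "card (ends K) = 2" if "K \<in> A 2" for K
    proof -
      have K: "K \<in> \<C>" "aff_dim K = 2" "x \<in> K" using that by (auto simp: A_def cells_at_def)
      show ?thesis
        using two_edges_at_vertex[OF polytopal_complexD(2)[OF C K(1)] K(2) vface[OF K(1,3)]]
          cells_at_faces[OF C K(1), of x 1] by (simp add: ends_def A_def)
    qed
    have edge2: "card {K \<in> bd P. e \<subseteq> K} = 2" if "P \<in> A 3" "e \<in> A 1" "e \<subseteq> P" for P e
    proof -
      have P: "P \<in> \<C>" "aff_dim P = 3" "x \<in> P" and e: "e \<in> \<C>" "aff_dim e = 1" "x \<in> e" using that by (auto simp: A_def cells_at_def)
      obtain y where y: "y \<in> rel_interior e" using rel_interior_eq_empty complex_cell(2)[OF C e(1)] e(3) by blast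
      have yP: "y \<in> P" using y that(3) rel_interior_subset by blast
      \<comment> \<open>The polygons containing the edge are those through a relatively interior
        point \<open>y\<close> of it, where \<open>two_facets_at_edge\<close> counts them.\<close>
      have "{K \<in> bd P. e \<subseteq> K} = cells_at (faces P) y 2"
        unfolding cells_at_faces[OF C P(1)]
      proof (intro equalityI subsetI)
        fix K assume "K \<in> {K \<in> bd P. e \<subseteq> K}"
        then show "K \<in> {K \<in> cells_at \<C> y 2. K \<subseteq> P}" using y rel_interior_subset by (auto simp: bd_def A_def cells_at_def)
      next
        fix K assume K: "K \<in> {K \<in> cells_at \<C> y 2. K \<subseteq> P}"
        then have "e \<subseteq> K" using complex_cell_subset[OF C e(1) _ y, of K] face_of_imp_subset by (auto simp: cells_at_def)
        then show "K \<in> {K \<in> bd P. e \<subseteq> K}" using K e(3) by (auto simp: bd_def A_def cells_at_def)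
      qed
      then show ?thesis
        using two_facets_at_edge[OF polytopal_complexD(2)[OF C P(1)] P(2) complex_cell_subset[OF C e(1) P(1) y yP] e(2) y] by simp
    qed
    have "card (A 1) + card (A 3) \<le> card (A 2) + 1"
    proof (rule connected_planar_link_card[of "A 1" "A 2" "A 3" ends bd])
      show "A 1 \<noteq> {}"
      proof -
        obtain P where P: "P \<in> \<C>" "aff_dim P = 3" "x \<in> P" using A3ne by (auto simp: A_def cells_at_def)
        have "P \<noteq> {x}" using P(2) by auto
        then obtain e where "e face_of P" "x \<in> e" "aff_dim e = 1"
          using edge_at_vertex_exists[OF polytopal_complexD(2)[OF C P(1)] vface[OF P(1,3)]] by metis
        then show ?thesis using polytopal_complexD(3)[OF C P(1)] by (auto simp: A_def cells_at_def)
      qed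
      show "card (ends e) = 2 \<and> ends e \<subseteq> A 1" if "e \<in> A 2" for e using ends2[OF that] by (auto simp: ends_def)
      show "bd f \<subseteq> A 2" for f by (auto simp: bd_def)
      show "even (card {e \<in> bd P. ends e \<inter> S \<noteq> {} \<and> \<not> ends e \<subseteq> S})" if P: "P \<in> A 3" and S: "S \<subseteq> A 1" for P S
      proof -
        have finb: "finite (bd P)" and finS: "finite S" using fin S by (auto simp: bd_def intro: finite_subset)
        have endsS: "ends K \<inter> S = {e \<in> S. e \<subseteq> K}" for K using S by (auto simp: ends_def)
        \<comment> \<open>Each edge of \<open>S\<close> in \<open>P\<close> lies in two polygons of
          \<open>P\<close>, so the incidences are even in number. A polygon contributes an odd
          amount exactly when one of its two edges belongs to \<open>S\<close>.\<close>
        have "(\<Sum>K\<in>bd P. card (ends K \<inter> S)) = (\<Sum>e\<in>S. card {K \<in> bd P. e \<subseteq> K})"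
          unfolding endsS by (rule sum_card_swap[OF finb finS])
        also have "even \<dots>"
        proof (rule dvd_sum)
          fix e assume e: "e \<in> S"
          show "even (card {K \<in> bd P. e \<subseteq> K})"
          proof (cases "e \<subseteq> P")
            case True
            then show ?thesis using edge2[OF P _ True] e S by auto
          next
            case False
            then have "{K \<in> bd P. e \<subseteq> K} = {}" by (auto simp: bd_def)
            then show ?thesis by (simp only: card.empty) simp
          qed
        qed
        finally have "even (\<Sum>K\<in>bd P. card (ends K \<inter> S))" .
        then have ev: "even (card {K \<in> bd P. odd (card (ends K \<inter> S))})"
          using even_sum_iff[OF finb, of "\<lambda>K. card (ends K \<inter> S)"] by simp
        have "odd (card (ends K \<inter> S)) \<longleftrightarrow> ends K \<inter> S \<noteq> {} \<and> \<not> ends K \<subseteq> S" if K: "K \<in> bd P" for K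
        proof -
          obtain e e' where ee: "ends K = {e, e'}" "e \<noteq> e'" using ends2[of K] K by (auto simp: bd_def card_2_iff)
          show ?thesis unfolding ee(1) using ee(2) by (cases "e \<in> S"; cases "e' \<in> S") auto
        qed
        then have "{K \<in> bd P. odd (card (ends K \<inter> S))} = {e \<in> bd P. ends e \<inter> S \<noteq> {} \<and> \<not> ends e \<subseteq> S}" by blast
        then show ?thesis using ev by simp
      qed
      show "\<exists>e\<in>A 2. ends e \<inter> S \<noteq> {} \<and> \<not> ends e \<subseteq> S" if S: "S \<subseteq> A 1" "S \<noteq> {}" "S \<noteq> A 1" for S
        using vertex_link_connected[OF C d _ conn] F(1) Fx S unfolding A_def ends_def by simp
      show "\<exists>P\<in>Q. \<exists>K\<in>bd P. \<forall>P'\<in>Q. K \<in> bd P' \<longrightarrow> P' = P" if "Q \<subseteq> A 3" "Q \<noteq> {}" for Q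
        using free[OF that] by (auto simp: bd_def)
    qed (use fin in auto)
    moreover have "A 0 = {F}" using cF 1 by simp
    ultimately show ?thesis using star by simp
  qed
qed

subsection \<open>Handle additions\<close>

text \<open>In the model ball, a convex neighbourhood of a boundary point stays connected when the
  point is removed. Its image \<open>N\<close> lies in the star, and every other point of the
  punctured star is joined to \<open>N\<close> by a segment towards \<open>x\<close>.\<close>

lemma ball_star_connected:
  fixes \<B> :: "'a::euclidean_space set set"
  assumes B: "polytopal_complex \<B>" and h: "homeomorphism (\<Union>\<B>) (cball (0::'a) 1) f g"
    and x: "x \<in> \<Union>\<B>" "norm (f x) = 1"
  shows "connected (star_set \<B> x - {x})"
proof -
  obtain r where r: "r > 0" "\<And>G. G \<in> \<B> \<Longrightarrow> x \<notin> G \<Longrightarrow> G \<inter> cball x r = {}"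
    using complex_near[OF B, of x] by blast
  have im: "f ` \<Union>\<B> = cball 0 1" "g ` cball 0 1 = \<Union>\<B>" "\<forall>y\<in>\<Union>\<B>. g (f y) = y" "\<forall>z\<in>cball 0 1. f (g z) = z"
    and cont: "continuous_on (\<Union>\<B>) f" "continuous_on (cball 0 1) g"
    using h unfolding homeomorphism_def by blast+
  have fg: "f y \<in> cball 0 1 \<and> g (f y) = y" if "y \<in> \<Union>\<B>" for y
    using im(1,3) that by (metis imageI)
  have gf: "g z \<in> \<Union>\<B> \<and> f (g z) = z" if "z \<in> cball 0 1" for z
    using im(2,4) that by (metis imageI)
  have fx: "f x \<in> cball 0 1" "g (f x) = x" using fg[OF x(1)] by auto
  obtain \<delta> where \<delta>: "\<delta> > 0" "\<And>z. z \<in> cball 0 1 \<Longrightarrow> dist z (f x) < \<delta> \<Longrightarrow> dist (g z) x < r"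
    using cont(2) fx r(1) unfolding continuous_on_iff by metis
  define S where "S = cball 0 1 \<inter> cball (f x) (\<delta> / 2)"
  have S: "convex S" "closed S" "f x \<in> S" using fx(1) \<delta>(1) by (auto simp: S_def convex_Int closed_Int)
  have "f x \<notin> rel_interior S"
  proof
    assume fr: "f x \<in> rel_interior S"
    define \<eta> where "\<eta> = min 1 (\<delta> / 2)"
    have \<eta>: "0 < \<eta>" "\<eta> \<le> 1" "\<eta> \<le> \<delta> / 2" using \<delta>(1) by (auto simp: \<eta>_def)
    \<comment> \<open>A point of \<open>S\<close> on the radius to \<open>f x\<close>. If
      \<open>f x\<close> were relatively interior, the segment from \<open>w\<close> could be
      prolonged beyond \<open>f x\<close>, out of the unit ball.\<close>
    define w where "w = (1 - \<eta>) *\<^sub>R f x"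
    have "dist (f x) w = norm (\<eta> *\<^sub>R f x)" by (simp add: w_def dist_norm algebra_simps)
    then have "w \<in> S" using \<eta> x(2) by (simp add: S_def w_def)
    then obtain e where e: "e > 1" "(1 - e) *\<^sub>R w + e *\<^sub>R f x \<in> S"
      using convex_rel_interior_if[OF S(1) fr] hull_inc[of w S affine] by (metis order_refl)
    have "(1 - e) *\<^sub>R w + e *\<^sub>R f x = (1 + (e - 1) * \<eta>) *\<^sub>R f x" by (simp add: w_def algebra_simps)
    then have "\<bar>1 + (e - 1) * \<eta>\<bar> \<le> 1" using e(2) x(2) by (simp add: S_def)
    moreover have "(e - 1) * \<eta> > 0" using e \<eta> by simp
    ultimately show False by linarith
  qed
  then have connS: "connected (S - {f x})" and neS: "S - {f x} \<noteq> {}"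
    using contractible_convex_minus_boundary_point[OF S(1,2)] S(3) contractible_imp_connected by blast+
  define N where "N = g ` (S - {f x})"
  have connN: "connected N" unfolding N_def
    by (rule connected_continuous_image[OF continuous_on_subset[OF cont(2)] connS]) (auto simp: S_def)
  have near: "y \<in> star_set \<B> x" if y: "y \<in> \<Union>\<B>" "dist y x < r" for y
  proof -
    obtain G where G: "G \<in> \<B>" "y \<in> G" using y(1) by blast
    have "y \<in> cball x r" using y(2) by (simp add: dist_commute)
    then have "x \<in> G" using r(2)[OF G(1)] G(2) by blast
    then show ?thesis using G by (auto simp: star_set_def)
  qed
  have NK: "N \<subseteq> star_set \<B> x - {x}"
  proof
    fix y assume "y \<in> N"
    then obtain z where z: "y = g z" "z \<in> S" "z \<noteq> f x" by (auto simp: N_def)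
    have "z \<in> cball 0 1" using z(2) by (simp add: S_def)
    moreover have "dist z (f x) < \<delta>" using z(2) \<delta>(1) by (simp add: S_def dist_commute)
    ultimately have "y \<in> \<Union>\<B>" "dist y x < r" "f y = z" using gf[of z] \<delta>(2)[of z] z(1) by auto
    then show "y \<in> star_set \<B> x - {x}" using near z(3) by auto
  qed
  \<comment> \<open>The half-open segment leaves out \<open>x\<close> itself; its points with small
    parameter lie in \<open>N\<close>.\<close>
  define L where "L = (\<lambda>y. (\<lambda>t. x + t *\<^sub>R (y - x)) ` {0<..1::real})"
  have L: "connected (N \<union> L y)" "L y \<subseteq> star_set \<B> x - {x}" "y \<in> L y" if y: "y \<in> star_set \<B> x - {x}" for y
  proof -
    obtain G where G: "G \<in> \<B>" "x \<in> G" "y \<in> G" "y \<noteq> x" using y by (auto simp: star_set_def)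
    have in_G: "x + t *\<^sub>R (y - x) \<in> G" if "0 \<le> t" "t \<le> 1" for t
    proof -
      have "(1 - t) *\<^sub>R x + t *\<^sub>R y \<in> G" using complex_cell(2)[OF B G(1)] G that by (intro convexD) auto
      moreover have "(1 - t) *\<^sub>R x + t *\<^sub>R y = x + t *\<^sub>R (y - x)" by (simp add: algebra_simps)
      ultimately show ?thesis by simp
    qed
    show "L y \<subseteq> star_set \<B> x - {x}" using in_G G by (auto simp: L_def star_set_def)
    show "y \<in> L y" unfolding L_def by (intro image_eqI[of _ _ 1]) auto
    have connL: "connected (L y)" unfolding L_def
      by (intro connected_continuous_image continuous_intros) (simp add: convex_connected)
    obtain d where d: "d > 0" "\<And>w. w \<in> \<Union>\<B> \<Longrightarrow> dist w x < d \<Longrightarrow> dist (f w) (f x) < \<delta> / 2"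
      using cont(1) x(1) \<delta>(1) unfolding continuous_on_iff by (metis half_gt_zero)
    define t where "t = min 1 (d / (2 * norm (y - x)))"
    have n0: "norm (y - x) > 0" using G(4) by simp
    have t: "0 < t" "t \<le> 1" "t * norm (y - x) \<le> d / 2"
    proof -
      show "0 < t" "t \<le> 1" using d(1) n0 by (auto simp: t_def)
      have "t \<le> d / (2 * norm (y - x))" by (simp add: t_def)
      then show "t * norm (y - x) \<le> d / 2" using n0 by (simp add: field_simps)
    qed
    define w where "w = x + t *\<^sub>R (y - x)"
    have w: "w \<in> \<Union>\<B>" "w \<noteq> x" "dist w x < d"
      using in_G[of t] t G d(1) by (auto simp: w_def dist_norm)
    have "f w \<noteq> f x" using fg[OF w(1)] fx(2) w(2) by metis
    then have "f w \<in> S - {f x}" using fg[OF w(1)] d(2)[OF w(1,3)] by (auto simp: S_def dist_commute)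
    then have "w \<in> N" unfolding N_def using fg[OF w(1)] by (metis imageI)
    moreover have "w \<in> L y" unfolding L_def w_def using t by auto
    ultimately show "connected (N \<union> L y)" using connN connL by (intro connected_Un) auto
  qed
  have eq: "star_set \<B> x - {x} = \<Union>(insert N ((\<lambda>y. N \<union> L y) ` (star_set \<B> x - {x})))"
  proof (intro equalityI subsetI)
    fix y assume "y \<in> star_set \<B> x - {x}"
    then show "y \<in> \<Union>(insert N ((\<lambda>y. N \<union> L y) ` (star_set \<B> x - {x})))"
      using L(3)[of y] by (intro UnionI[of "N \<union> L y"]) auto
  next
    fix y assume "y \<in> \<Union>(insert N ((\<lambda>y. N \<union> L y) ` (star_set \<B> x - {x})))"
    then consider "y \<in> N" | z where "z \<in> star_set \<B> x - {x}" "y \<in> L z" by blast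
    then show "y \<in> star_set \<B> x - {x}"
    proof cases
      case 1
      then show ?thesis using NK by blast
    next
      case 2
      then show ?thesis using L(2)[OF 2(1)] by blast
    qed
  qed
  have "N \<noteq> {}" using neS by (simp add: N_def)
  then have ne: "\<Inter>(insert N ((\<lambda>y. N \<union> L y) ` (star_set \<B> x - {x}))) \<noteq> {}" by blast
  show ?thesis
    by (subst eq, rule connected_Union[OF _ ne]) (use connN L(1) in blast)
qed

text \<open>A disc is connected and has more than one point, so \<open>x\<close> is not isolated in
  it. The point \<open>w\<close> will make the punctured stars of the two glued complexes
  meet.\<close>

lemma disc_not_isolated:
  fixes \<D> :: "'a::euclidean_space set set"
  assumes D: "polytopal_complex \<D>" "homeomorphic_to_ball 2 (\<Union>\<D>)" "x \<in> \<Union>\<D>"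
  obtains G w where "G \<in> \<D>" "x \<in> G" "w \<in> G" "w \<noteq> x"
proof -
  obtain T :: "'a set" where T: "subspace T" "dim T = 2" "(\<Union>\<D>) homeomorphic (cball 0 1 \<inter> T)"
    using D(2) by (auto simp: homeomorphic_to_ball_def)
  have "convex (cball 0 1 \<inter> T)" using T(1) by (simp add: convex_Int subspace_imp_convex)
  then have "connected (cball 0 1 \<inter> T)" by (rule convex_connected)
  then have conn: "connected (\<Union>\<D>)" using T(3) homeomorphic_connectedness by blast
  have two: "\<not> (\<Union>\<D> \<subseteq> {x})"
  proof
    assume "\<Union>\<D> \<subseteq> {x}"
    then have s: "\<Union>\<D> = {x}" using D(3) by blast
    obtain f g where h: "homeomorphism (\<Union>\<D>) (cball 0 1 \<inter> T) f g" using T(3) homeomorphic_def by blast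
    have im: "cball 0 1 \<inter> T = f ` {x}" using h s by (auto simp: homeomorphism_def)
    have "\<not> T \<subseteq> {0}" using T(2) by (metis dim_eq_0 numeral_neq_zero)
    then obtain t where t: "t \<in> T" "t \<noteq> 0" by blast
    have "(1 / norm t) *\<^sub>R t \<in> cball 0 1 \<inter> T" "0 \<in> cball 0 1 \<inter> T"
      using t T(1) subspace_0 by (auto simp: subspace_scale)
    then have "(1 / norm t) *\<^sub>R t = 0" unfolding im by auto
    then show False using t by simp
  qed
  obtain r where r: "r > 0" "\<And>G. G \<in> \<D> \<Longrightarrow> x \<notin> G \<Longrightarrow> G \<inter> cball x r = {}"
    using complex_near[OF D(1), of x] by blast
  have "\<exists>G\<in>\<D>. x \<in> G \<and> (\<exists>w\<in>G. w \<noteq> x)"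
  proof (rule ccontr)
    assume "\<not> (\<exists>G\<in>\<D>. x \<in> G \<and> (\<exists>w\<in>G. w \<noteq> x))"
    then have triv: "w = x" if "G \<in> \<D>" "x \<in> G" "w \<in> G" for G w using that by blast
    have "\<Union>\<D> \<inter> ball x r \<subseteq> {x}"
    proof
      fix w assume w: "w \<in> \<Union>\<D> \<inter> ball x r"
      then obtain G where G: "G \<in> \<D>" "w \<in> G" by blast
      have "w \<in> cball x r" using w by simp
      then have "x \<in> G" using r(2)[OF G(1)] G(2) by blast
      then show "w \<in> {x}" using triv[OF G(1) _ G(2)] by simp
    qed
    then have "\<Union>\<D> \<subseteq> ball x r \<union> (- {x})" "ball x r \<inter> (- {x}) \<inter> \<Union>\<D> = {}" using r(1) by auto
    moreover have "x \<in> ball x r \<inter> \<Union>\<D>" using D(3) r(1) by simp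
    then have "ball x r \<inter> \<Union>\<D> \<noteq> {}" by blast
    moreover have "(- {x}) \<inter> \<Union>\<D> \<noteq> {}" using two by blast
    ultimately show False
      using connectedD[OF conn, of "ball x r" "- {x}"] by blast
  qed
  then show ?thesis using that by blast
qed

lemma handle_disc_at:
  assumes "\<C> \<inter> \<B> = \<D>\<^sub>1 \<union> \<D>\<^sub>2" "\<Union>\<D>\<^sub>1 \<inter> \<Union>\<D>\<^sub>2 = {}" "x \<in> \<Union>\<D>\<^sub>1"
  shows "star_sum (\<C> \<inter> \<B>) x = star_sum \<D>\<^sub>1 x"
proof -
  have "{F \<in> \<C> \<inter> \<B>. x \<in> F} = {F \<in> \<D>\<^sub>1. x \<in> F}" using assms by blast
  then show ?thesis by (simp only: star_sum_def)
qed

text \<open>Connectedness of the punctured star is carried along because the opposite inequality for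
  \<open>star_sum\<close> assumes it. Under gluing it survives, since the two punctured stars share
  a point of the disc.\<close>

lemma built_by_handles_local:
  fixes \<C> :: "'a::euclidean_space set set"
  assumes "built_by_handles \<C>" and d: "DIM('a) = 3" and "x \<in> frontier (\<Union>\<C>)"
  shows "star_sum \<C> x \<le> 0 \<and> connected (star_set \<C> x - {x})"
  using assms(1,3)
proof (induction arbitrary: x)
  case (polytope P)
  have cv: "convex P" "closed P" using polytope(1) polytope_imp_convex polytope_imp_closed by auto
  have U: "\<Union>(faces P) = P" by (rule Union_faces[OF polytope(1)])
  have x: "x \<in> P" "x \<notin> rel_interior P"
    using polytope(3) frontier_subset_closed[OF cv(2)] interior_rel_interior[OF polytope(2)] unfolding U by (auto simp: frontier_def)
  have "star_set (faces P) x = P" using x(1) cv(1) face_of_imp_subset face_of_refl by (force simp: star_set_def)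
  moreover have "connected (P - {x})"
    using contractible_convex_minus_boundary_point(1)[OF cv _ x(2)] x(1) contractible_imp_connected by blast
  ultimately show ?case using star_sum_polytope[OF polytope(1) x] by simp
next
  case (handle \<C> \<C>')
  obtain \<B> \<D>\<^sub>1 \<D>\<^sub>2 where glue: "is_gluing \<C>' \<C> \<B>" and ballB: "homeomorphic_to_ball DIM('a) (\<Union>\<B>)"
    and D: "subcomplex \<D>\<^sub>1 (\<C> \<inter> \<B>)" "subcomplex \<D>\<^sub>2 (\<C> \<inter> \<B>)" "\<C> \<inter> \<B> = \<D>\<^sub>1 \<union> \<D>\<^sub>2" "\<Union>\<D>\<^sub>1 \<inter> \<Union>\<D>\<^sub>2 = {}"
      "homeomorphic_to_ball (DIM('a) - 1) (\<Union>\<D>\<^sub>1)" "homeomorphic_to_ball (DIM('a) - 1) (\<Union>\<D>\<^sub>2)"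
    using handle.hyps(2) unfolding handle_addition_def by blast
  have C: "polytopal_complex \<C>" and B: "polytopal_complex \<B>" and C': "\<C>' = \<C> \<union> \<B>"
    and meet: "\<Union>\<C> \<inter> \<Union>\<B> = \<Union>(\<C> \<inter> \<B>)"
    using glue geometric_complexD(1) unfolding is_gluing_def by blast+
  have fin: "finite \<C>" "finite \<B>" using polytopal_complexD(1) C B by auto
  have UC': "\<Union>\<C>' = \<Union>\<C> \<union> \<Union>\<B>" using C' by blast
  have x_in: "x \<in> \<Union>\<C> \<union> \<Union>\<B>"
    using handle.prems frontier_subset_closed[OF closed_Un[OF closed_Union_complex(1)[OF C] closed_Union_complex(1)[OF B]]] UC' by auto
  have "x \<notin> interior (\<Union>\<C> \<union> \<Union>\<B>)" using handle.prems UC' by (simp add: frontier_def)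
  \<comment> \<open>A frontier point of the union is interior to neither piece, so the induction
    hypothesis and the statements on balls apply to each piece that contains it.\<close>
  then have nint: "x \<notin> interior (\<Union>\<C>)" "x \<notin> interior (\<Union>\<B>)" using interior_mono[of _ "\<Union>\<C> \<union> \<Union>\<B>"] by blast+
  have LC: "star_sum \<C> x \<le> 0 \<and> connected (star_set \<C> x - {x})" if "x \<in> \<Union>\<C>"
  proof -
    have "x \<in> frontier (\<Union>\<C>)" using that nint(1) by (rule frontier_memI)
    then show ?thesis by (rule handle.IH)
  qed
  have LB: "star_sum \<B> x = 0 \<and> connected (star_set \<B> x - {x})" if xB: "x \<in> \<Union>\<B>"
  proof -
    have fr: "x \<in> frontier (\<Union>\<B>)" using xB nint(2) by (rule frontier_memI)
    obtain f g where h: "homeomorphism (\<Union>\<B>) (cball (0::'a) 1) f g" using ball_homeomorphism[OF ballB] .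
    show ?thesis
      using star_sum_ball[OF B ballB xB fr] ball_star_connected[OF B h xB ball_frontier_image[OF h fr xB]] by blast
  qed
  consider "x \<in> \<Union>\<C>" "x \<notin> \<Union>\<B>" | "x \<in> \<Union>\<B>" "x \<notin> \<Union>\<C>" | "x \<in> \<Union>\<C>" "x \<in> \<Union>\<B>" using x_in by blast
  then show ?case
  proof cases
    case 1
    then have "{F \<in> \<C>'. x \<in> F} = {F \<in> \<C>. x \<in> F}" using C' by blast
    then show ?thesis using LC[OF 1(1)] by (simp add: star_sum_def star_set_def)
  next
    case 2
    then have "{F \<in> \<C>'. x \<in> F} = {F \<in> \<B>. x \<in> F}" using C' by blast
    then show ?thesis using LB[OF 2(1)] by (simp add: star_sum_def star_set_def)
  next
    case 3
    have disc: "star_sum \<D> x \<ge> 0 \<and> (\<exists>w. w \<noteq> x \<and> w \<in> star_set \<C> x \<and> w \<in> star_set \<B> x)"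
      if \<D>: "subcomplex \<D> (\<C> \<inter> \<B>)" "homeomorphic_to_ball (DIM('a) - 1) (\<Union>\<D>)" "x \<in> \<Union>\<D>" for \<D>
    proof -
      have PD: "polytopal_complex \<D>"
        using \<D>(1) polytopal_complex_subset[OF C, of \<D>] unfolding subcomplex_def by blast
      have b2: "homeomorphic_to_ball 2 (\<Union>\<D>)" using \<D>(2) d by simp
      obtain G w where G: "G \<in> \<D>" "x \<in> G" "w \<in> G" "w \<noteq> x" using disc_not_isolated[OF PD b2 \<D>(3)] .
      have "G \<in> \<C>" "G \<in> \<B>" using G(1) \<D>(1) by (auto simp: subcomplex_def)
      then show ?thesis using G star_sum_disc[OF PD b2 \<D>(3)] by (auto simp: star_set_def)
    qed
    \<comment> \<open>The discs are disjoint, so exactly one contains \<open>x\<close>, and only its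
      cells count in the intersection.\<close>
    have "x \<in> \<Union>\<D>\<^sub>1 \<or> x \<in> \<Union>\<D>\<^sub>2" using 3 meet D(3) by blast
    then have key: "star_sum (\<C> \<inter> \<B>) x \<ge> 0 \<and> (\<exists>w. w \<noteq> x \<and> w \<in> star_set \<C> x \<and> w \<in> star_set \<B> x)"
    proof
      assume xD: "x \<in> \<Union>\<D>\<^sub>1"
      then show ?thesis using disc[OF D(1,5) xD] handle_disc_at[OF D(3,4) xD] by simp
    next
      assume xD: "x \<in> \<Union>\<D>\<^sub>2"
      have "\<C> \<inter> \<B> = \<D>\<^sub>2 \<union> \<D>\<^sub>1" "\<Union>\<D>\<^sub>2 \<inter> \<Union>\<D>\<^sub>1 = {}" using D(3,4) by auto
      then show ?thesis using disc[OF D(2,6) xD] handle_disc_at[OF _ _ xD] by metis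
    qed
    have "star_sum \<C>' x + star_sum (\<C> \<inter> \<B>) x = star_sum \<C> x + star_sum \<B> x"
    proof -
      have "{F \<in> \<C>'. x \<in> F} = {F \<in> \<C>. x \<in> F} \<union> {F \<in> \<B>. x \<in> F}"
        "{F \<in> \<C> \<inter> \<B>. x \<in> F} = {F \<in> \<C>. x \<in> F} \<inter> {F \<in> \<B>. x \<in> F}" using C' by auto
      then show ?thesis using fin unfolding star_sum_def by (simp add: sum.union_inter)
    qed
    moreover have "star_set \<C>' x - {x} = (star_set \<C> x - {x}) \<union> (star_set \<B> x - {x})"
      unfolding star_set_def C' by blast
    moreover have "connected ((star_set \<C> x - {x}) \<union> (star_set \<B> x - {x}))"
      using LC[OF 3(1)] LB[OF 3(2)] key by (intro connected_Un) auto
    ultimately show ?thesis using LC[OF 3(1)] LB[OF 3(2)] key by simp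
  qed
qed

subsection \<open>The angle sum of a complex\<close>

lemma boundary_complex_polytopal:
  assumes "polytopal_complex \<C>"
  shows "polytopal_complex (boundary_complex \<C>)"
proof (rule polytopal_complex_subset[OF assms])
  show "face_closed (boundary_complex \<C>)"
    using polytopal_complexD(3)[OF assms] face_of_imp_subset
    unfolding face_closed_def boundary_complex_def by blast
qed (auto simp: boundary_complex_def)

lemma sum_faces_swap:
  fixes f :: "'a::euclidean_space set \<Rightarrow> 'a set \<Rightarrow> 'b::comm_monoid_add"
  assumes C: "polytopal_complex \<C>" and S: "\<S> \<subseteq> \<C>"
  shows "(\<Sum>G\<in>\<S>. \<Sum>F\<in>faces G - {{}}. f G F) = (\<Sum>F\<in>\<C> - {{}}. \<Sum>G\<in>{G\<in>\<S>. F face_of G}. f G F)"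
proof -
  have fin: "finite \<C>" "finite \<S>" using polytopal_complexD(1)[OF C] S finite_subset by auto
  have "(\<Sum>G\<in>\<S>. \<Sum>F\<in>faces G - {{}}. f G F) = (\<Sum>G\<in>\<S>. \<Sum>F\<in>{F\<in>\<C> - {{}}. F face_of G}. f G F)"
  proof (rule sum.cong[OF refl])
    fix G assume "G \<in> \<S>"
    then have "faces G - {{}} = {F\<in>\<C> - {{}}. F face_of G}" using polytopal_complexD(3)[OF C] S by blast
    then show "(\<Sum>F\<in>faces G - {{}}. f G F) = (\<Sum>F\<in>{F\<in>\<C> - {{}}. F face_of G}. f G F)" by simp
  qed
  also have "\<dots> = (\<Sum>F\<in>\<C> - {{}}. \<Sum>G\<in>{G\<in>\<S>. F face_of G}. f G F)"
    by (rule sum.swap_restrict) (use fin in auto)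
  finally show ?thesis .
qed

text \<open>Each sign is multiplied by Euler's relation for its cell, and the sum over pairs of a
  cell and one of its faces is rearranged by faces.\<close>

lemma cell_sum_star_sums:
  fixes \<C> :: "'a::euclidean_space set set"
  assumes C: "polytopal_complex \<C>" and p: "\<And>F. F \<in> \<C> - {{}} \<Longrightarrow> p F \<in> rel_interior F"
  shows "cell_sum \<C> = (\<Sum>F\<in>\<C> - {{}}. cell_sign F * star_sum \<C> (p F))"
proof -
  have "cell_sum \<C> = (\<Sum>G\<in>\<C> - {{}}. \<Sum>F\<in>faces G - {{}}. cell_sign G * cell_sign F)"
    unfolding cell_sum_def
  proof (rule sum.cong[OF refl])
    fix G assume G: "G \<in> \<C> - {{}}"
    then have "(\<Sum>F\<in>faces G - {{}}. cell_sign F) = 1"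
      using euler_relation[OF polytopal_complexD(2)[OF C], of G] by (simp add: cell_sum_def)
    then show "cell_sign G = (\<Sum>F\<in>faces G - {{}}. cell_sign G * cell_sign F)"
      by (simp add: sum_distrib_left[symmetric])
  qed
  also have "\<dots> = (\<Sum>F\<in>\<C> - {{}}. \<Sum>G\<in>{G\<in>\<C> - {{}}. F face_of G}. cell_sign G * cell_sign F)"
    by (rule sum_faces_swap[OF C]) blast
  also have "\<dots> = (\<Sum>F\<in>\<C> - {{}}. cell_sign F * star_sum \<C> (p F))"
  proof (rule sum.cong[OF refl])
    fix F assume F: "F \<in> \<C> - {{}}"
    have "{G\<in>\<C> - {{}}. F face_of G} = {G\<in>\<C>. p F \<in> G}"
    proof (intro equalityI subsetI)
      fix G assume "G \<in> {G\<in>\<C> - {{}}. F face_of G}"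
      then show "G \<in> {G\<in>\<C>. p F \<in> G}" using p[OF F] rel_interior_subset face_of_imp_subset by blast
    next
      fix G assume "G \<in> {G\<in>\<C>. p F \<in> G}"
      then show "G \<in> {G\<in>\<C> - {{}}. F face_of G}"
        using complex_cell_subset[OF C _ _ p[OF F], of G] F by blast
    qed
    then show "(\<Sum>G\<in>{G\<in>\<C> - {{}}. F face_of G}. cell_sign G * cell_sign F) = cell_sign F * star_sum \<C> (p F)"
      by (simp add: star_sum_def sum_distrib_left mult.commute)
  qed
  finally show ?thesis .
qed

lemma boundary_cell_dim:
  fixes \<C> :: "'a::euclidean_space set set"
  assumes C: "polytopal_complex \<C>" and F: "F \<in> boundary_complex \<C>" "F \<noteq> {}"
  shows "0 \<le> aff_dim F" "aff_dim F < int DIM('a)"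
proof -
  have FC: "F \<in> \<C>" "F \<subseteq> frontier (\<Union>\<C>)" using F by (auto simp: boundary_complex_def)
  show "0 \<le> aff_dim F" using F(2) by (metis aff_dim_negative_iff not_less)
  have "aff_dim F \<noteq> int DIM('a)"
  proof
    assume "aff_dim F = int DIM('a)"
    then have "interior F \<noteq> {}"
      using interior_rel_interior[of F] rel_interior_eq_empty[OF complex_cell(2)[OF C FC(1)]] F(2) by simp
    then obtain x where "x \<in> interior F" by blast
    then have "x \<in> interior (\<Union>\<C>)" "x \<in> F" using interior_mono[of F "\<Union>\<C>"] FC(1) interior_subset by blast+
    then show False using FC(2) by (auto simp: frontier_def)
  qed
  then show "aff_dim F < int DIM('a)" using aff_dim_le_DIM[of F] by linarith
qed

lemma interior_of_nonboundary_cell: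
  assumes C: "geometric_complex \<C>" and F: "F \<in> \<C>" "F \<notin> boundary_complex \<C>" "x \<in> rel_interior F"
  shows "x \<in> interior (\<Union>\<C>)"
proof (rule ccontr)
  assume "x \<notin> interior (\<Union>\<C>)"
  moreover have "x \<in> \<Union>\<C>" using F(1,3) rel_interior_subset by blast
  ultimately have "x \<in> frontier (\<Union>\<C>)" by (intro frontier_memI)
  then show False using frontier_cell_boundary[OF C F(1,3)] F(2) by blast
qed

lemma chi_alpha_cell_sums:
  fixes \<C> :: "'a::euclidean_space set set"
  assumes G: "geometric_complex \<C>"
  shows "chi_alpha \<C> = real_of_int (cell_sum (boundary_complex \<C>)) - real_of_int (cell_sum \<C>)"
proof -
  note C = geometric_complexD(1)[OF G]
  define \<B> where "\<B> = boundary_complex \<C> - {{}}"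
  define \<I> where "\<I> = \<C> - {{}} - boundary_complex \<C>"
  have sub: "boundary_complex \<C> \<subseteq> \<C>" by (auto simp: boundary_complex_def)
  have fin: "finite \<B>" "finite \<I>" "finite (\<C> - {{}})"
    using polytopal_complexD(1)[OF C] sub by (auto simp: \<B>_def \<I>_def intro: finite_subset)
  have part: "\<C> - {{}} = \<B> \<union> \<I>" "\<B> \<inter> \<I> = {}" using sub by (auto simp: \<B>_def \<I>_def)
  define s where "s = (\<lambda>F. \<Sum>P\<in>{P \<in> full_cells \<C>. F face_of P}. face_angle P F)"
  have "0 = (\<Sum>P\<in>full_cells \<C>. \<Sum>F\<in>faces P - {{}}. real_of_int (cell_sign F) * face_angle P F)"
  proof (rule sum.neutral[symmetric], rule ballI)
    fix P assume "P \<in> full_cells \<C>"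
    then show "(\<Sum>F\<in>faces P - {{}}. real_of_int (cell_sign F) * face_angle P F) = 0"
      using gram_relation[OF polytopal_complexD(2)[OF C]] by (auto simp: full_cells_def)
  qed
  also have "\<dots> = (\<Sum>F\<in>\<C> - {{}}. real_of_int (cell_sign F) * s F)"
    unfolding s_def sum_distrib_left by (rule sum_faces_swap[OF C geometric_complexD(3)[OF G]])
  also have "\<dots> = (\<Sum>F\<in>\<B>. real_of_int (cell_sign F) * s F) + (\<Sum>F\<in>\<I>. real_of_int (cell_sign F) * s F)"
    unfolding part(1) by (rule sum.union_disjoint[OF fin(1,2) part(2)])
  also have "(\<Sum>F\<in>\<I>. real_of_int (cell_sign F) * s F) = (\<Sum>F\<in>\<I>. real_of_int (cell_sign F))"
  proof (rule sum.cong[OF refl])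
    fix F assume "F \<in> \<I>"
    then have F: "F \<in> \<C>" "F \<noteq> {}" "F \<notin> boundary_complex \<C>" by (auto simp: \<I>_def)
    obtain x where x: "x \<in> rel_interior F" using rel_interior_eq_empty complex_cell(2)[OF C F(1)] F(2) by blast
    have "s F = 1"
      unfolding s_def using interior_angle_sum[OF G F(1) x interior_of_nonboundary_cell[OF G F(1,3) x]] .
    then show "real_of_int (cell_sign F) * s F = real_of_int (cell_sign F)" by simp
  qed
  finally have gram: "(\<Sum>F\<in>\<B>. real_of_int (cell_sign F) * s F) = - (\<Sum>F\<in>\<I>. real_of_int (cell_sign F))" by simp
  have "chi_alpha \<C> = (\<Sum>i<DIM('a). \<Sum>F\<in>{F \<in> \<B>. nat (aff_dim F) = i}. real_of_int (cell_sign F) * s F)"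
    unfolding chi_alpha_def angle_sum_def sum_distrib_left
  proof (rule sum.cong[OF refl])
    fix i
    \<comment> \<open>The empty cell has dimension -1, which \<open>nat\<close> would send to 0. It
      is excluded from \<open>\<B>\<close>, so grouping by \<open>nat\<close> of the dimension is
      faithful.\<close>
    have "{F \<in> boundary_complex \<C>. aff_dim F = int i} = {F \<in> \<B>. nat (aff_dim F) = i}"
    proof (intro equalityI subsetI)
      fix F assume "F \<in> {F \<in> \<B>. nat (aff_dim F) = i}"
      then show "F \<in> {F \<in> boundary_complex \<C>. aff_dim F = int i}"
        using boundary_cell_dim(1)[OF C, of F] by (auto simp: \<B>_def)
    qed (auto simp: \<B>_def)
    then show "(\<Sum>F\<in>{F \<in> boundary_complex \<C>. aff_dim F = int i}. (- 1) ^ i * solid_angle F \<C>) =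
        (\<Sum>F\<in>{F \<in> \<B>. nat (aff_dim F) = i}. real_of_int (cell_sign F) * s F)"
      using solid_angle_eq[OF G] sub by (intro sum.cong) (auto simp: \<B>_def s_def cell_sign_def)
  qed
  also have "\<dots> = (\<Sum>F\<in>\<B>. real_of_int (cell_sign F) * s F)"
  proof (rule sum.group[OF fin(1)])
    show "(\<lambda>F. nat (aff_dim F)) ` \<B> \<subseteq> {..<DIM('a)}"
      using boundary_cell_dim[OF C] by (force simp: \<B>_def)
  qed simp
  also have "\<dots> = - real_of_int (\<Sum>F\<in>\<I>. cell_sign F)" using gram by simp
  also have "(\<Sum>F\<in>\<I>. cell_sign F) = cell_sum \<C> - cell_sum (boundary_complex \<C>)"
    using sum.union_disjoint[OF fin(1,2) part(2), of cell_sign] part(1)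
    by (simp add: cell_sum_def \<B>_def)
  finally show ?thesis by simp
qed

lemma cell_sum_boundary:
  fixes \<C> :: "(real ^ 3) set set"
  assumes G: "geometric_complex \<C>" and b: "built_by_handles \<C>"
  shows "cell_sum (boundary_complex \<C>) = 2 * cell_sum \<C>"
proof -
  note C = geometric_complexD(1)[OF G]
  define p where "p = (\<lambda>F :: (real ^ 3) set. SOME x. x \<in> rel_interior F)"
  have p: "p F \<in> rel_interior F" if "F \<in> \<C> - {{}}" for F
  proof -
    have "rel_interior F \<noteq> {}" using rel_interior_eq_empty complex_cell(2)[OF C] that by blast
    then show ?thesis unfolding p_def by (simp add: some_in_eq)
  qed
  have sub: "boundary_complex \<C> \<subseteq> \<C>" by (auto simp: boundary_complex_def)
  have star: "star_sum \<C> (p F) = (if F \<in> boundary_complex \<C> then 0 else - 1)" if F: "F \<in> \<C> - {{}}" for F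
  proof (cases "F \<in> boundary_complex \<C>")
    case True
    have "p F \<in> frontier (\<Union>\<C>)" using True p[OF F] rel_interior_subset by (auto simp: boundary_complex_def)
    moreover from this have "star_sum \<C> (p F) \<le> 0" "connected (star_set \<C> (p F) - {p F})"
      using built_by_handles_local[OF b] by auto
    ultimately show ?thesis using star_sum_boundary_nonneg[OF G _ p[OF F]] F True by fastforce
  next
    case False
    then have "p F \<in> interior (\<Union>\<C>)" using interior_of_nonboundary_cell[OF G _ _ p[OF F]] F by blast
    then show ?thesis using star_sum_interior[OF C] False by simp
  qed
  have fin: "finite (\<C> - {{}})" using polytopal_complexD(1)[OF C] by simp
  have "cell_sum \<C> = (\<Sum>F\<in>\<C> - {{}}. cell_sign F * star_sum \<C> (p F))" by (rule cell_sum_star_sums[OF C p])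
  \<comment> \<open>The values 0 on the boundary and -1 elsewhere are written as the indicator of
    the boundary minus 1, which splits the sum into two cell sums.\<close>
  also have "\<dots> = (\<Sum>F\<in>\<C> - {{}}. (if F \<in> boundary_complex \<C> - {{}} then cell_sign F else 0) - cell_sign F)"
    using star by (intro sum.cong) auto
  also have "\<dots> = (\<Sum>F\<in>\<C> - {{}}. if F \<in> boundary_complex \<C> - {{}} then cell_sign F else 0) - cell_sum \<C>"
    by (simp add: sum_subtractf cell_sum_def)
  also have "(\<Sum>F\<in>\<C> - {{}}. if F \<in> boundary_complex \<C> - {{}} then cell_sign F else 0) = cell_sum (boundary_complex \<C>)"
    unfolding cell_sum_def sum.inter_restrict[OF fin, symmetric]
    by (rule sum.cong) (use sub in auto)
  finally show ?thesis by simp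
qed

theorem corollary3p3p4:
  fixes \<C> :: "(real ^ 3) set set" and g :: nat and \<Sigma> :: "'b topology"
  assumes "geometric_complex \<C>"
    and "built_by_handles \<C>"
    and "closed_orientable_surface g \<Sigma>"
    and "top_of_set (\<Union>(boundary_complex \<C>)) homeomorphic_space \<Sigma>"
  shows "chi_alpha \<C> = 1 - real g"
proof -
  note C = geometric_complexD(1)[OF assms(1)]
  have "euler_pair \<Sigma> {} (cell_sum (boundary_complex \<C>))"
    by (rule euler_pair_homotopy[OF homeomorphic_imp_homotopy_equivalent_space[OF assms(4)]])
       (rule euler_complex[OF boundary_complex_polytopal[OF C]])
  then have "euler_char \<Sigma> = cell_sum (boundary_complex \<C>)" by (rule euler_char_eq)
  then have "cell_sum (boundary_complex \<C>) = 2 - 2 * int g"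
    using assms(3) by (simp add: closed_orientable_surface_def)
  then show ?thesis
    using chi_alpha_cell_sums[OF assms(1)] cell_sum_boundary[OF assms(1,2)] by linarith
qed

end
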